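(* Let $n\ge1$ and consider an exceptional set for the quiver of type $\mathbb A_n$ with straight orientation. A strand $c(i,j)$ (with $i<j$) of its strand diagram corresponds to a relatively projective object $M_{i,j}$ in the exceptional set if and only if the unique path from $i$ to $n$ in the strand diagram passes through $j$.
   Context: The quiver is $1\to2\to\cdots\to n$ over a field $\Bbbk$; modules are finite dimensional. For $0\le i<j\le n$, $M_{i,j}$ is the indecomposable module with support $(i,j]=\{i+1,\dots,j\}$. An exceptional sequence is a sequence $(E_1,\dots,E_n)$ of indecomposable modules with $\mathrm{Ext}^1(E_p,E_p)=0$ and $\mathrm{Hom}(E_p,E_q)=0=\mathrm{Ext}^1(E_p,E_q)$ for all $q<p$; an exceptional set is a set of $n$ modules which can be so ordered. $E_p$ is relatively projective in the sequence if it is a projective object of $(E_{p+1}\oplus\cdots\oplus E_n)^\perp$, where $V^\perp$ is the full subcategory of modules $W$ with $\mathrm{Hom}(V,W)=0=\mathrm{Ext}^1(V,W)$; this property does not depend on the ordering of the exceptional set into an exceptional sequence. The strand diagram of an exceptional set is the graph with vertex set $\{0,1,\dots,n\}$ and an edge (strand) $c(i,j)$ joining $i$ and $j$ for each object $M_{i,j}$ of the set; it is a tree. *)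

theory Defs
  imports "Jordan_Normal_Form.Matrix" "Graph_Theory.Arc_Walk"
begin

section \<open>Representations of the quiver 1 -> 2 -> ... -> n\<close>

text \<open>A finite-dimensional module is given in coordinates: the space at vertex x is the
  space of column vectors of length \<open>vdim V x\<close> over the field, and \<open>vmap V x\<close> is the matrix of
  the arrow from x to x + 1.  Every finite-dimensional module is isomorphic to one of this form.
  Only the data at the vertices 1, ..., n and the arrows starting at 1, ..., n - 1 matter; the
  other values of the two functions are junk, and no notion below depends on them.\<close>

record 'k rep =
  vdim :: "nat \<Rightarrow> nat"
  vmap :: "nat \<Rightarrow> 'k mat"

definition is_rep :: "nat \<Rightarrow> 'k rep \<Rightarrow> bool" where
  "is_rep n V \<longleftrightarrow> (\<forall>x\<in>{1..<n}. vmap V x \<in> carrier_mat (vdim V (x + 1)) (vdim V x))"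

definition rep_hom :: "nat \<Rightarrow> 'k::field rep \<Rightarrow> 'k rep \<Rightarrow> (nat \<Rightarrow> 'k mat) \<Rightarrow> bool" where
  "rep_hom n V W f \<longleftrightarrow>
     (\<forall>x\<in>{1..n}. f x \<in> carrier_mat (vdim W x) (vdim V x)) \<and>
     (\<forall>x\<in>{1..<n}. f (x + 1) * vmap V x = vmap W x * f x)"

definition rep_iso :: "nat \<Rightarrow> 'k::field rep \<Rightarrow> 'k rep \<Rightarrow> bool" where
  "rep_iso n V W \<longleftrightarrow>
     (\<exists>f g. rep_hom n V W f \<and> rep_hom n W V g \<and>
        (\<forall>x\<in>{1..n}. g x * f x = 1\<^sub>m (vdim V x) \<and> f x * g x = 1\<^sub>m (vdim W x)))"

definition nonzero_rep :: "nat \<Rightarrow> 'k rep \<Rightarrow> bool" where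
  "nonzero_rep n V \<longleftrightarrow> (\<exists>x\<in>{1..n}. vdim V x \<noteq> 0)"

definition zero_rep :: "'k::field rep" where
  "zero_rep = \<lparr>vdim = (\<lambda>_. 0), vmap = (\<lambda>_. 0\<^sub>m 0 0)\<rparr>"

definition direct_sum :: "'k::field rep \<Rightarrow> 'k rep \<Rightarrow> 'k rep" where
  "direct_sum V W =
     \<lparr>vdim = (\<lambda>x. vdim V x + vdim W x),
      vmap = (\<lambda>x. four_block_mat
                (vmap V x) (0\<^sub>m (vdim V (x + 1)) (vdim W x))
                (0\<^sub>m (vdim W (x + 1)) (vdim V x)) (vmap W x))\<rparr>"

definition direct_sum_list :: "'k::field rep list \<Rightarrow> 'k rep" where
  "direct_sum_list Vs = foldr direct_sum Vs zero_rep"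

definition indecomposable :: "nat \<Rightarrow> 'k::field rep \<Rightarrow> bool" where
  "indecomposable n V \<longleftrightarrow> is_rep n V \<and> nonzero_rep n V \<and>
     (\<forall>A B. is_rep n A \<longrightarrow> is_rep n B \<longrightarrow> rep_iso n V (direct_sum A B) \<longrightarrow>
        \<not> (nonzero_rep n A \<and> nonzero_rep n B))"

text \<open>The module \<open>M\<^sub>i\<^sub>,\<^sub>j\<close>: the ground field at the vertices i + 1, ..., j and identity maps
  between them.\<close>

definition interval_rep :: "nat \<Rightarrow> nat \<Rightarrow> 'k::field rep" where
  "interval_rep i j =
     (let d = (\<lambda>x. if i < x \<and> x \<le> j then 1 else 0) in
      \<lparr>vdim = d,
       vmap = (\<lambda>x. if i < x \<and> x + 1 \<le> j then 1\<^sub>m 1 else 0\<^sub>m (d (x + 1)) (d x))\<rparr>)"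


section \<open>Vanishing of Hom and of first extension groups\<close>

definition Hom_zero :: "nat \<Rightarrow> 'k::field rep \<Rightarrow> 'k rep \<Rightarrow> bool" where
  "Hom_zero n V W \<longleftrightarrow>
     (\<forall>f. rep_hom n V W f \<longrightarrow> (\<forall>x\<in>{1..n}. f x = 0\<^sub>m (vdim W x) (vdim V x)))"

text \<open>\<open>0 \<rightarrow> W \<rightarrow> X \<rightarrow> V \<rightarrow> 0\<close> with maps f and g; exactness is checked at each vertex.\<close>

definition short_exact ::
  "nat \<Rightarrow> 'k::field rep \<Rightarrow> (nat \<Rightarrow> 'k mat) \<Rightarrow> 'k rep \<Rightarrow> (nat \<Rightarrow> 'k mat) \<Rightarrow> 'k rep \<Rightarrow> bool" where
  "short_exact n W f X g V \<longleftrightarrow> rep_hom n W X f \<and> rep_hom n X V g \<and>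
     (\<forall>x\<in>{1..n}.
        inj_on (\<lambda>w. f x *\<^sub>v w) (carrier_vec (vdim W x)) \<and>
        (\<lambda>w. f x *\<^sub>v w) ` carrier_vec (vdim W x)
          = {u \<in> carrier_vec (vdim X x). g x *\<^sub>v u = 0\<^sub>v (vdim V x)} \<and>
        (\<lambda>u. g x *\<^sub>v u) ` carrier_vec (vdim X x) = carrier_vec (vdim V x))"

text \<open>\<open>Ext\<^sup>1(V, W) = 0\<close> in the sense of Yoneda: every extension of V by W splits.\<close>

definition Ext1_zero :: "nat \<Rightarrow> 'k::field rep \<Rightarrow> 'k rep \<Rightarrow> bool" where
  "Ext1_zero n V W \<longleftrightarrow>
     (\<forall>X f g. is_rep n X \<longrightarrow> short_exact n W f X g V \<longrightarrow>
        (\<exists>s. rep_hom n V X s \<and> (\<forall>x\<in>{1..n}. g x * s x = 1\<^sub>m (vdim V x))))"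

definition perp :: "nat \<Rightarrow> 'k::field rep \<Rightarrow> 'k rep set" where
  "perp n V = {W. is_rep n W \<and> Hom_zero n V W \<and> Ext1_zero n V W}"


section \<open>Projective objects of a full subcategory\<close>

text \<open>A full subcategory is given by its set of objects.  Epimorphisms are those of the
  subcategory: they are tested against objects of the subcategory only.\<close>

definition epi_in :: "nat \<Rightarrow> 'k::field rep set \<Rightarrow> 'k rep \<Rightarrow> 'k rep \<Rightarrow> (nat \<Rightarrow> 'k mat) \<Rightarrow> bool" where
  "epi_in n \<C> X Y g \<longleftrightarrow> rep_hom n X Y g \<and>
     (\<forall>Z\<in>\<C>. \<forall>u v. rep_hom n Y Z u \<longrightarrow> rep_hom n Y Z v \<longrightarrow>
        (\<forall>x\<in>{1..n}. u x * g x = v x * g x) \<longrightarrow> (\<forall>x\<in>{1..n}. u x = v x))"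

definition projective_in :: "nat \<Rightarrow> 'k::field rep set \<Rightarrow> 'k rep \<Rightarrow> bool" where
  "projective_in n \<C> P \<longleftrightarrow> P \<in> \<C> \<and>
     (\<forall>X\<in>\<C>. \<forall>Y\<in>\<C>. \<forall>g f. epi_in n \<C> X Y g \<longrightarrow> rep_hom n P Y f \<longrightarrow>
        (\<exists>h. rep_hom n P X h \<and> (\<forall>x\<in>{1..n}. g x * h x = f x)))"


section \<open>Exceptional sequences and strand diagrams\<close>

text \<open>Lists are indexed from 0.\<close>

definition exceptional_sequence :: "nat \<Rightarrow> 'k::field rep list \<Rightarrow> bool" where
  "exceptional_sequence n Es \<longleftrightarrow> length Es = n \<and>
     (\<forall>p<n. indecomposable n (Es ! p) \<and> Ext1_zero n (Es ! p) (Es ! p) \<and>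
        (\<forall>q<p. Hom_zero n (Es ! p) (Es ! q) \<and> Ext1_zero n (Es ! p) (Es ! q)))"

definition exceptional_set :: "nat \<Rightarrow> 'k::field rep set \<Rightarrow> bool" where
  "exceptional_set n S \<longleftrightarrow> card S = n \<and> (\<exists>Es. exceptional_sequence n Es \<and> set Es = S)"

definition relatively_projective :: "nat \<Rightarrow> 'k::field rep list \<Rightarrow> nat \<Rightarrow> bool" where
  "relatively_projective n Es p \<longleftrightarrow>
     projective_in n (perp n (direct_sum_list (drop (Suc p) Es))) (Es ! p)"

definition strands :: "nat \<Rightarrow> 'k::field rep set \<Rightarrow> (nat \<times> nat) set" where
  "strands n S = {(i, j). i < j \<and> j \<le> n \<and> (\<exists>E\<in>S. rep_iso n E (interval_rep i j))}"

text \<open>The undirected strand diagram as a symmetric digraph: each strand gives two opposite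
  arcs, so undirected paths are exactly the paths (\<open>apath\<close>) of the digraph.\<close>

definition strand_diagram :: "nat \<Rightarrow> 'k::field rep set \<Rightarrow> (nat, nat \<times> nat) pre_digraph" where
  "strand_diagram n S =
     \<lparr>verts = {0..n}, arcs = strands n S \<union> (strands n S)\<inverse>, tail = fst, head = snd\<rparr>"

definition is_strand_path :: "nat \<Rightarrow> 'k::field rep set \<Rightarrow> nat \<Rightarrow> (nat \<times> nat) list \<Rightarrow> nat \<Rightarrow> bool" where
  "is_strand_path n S u w v \<longleftrightarrow> pre_digraph.apath (strand_diagram n S) u w v"

definition path_vertices :: "nat \<Rightarrow> 'k::field rep set \<Rightarrow> nat \<Rightarrow> (nat \<times> nat) list \<Rightarrow> nat set" where
  "path_vertices n S u w = set (pre_digraph.awalk_verts (strand_diagram n S) u w)"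

end

theory Submission
  imports Defs
begin

text \<open>Write \<open>U\<^sub>a\<close> for the space of W at the vertex a + 1, and \<open>U\<^sub>n = 0\<close>.  Then
  \<open>Hom(M\<^sub>a\<^sub>,\<^sub>b, W)\<close> and \<open>Ext\<^sup>1(M\<^sub>a\<^sub>,\<^sub>b, W)\<close> are the kernel and the cokernel of
  \<open>U\<^sub>a \<rightarrow> U\<^sub>b\<close>, so W lies in the perpendicular category of a set of strands if and only if this
  map is bijective for each strand (a, b) of the set, and hence for any vertices a < b of one
  component of the graph they form.  In particular the end points of a strand of an exceptional
  sequence lie both inside or both outside \<open>[c, d)\<close> for every earlier strand (c, d); this makes
  the diagram a noncrossing tree.

  Let K be the component of j under the strands after (i, j).  If K contains n or a vertex k < i,
  then \<open>U\<^sub>i \<rightarrow> U\<^sub>j\<close> is surjective on the whole perpendicular category, because \<open>U\<^sub>j = 0\<close> or the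
  bijection \<open>U\<^sub>k \<rightarrow> U\<^sub>j\<close> passes through \<open>U\<^sub>i\<close>, and \<open>M\<^sub>i\<^sub>,\<^sub>j\<close> is projective there.  Otherwise
  j = min K and, with m = max K < n, the non-split epimorphism from \<open>M\<^sub>i\<^sub>,\<^sub>m\<^sub>+\<^sub>1\<close> to \<open>M\<^sub>i\<^sub>,\<^sub>j\<close>
  lies in that category.  Since the tree is noncrossing, K contains n or a vertex below i exactly
  when n is on the side of j after the strand (i, j) is removed.\<close>

subsection \<open>Matrices\<close>

text \<open>The path algebra is hereditary: any family of matrices on the arrows is a module, so
  every quiver cocycle defines an extension. Vanishing of Ext thus becomes solvability of linear
  equations along the arrows, and Ext is right exact in its second argument. The latter makes
  perpendicular categories closed under cokernels, which is needed because \<open>epi_in\<close>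
  tests epimorphisms within the subcategory only, whereas a lifting argument needs surjectivity at a
  vertex. The objects of the sequence are interval modules only up to isomorphism, and
  \<open>perp\<close> is formed with respect to one direct sum; retractions handle both.

  On the combinatorial side noncrossing alone does not exclude cycles: the triangle on 0, 1, 2 is
  noncrossing. What excludes them is that the intervals are half-open, so that strands with a common
  end point are constrained by their order in the sequence as well. Counting components then shows
  that the n strands connect all n + 1 vertices, hence that n lies on exactly one side once a strand
  is removed.\<close>

lemma mat_mult_assoc:
  "dim_col A = dim_row B \<Longrightarrow> dim_col B = dim_row C \<Longrightarrow> A * B * C = A * (B * C :: 'a::semiring_0 mat)"
  by (rule assoc_mult_mat[of _ "dim_row A" "dim_row B" _ "dim_row C" _ "dim_col C"]) auto

text \<open>As for its neighbours, the premises are equations between dimensions, which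
  simplification can settle from known sizes; \<open>carrier_mat\<close> premises would contain
  dimensions that have to be guessed.\<close>

lemma mat_mult_add:
  "dim_col A = dim_row B \<Longrightarrow> dim_row C = dim_row B \<Longrightarrow> dim_col C = dim_col B \<Longrightarrow>
    A * (B + C) = A * B + (A * C :: 'a::semiring_0 mat)"
  by (rule mult_add_distrib_mat[of _ "dim_row A" "dim_row B" _ "dim_col B"]) auto

lemma mat_add_mult:
  "dim_col A = dim_row C \<Longrightarrow> dim_row B = dim_row A \<Longrightarrow> dim_col B = dim_col A \<Longrightarrow>
    (A + B) * C = A * C + (B * C :: 'a::semiring_0 mat)"
  by (rule add_mult_distrib_mat[of _ "dim_row A" "dim_col A" _ _ "dim_col C"]) auto

lemma mat_mult_minus:
  "dim_col A = dim_row B \<Longrightarrow> dim_row C = dim_row B \<Longrightarrow> dim_col C = dim_col B \<Longrightarrow>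
    A * (B - C) = A * B - (A * C :: 'a::ring mat)"
  by (rule mult_minus_distrib_mat[of _ "dim_row A" "dim_row B" _ "dim_col B"]) auto

lemma mat_minus_mult:
  "dim_col A = dim_row C \<Longrightarrow> dim_row B = dim_row A \<Longrightarrow> dim_col B = dim_col A \<Longrightarrow>
    (A - B) * C = A * C - (B * C :: 'a::ring mat)"
  by (rule minus_mult_distrib_mat[of _ "dim_row A" "dim_col A" _ _ "dim_col C"]) auto

lemma mat_zero_mult: "dim_row A = k \<Longrightarrow> 0\<^sub>m r k * A = 0\<^sub>m r (dim_col A :: nat)"
  for A :: "'a::semiring_0 mat"
  by (rule eq_matI) (auto simp: scalar_prod_def)

lemma mat_mult_zero: "dim_col A = k \<Longrightarrow> A * 0\<^sub>m k c = 0\<^sub>m (dim_row A) (c :: nat)"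
  for A :: "'a::semiring_0 mat"
  by (rule eq_matI) (auto simp: scalar_prod_def)

lemma mat_mult_dim0: "dim_row B = 0 \<Longrightarrow> A * B = 0\<^sub>m (dim_row A) (dim_col B)"
  for A :: "'a::semiring_0 mat"
  by (rule eq_matI) (auto simp: scalar_prod_def)

lemma mat_ext: "A \<in> carrier_mat r c \<Longrightarrow> B \<in> carrier_mat r c \<Longrightarrow>
   (\<And>i j. i < r \<Longrightarrow> j < c \<Longrightarrow> A $$ (i, j) = B $$ (i, j)) \<Longrightarrow> A = B"
  by (rule eq_matI) auto

text \<open>Preimages are chosen column by column. This turns exactness, stated for vectors, into
  equations between matrices.\<close>

lemma factor_through:
  fixes A M :: "'a::comm_ring_1 mat"
  assumes A: "A \<in> carrier_mat r k" and M: "M \<in> carrier_mat r c"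
    and img: "\<And>j. j < c \<Longrightarrow> \<exists>w\<in>carrier_vec k. A *\<^sub>v w = col M j"
  shows "\<exists>N\<in>carrier_mat k c. A * N = M"
proof -
  obtain w where w: "\<And>j. j < c \<Longrightarrow> w j \<in> carrier_vec k \<and> A *\<^sub>v w j = col M j"
    using img by metis
  define N where "N = mat k c (\<lambda>(i, j). w j $ i)"
  have N: "N \<in> carrier_mat k c" by (simp add: N_def)
  have col: "col N j = w j" if "j < c" for j
    using w[OF that] that by (intro eq_vecI) (auto simp: N_def)
  have "A * N = M"
  proof (rule mat_col_eqI)
    fix j assume "j < dim_col M"
    then have j: "j < c" using M by simp
    then have "col (A * N) j = A *\<^sub>v col N j" by (rule col_mult2[OF A N])
    then show "col (A * N) j = col M j" using w[OF j] col[OF j] by simp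
  qed (use A M N in auto)
  then show ?thesis using N by blast
qed

text \<open>The cokernel of a single nonzero column, with a splitting. Any nonzero entry p of v can
  serve as a pivot.\<close>

lemma vector_complement:
  fixes v :: "'a::field mat"
  assumes v: "v \<in> carrier_mat (Suc r) 1" and nz: "v \<noteq> 0\<^sub>m (Suc r) 1"
  shows "\<exists>B s t. B \<in> carrier_mat r (Suc r) \<and> s \<in> carrier_mat (Suc r) r \<and> t \<in> carrier_mat 1 (Suc r) \<and>
    B * v = 0\<^sub>m r 1 \<and> B * s = 1\<^sub>m r \<and> s * B + v * t = 1\<^sub>m (Suc r)"
proof -
  obtain p where p: "p < Suc r" "v $$ (p, 0) \<noteq> 0"
  proof -
    have "\<exists>p<Suc r. v $$ (p, 0) \<noteq> 0"
    proof (rule ccontr)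
      assume *: "\<not> ?thesis"
      have "v = 0\<^sub>m (Suc r) 1" by (rule mat_ext[OF v]) (use * in auto)
      then show False using nz by simp
    qed
    then show thesis using that by blast
  qed
  define c where "c i = v $$ (i, 0)" for i
  \<comment> \<open>Enumerates the indices other than the pivot p.\<close>
  define \<sigma> where "\<sigma> i = (if i < p then i else Suc i)" for i
  \<comment> \<open>B subtracts from a vector the multiple of v that cancels its pivot entry and
    then deletes that entry; t returns the multiple, and s puts a zero back at p.\<close>
  define B where "B = mat r (Suc r) (\<lambda>(i, j). (if j = \<sigma> i then 1 else 0) - (if j = p then c (\<sigma> i) / c p else 0))"
  define s where "s = mat (Suc r) r (\<lambda>(i, j). if i = \<sigma> j then (1::'a) else 0)"
  define t where "t = mat 1 (Suc r) (\<lambda>(i, j). if j = p then 1 / c p else (0::'a))"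
  have cp: "c p \<noteq> 0" using p by (simp add: c_def)
  have \<sigma>: "\<sigma> i \<noteq> p" "i < r \<Longrightarrow> \<sigma> i < Suc r" for i using p
    by (auto simp: \<sigma>_def)
  have \<sigma>_inj: "\<sigma> i = \<sigma> j \<longleftrightarrow> i = j" for i j
    by (auto simp: \<sigma>_def)
  have car: "B \<in> carrier_mat r (Suc r)" "s \<in> carrier_mat (Suc r) r" "t \<in> carrier_mat 1 (Suc r)"
    by (auto simp: B_def s_def t_def)
  have sum2: "(\<Sum>k = 0..<Suc r. ((if k = \<sigma> i then 1 else 0) - (if k = p then x else 0)) * f k) = f (\<sigma> i) - x * f p"
    if "i < r" for i x and f :: "nat \<Rightarrow> 'a"
    using \<sigma>(2)[OF that] p(1)
    by (simp add: left_diff_distrib sum_subtractf if_distrib[of "\<lambda>z. z * f _"] sum.delta cong: if_cong del: sum.op_ivl_Suc)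
  have "B * v = 0\<^sub>m r 1"
  proof (rule mat_ext)
    fix i j assume ij: "i < r" "j < (1::nat)"
    then have "(B * v) $$ (i, j) = (\<Sum>k = 0..<Suc r. ((if k = \<sigma> i then 1 else 0) - (if k = p then c (\<sigma> i) / c p else 0)) * c k)"
      using car v by (auto simp: scalar_prod_def B_def c_def simp del: sum.op_ivl_Suc intro!: sum.cong)
    also have "\<dots> = 0" using sum2[OF ij(1)] cp by simp
    finally show "(B * v) $$ (i, j) = 0\<^sub>m r 1 $$ (i, j)" using ij by simp
  qed (use car v in auto)
  moreover have "B * s = 1\<^sub>m r"
  proof (rule mat_ext)
    fix i j assume ij: "i < r" "j < r"
    then have "(B * s) $$ (i, j) = (\<Sum>k = 0..<Suc r. ((if k = \<sigma> i then 1 else 0) - (if k = p then c (\<sigma> i) / c p else 0)) * (if k = \<sigma> j then 1 else 0))"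
      by (auto simp: scalar_prod_def B_def s_def simp del: sum.op_ivl_Suc intro!: sum.cong)
    also have "\<dots> = (if \<sigma> i = \<sigma> j then 1 else 0)" 
      unfolding sum2[OF ij(1)] using \<sigma>(1)[of j] not_sym[OF \<sigma>(1)[of j]] by simp
    finally show "(B * s) $$ (i, j) = 1\<^sub>m r $$ (i, j)" using ij by (simp add: \<sigma>_inj)
  qed (use car in auto)
  moreover have "s * B + v * t = 1\<^sub>m (Suc r)"
  proof (rule mat_ext)
    fix i j assume ij: "i < Suc r" "j < Suc r"
    have sB: "(s * B) $$ (i, j) = (\<Sum>k = 0..<r. (if i = \<sigma> k then 1 else 0) * B $$ (k, j))"
      using ij by (auto simp: scalar_prod_def B_def s_def intro!: sum.cong)
    have vt: "(v * t) $$ (i, j) = (if j = p then c i / c p else 0)"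
      using ij v by (auto simp: scalar_prod_def t_def c_def)
    show "(s * B + v * t) $$ (i, j) = 1\<^sub>m (Suc r) $$ (i, j)"
    proof (cases "i = p")
      case True
      have "p \<noteq> \<sigma> k" for k using \<sigma>(1)[of k] by simp
      with True have "(s * B) $$ (i, j) = 0" unfolding sB by simp
      then show ?thesis using vt True ij cp car v by auto
    next
      case False
      have "\<exists>k<r. i = \<sigma> k"
      proof (cases "i < p")
        case True
        then show ?thesis using p by (intro exI[of _ i]) (auto simp: \<sigma>_def)
      next
        case ge: False
        then show ?thesis using False ij by (intro exI[of _ "i - 1"]) (auto simp: \<sigma>_def)
      qed
      then obtain k where k: "k < r" "i = \<sigma> k" by blast
      have "(s * B) $$ (i, j) = (\<Sum>k' = 0..<r. if k' = k then B $$ (k', j) else 0)"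
        unfolding sB unfolding k(2) \<sigma>_inj by (intro sum.cong) auto
      also have "\<dots> = B $$ (k, j)" using k by simp
      finally show ?thesis using vt False k ij car v by (auto simp: B_def)
    qed
  qed (use car v in auto)
  ultimately show ?thesis using car by blast
qed

text \<open>B is the cokernel of A, s a section of it, and the last equation says that whatever B
  kills is in the image of A. Adding a column a to A' leaves the cokernel alone if
  \<open>B * a = 0\<close>; otherwise it divides out the line spanned by
  \<open>B * a\<close>.\<close>

lemma cokernel_matrix:
  fixes A :: "'a::field mat"
  assumes "A \<in> carrier_mat m n"
  shows "\<exists>r B s t. B \<in> carrier_mat r m \<and> s \<in> carrier_mat m r \<and> t \<in> carrier_mat n m \<and>
    B * A = 0\<^sub>m r n \<and> B * s = 1\<^sub>m r \<and> s * B + A * t = 1\<^sub>m m"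
  using assms
proof (induction n arbitrary: A)
  case 0
  then show ?case
    by (intro exI[of _ m] exI[of _ "1\<^sub>m m"] exI[of _ "1\<^sub>m m"] exI[of _ "0\<^sub>m 0 m"])
      (auto intro!: eq_matI simp: scalar_prod_def)
next
  case (Suc n)
  define A' where "A' = mat m n (\<lambda>(i, j). A $$ (i, j))"
  define a where "a = mat m 1 (\<lambda>(i, j). A $$ (i, n))"
  have A': "A' \<in> carrier_mat m n" and a: "a \<in> carrier_mat m 1" by (auto simp: A'_def a_def)
  obtain r B s t where B: "B \<in> carrier_mat r m" and s: "s \<in> carrier_mat m r"
    and t: "t \<in> carrier_mat n m" and BA: "B * A' = 0\<^sub>m r n" and Bs: "B * s = 1\<^sub>m r"
    and sB: "s * B + A' * t = 1\<^sub>m m" using Suc.IH[OF A'] by blast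
  \<comment> \<open>Appends u as a last row to t', matching the last column a of A.\<close>
  define stack where "stack t' u = mat (Suc n) m (\<lambda>(i, j). if i < n then t' $$ (i, j) else u $$ (0, j))"
    for t' u :: "'a mat"
  have stack: "A * stack t' u = A' * t' + a * u"
    if "t' \<in> carrier_mat n m" "u \<in> carrier_mat 1 m" for t' u
    by (rule mat_ext[of _ m m])
      (use that Suc.prems in \<open>auto simp: stack_def A'_def a_def scalar_prod_def intro!: sum.cong\<close>)
  have split: "C * A = 0\<^sub>m k (Suc n)"
    if C: "C \<in> carrier_mat k m" "C * A' = 0\<^sub>m k n" "C * a = 0\<^sub>m k 1" for C k
  proof (rule mat_ext)
    fix i j assume ij: "i < k" "j < Suc n"
    show "(C * A) $$ (i, j) = 0\<^sub>m k (Suc n) $$ (i, j)"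
    proof (cases "j = n")
      case True
      have "(C * A) $$ (i, j) = (C * a) $$ (i, 0)"
        using C(1) ij Suc.prems True by (auto simp: scalar_prod_def a_def intro!: sum.cong)
      then show ?thesis using C ij by simp
    next
      case False
      have "(C * A) $$ (i, j) = (C * A') $$ (i, j)"
        using C(1) ij Suc.prems False by (auto simp: scalar_prod_def A'_def intro!: sum.cong)
      then show ?thesis using C ij False by simp
    qed
  qed (use C Suc.prems in auto)
  show ?case
  proof (cases "B * a = 0\<^sub>m r 1")
    case True
    have z: "a * 0\<^sub>m 1 m = 0\<^sub>m m m" using a by (intro eq_matI) (auto simp: scalar_prod_def)
    have "A * stack t (0\<^sub>m 1 m) = A' * t" using stack[OF t, of "0\<^sub>m 1 m"] z A' t by simp
    then show ?thesis using B s Bs sB split[OF B BA True]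
      by (intro exI[of _ r] exI[of _ B] exI[of _ s] exI[of _ "stack t (0\<^sub>m 1 m)"])
        (auto simp: stack_def)
  next
    case False
    have "r \<noteq> 0" using False B a by (auto intro!: eq_matI)
    then obtain r' where r: "r = Suc r'" by (cases r) auto
    have Ba: "B * a \<in> carrier_mat (Suc r') 1" "B * a \<noteq> 0\<^sub>m (Suc r') 1" using B a r False
      by auto
    obtain B' s' t' where B': "B' \<in> carrier_mat r' (Suc r')" and s': "s' \<in> carrier_mat (Suc r') r'"
      and t': "t' \<in> carrier_mat 1 (Suc r')" and BA': "B' * (B * a) = 0\<^sub>m r' 1"
      and Bs': "B' * s' = 1\<^sub>m r'" and sB': "s' * B' + B * a * t' = 1\<^sub>m (Suc r')"
      using vector_complement[OF Ba] by blast
    \<comment> \<open>Insert \<open>s' * B' + B * a * t' = 1\<close> between s and B in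
      \<open>s * B + A' * t = 1\<close>, and replace \<open>s * B * a\<close> by
      \<open>a - A' * t * a\<close>. The coefficients of A' and of a are then \<open>?t\<close> and
      \<open>?u\<close>.\<close>
    let ?B = "B' * B" and ?s = "s * s'" and ?u = "t' * B" and ?t = "t - t * a * (t' * B)"
    note dims = A' a B[unfolded r] s[unfolded r] t B' s' t'
    note dimD = dims[THEN carrier_matD(1)] dims[THEN carrier_matD(2)]
    have 1: "?B * A = 0\<^sub>m r' (Suc n)"
      by (rule split) (use dims BA BA' r in \<open>auto simp: mat_mult_assoc\<close>)
    have 2: "?B * ?s = 1\<^sub>m r'"
    proof -
      have "?B * ?s = B' * ((B * s) * s')" using dimD by (simp add: mat_mult_assoc)
      also have "\<dots> = 1\<^sub>m r'" using Bs Bs' dims r by simp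
      finally show ?thesis .
    qed
    have 3: "?s * ?B + A * stack ?t ?u = 1\<^sub>m m"
    proof -
      have st: "A * stack ?t ?u = A' * t - A' * t * a * ?u + a * ?u"
      proof -
        have "?t \<in> carrier_mat n m" "?u \<in> carrier_mat 1 m" by (intro carrier_matI; simp add: dimD)+
        from stack[OF this] show ?thesis using dimD by (simp add: mat_mult_assoc mat_mult_minus)
      qed
      have "s * B * a * ?u + A' * t * a * ?u = (s * B + A' * t) * a * ?u"
        using dimD by (simp add: mat_mult_assoc mat_add_mult)
      then have e1: "s * B * a * ?u + A' * t * a * ?u = a * ?u" using sB dims by simp
      have "?s * ?B + s * B * a * ?u = s * ((s' * B' + B * a * t') * B)"
        using dimD by (simp add: mat_mult_assoc mat_add_mult mat_mult_add)
      then have e2: "?s * ?B + s * B * a * ?u = s * B" using sB' dims by simp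
      have car: "?s * ?B \<in> carrier_mat m m" "s * B * a * ?u \<in> carrier_mat m m" "A' * t * a * ?u \<in> carrier_mat m m"
        "A' * t \<in> carrier_mat m m" "s * B \<in> carrier_mat m m" "a * ?u \<in> carrier_mat m m"
        using dims by auto
      have "?s * ?B + A * stack ?t ?u = (?s * ?B + s * B * a * ?u) + A' * t"
        unfolding st e1[symmetric]
        by (rule mat_ext[of _ m m]) (use car dimD in \<open>auto simp del: index_mult_mat(1)\<close>)
      then show ?thesis using e2 sB by simp
    qed
    show ?thesis using 1 2 3 dims
      by (intro exI[of _ r'] exI[of _ ?B] exI[of _ ?s] exI[of _ "stack ?t ?u"]) (auto simp: stack_def)
  qed
qed

text \<open>Products are normalised to associate to the right, where an equation about two factors
  no longer matches. This lemma and the next two carry a further factor Z along.\<close>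

lemma mat_eq_assoc:
  fixes A :: "'a::semiring_0 mat"
  assumes "A * B = C * D" "dim_col A = dim_row B" "dim_col C = dim_row D" "dim_row Z = dim_col B"
  shows "A * (B * Z) = C * (D * Z)"
proof -
  have "dim_col D = dim_col B" using arg_cong[OF assms(1), of dim_col] by simp
  have "A * (B * Z) = (A * B) * Z" by (rule mat_mult_assoc[symmetric]) (use assms in auto)
  also have "\<dots> = C * (D * Z)" unfolding assms(1)
    by (rule mat_mult_assoc) (use assms \<open>dim_col D = dim_col B\<close> in auto)
  finally show ?thesis .
qed

lemma mat_one_assoc:
  fixes A :: "'a::semiring_1 mat"
  assumes "A * B = 1\<^sub>m k" "dim_col A = dim_row B" "dim_row Z = k"
  shows "A * (B * Z) = Z"
proof -
  have "dim_col B = k" using arg_cong[OF assms(1), of dim_col] by simp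
  have "A * (B * Z) = (A * B) * Z"
    by (rule mat_mult_assoc[symmetric]) (use assms \<open>dim_col B = k\<close> in auto)
  then show ?thesis using assms by (simp add: left_mult_one_mat')
qed

lemma mat_zero_assoc:
  fixes A :: "'a::semiring_0 mat"
  assumes "A * B = 0\<^sub>m k l" "dim_col A = dim_row B" "dim_row Z = l"
  shows "A * (B * Z) = 0\<^sub>m k (dim_col Z)"
proof -
  have "dim_col B = l" using arg_cong[OF assms(1), of dim_col] by simp
  have "A * (B * Z) = (A * B) * Z"
    by (rule mat_mult_assoc[symmetric]) (use assms \<open>dim_col B = l\<close> in auto)
  then show ?thesis using assms by (simp add: mat_zero_mult)
qed

subsection \<open>Morphisms, retractions and cocycles\<close>

abbreviation homs :: "'k rep \<Rightarrow> 'k rep \<Rightarrow> nat \<Rightarrow> 'k mat set" where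
  "homs V W x \<equiv> carrier_mat (vdim W x) (vdim V x)"

abbreviation arrow_homs :: "'k rep \<Rightarrow> 'k rep \<Rightarrow> nat \<Rightarrow> 'k mat set" where
  "arrow_homs V W x \<equiv> carrier_mat (vdim W (Suc x)) (vdim V x)"

lemma is_repD:
  assumes "is_rep n V" "1 \<le> x" "x < n"
  shows "dim_row (vmap V x) = vdim V (Suc x)" "dim_col (vmap V x) = vdim V x"
  using assms unfolding is_rep_def by auto

lemma rep_homD:
  assumes "rep_hom n V W f" "1 \<le> x" "x \<le> n"
  shows "dim_row (f x) = vdim W x" "dim_col (f x) = vdim V x"
  using assms unfolding rep_hom_def by auto

lemma rep_hom_commute:
  assumes "rep_hom n V W f" "1 \<le> x" "x < n"
  shows "f (Suc x) * vmap V x = vmap W x * f x"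
  using assms unfolding rep_hom_def by auto

lemma rep_homI:
  assumes "\<And>x. 1 \<le> x \<Longrightarrow> x \<le> n \<Longrightarrow> f x \<in> homs V W x"
    and "\<And>x. 1 \<le> x \<Longrightarrow> x < n \<Longrightarrow> f (Suc x) * vmap V x = vmap W x * f x"
  shows "rep_hom n V W f"
  using assms unfolding rep_hom_def by auto

lemma rep_hom_commute_assoc:
  assumes "rep_hom n V W f" "is_rep n V" "is_rep n W" "1 \<le> x" "x < n" "dim_row Z = vdim V x"
  shows "f (Suc x) * (vmap V x * Z) = vmap W x * (f x * Z)"
  using assms(4,5,6)
  by (intro mat_eq_assoc rep_hom_commute[OF assms(1)])
    (auto simp: is_repD[OF assms(2)] is_repD[OF assms(3)] rep_homD[OF assms(1)])

lemma rep_hom_comp: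
  assumes "is_rep n U" "is_rep n V" "is_rep n W" and f: "rep_hom n U V f" and g: "rep_hom n V W g"
  shows "rep_hom n U W (\<lambda>x. g x * f x)"
proof (rule rep_homI)
  fix x assume x: "1 \<le> x" "x < n"
  then have x': "1 \<le> Suc x" "Suc x \<le> n" "x \<le> n" by auto
  note dims = is_repD[OF assms(1) x] is_repD[OF assms(2) x] is_repD[OF assms(3) x]
    rep_homD[OF f x'(1,2)] rep_homD[OF g x'(1,2)] rep_homD[OF f x(1) x'(3)] rep_homD[OF g x(1) x'(3)]
  show "g (Suc x) * f (Suc x) * vmap U x = vmap W x * (g x * f x)"
    using dims rep_hom_commute[OF f x] rep_hom_commute_assoc[OF g assms(2,3) x, of "f x"]
    by (simp add: mat_mult_assoc)
qed (auto intro!: carrier_matI simp: rep_homD[OF f] rep_homD[OF g])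

text \<open>Covers isomorphisms and inclusions of direct summands at once, so that each invariance
  is proved only once.\<close>

definition retraction :: "nat \<Rightarrow> 'k::field rep \<Rightarrow> 'k rep \<Rightarrow> (nat \<Rightarrow> 'k mat) \<Rightarrow> (nat \<Rightarrow> 'k mat) \<Rightarrow> bool" where
  "retraction n V V' i r \<longleftrightarrow> is_rep n V \<and> is_rep n V' \<and> rep_hom n V V' i \<and> rep_hom n V' V r \<and>
     (\<forall>x\<in>{1..n}. r x * i x = 1\<^sub>m (vdim V x))"

lemma retractionD:
  assumes "retraction n V V' i r"
  shows "is_rep n V" "is_rep n V'" "rep_hom n V V' i" "rep_hom n V' V r"
    and "1 \<le> x \<Longrightarrow> x \<le> n \<Longrightarrow> r x * i x = 1\<^sub>m (vdim V x)"
    and "1 \<le> x \<Longrightarrow> x \<le> n \<Longrightarrow> dim_row Z = vdim V x \<Longrightarrow> r x * (i x * Z) = Z"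
proof -
  note r = assms[unfolded retraction_def]
  show i: "is_rep n V" "is_rep n V'" "rep_hom n V V' i" "rep_hom n V' V r" using r by auto
  show 1: "1 \<le> x \<Longrightarrow> x \<le> n \<Longrightarrow> r x * i x = 1\<^sub>m (vdim V x)" using r
    by simp
  show "1 \<le> x \<Longrightarrow> x \<le> n \<Longrightarrow> dim_row Z = vdim V x \<Longrightarrow> r x * (i x * Z) = Z"
    by (rule mat_one_assoc[OF 1]) (auto simp: rep_homD[OF i(3)] rep_homD[OF i(4)])
qed

section \<open>Vanishing of Hom and of cocycles passes to retracts\<close>

lemma Hom_zeroD: "Hom_zero n V W \<Longrightarrow> rep_hom n V W f \<Longrightarrow> 1 \<le> x \<Longrightarrow> x \<le> n \<Longrightarrow> f x = 0\<^sub>m (vdim W x) (vdim V x)"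
  unfolding Hom_zero_def by auto

text \<open>Since \<open>f = (f * r) * i\<close>, a morphism f from V is the restriction of one from
  V'.\<close>

lemma Hom_zero_retract_left:
  assumes ret: "retraction n V V' i r" and W: "is_rep n W" and H: "Hom_zero n V' W"
  shows "Hom_zero n V W"
  unfolding Hom_zero_def
proof (intro allI impI ballI)
  fix f x assume f: "rep_hom n V W f" and "x \<in> {1..n}"
  then have x: "1 \<le> x" "x \<le> n" by auto
  note r = retractionD[OF ret]
    and dr = rep_homD[OF retractionD(3)[OF ret]] rep_homD[OF retractionD(4)[OF ret]]
  have "f x * r x = 0\<^sub>m (vdim W x) (vdim V' x)"
    by (rule Hom_zeroD[OF H rep_hom_comp x]) (use r W f in auto)
  then have "f x * (r x * i x) = 0\<^sub>m (vdim W x) (dim_col (i x))"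
    by (rule mat_zero_assoc) (use x in \<open>auto simp: dr rep_homD[OF f]\<close>)
  then show "f x = 0\<^sub>m (vdim W x) (vdim V x)"
    using r(5)[OF x] x by (simp add: right_mult_one_mat' rep_homD[OF f] dr)
qed

lemma Hom_zero_retract_right:
  assumes ret: "retraction n W W' i r" and V: "is_rep n V" and H: "Hom_zero n V W'"
  shows "Hom_zero n V W"
  unfolding Hom_zero_def
proof (intro allI impI ballI)
  fix f x assume f: "rep_hom n V W f" and "x \<in> {1..n}"
  then have x: "1 \<le> x" "x \<le> n" by auto
  note r = retractionD[OF ret]
    and dr = rep_homD[OF retractionD(3)[OF ret]] rep_homD[OF retractionD(4)[OF ret]]
  have "i x * f x = 0\<^sub>m (vdim W' x) (vdim V x)"
    by (rule Hom_zeroD[OF H rep_hom_comp x]) (use r V f in auto)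
  moreover have "r x * (i x * f x) = f x"
    by (rule r(6)) (use x in \<open>auto simp: rep_homD[OF f]\<close>)
  ultimately show "f x = 0\<^sub>m (vdim W x) (vdim V x)"
    using x by (simp add: mat_mult_zero dr)
qed

text \<open>Vanishing of the cokernel of the map from families \<open>h x : V x \<rightarrow> W x\<close> to families
  \<open>\<phi> x : V x \<rightarrow> W (x + 1)\<close> in Ringel's standard exact sequence.\<close>

definition cocycles_split :: "nat \<Rightarrow> 'k::field rep \<Rightarrow> 'k rep \<Rightarrow> bool" where
  "cocycles_split n V W \<longleftrightarrow>
     (\<forall>\<phi>. (\<forall>x. 1 \<le> x \<longrightarrow> x < n \<longrightarrow> \<phi> x \<in> arrow_homs V W x) \<longrightarrow>
       (\<exists>h. (\<forall>x. 1 \<le> x \<longrightarrow> x \<le> n \<longrightarrow> h x \<in> homs V W x) \<and>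
          (\<forall>x. 1 \<le> x \<longrightarrow> x < n \<longrightarrow> \<phi> x = h (Suc x) * vmap V x - vmap W x * h x)))"

lemma cocycles_splitD:
  assumes "cocycles_split n V W"
    and "\<And>x. 1 \<le> x \<Longrightarrow> x < n \<Longrightarrow> \<phi> x \<in> arrow_homs V W x"
  shows "\<exists>h. (\<forall>x. 1 \<le> x \<longrightarrow> x \<le> n \<longrightarrow> h x \<in> homs V W x) \<and>
    (\<forall>x. 1 \<le> x \<longrightarrow> x < n \<longrightarrow> \<phi> x = h (Suc x) * vmap V x - vmap W x * h x)"
  by (rule mp[OF spec[OF assms(1)[unfolded cocycles_split_def]]]) (use assms(2) in simp)

text \<open>Pull the cocycle back along r, split it over V', and restrict the splitting along
  i.\<close>

lemma cocycles_split_retract_left: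
  assumes ret: "retraction n V V' i r" and W: "is_rep n W" and H: "cocycles_split n V' W"
  shows "cocycles_split n V W"
  unfolding cocycles_split_def
proof (intro allI impI)
  fix \<phi> :: "nat \<Rightarrow> 'a mat"
  assume p: "\<forall>x. 1 \<le> x \<longrightarrow> x < n \<longrightarrow> \<phi> x \<in> arrow_homs V W x"
  note r = retractionD[OF ret]
    and dr = rep_homD[OF retractionD(3)[OF ret]] rep_homD[OF retractionD(4)[OF ret]]
  have phi: "\<phi> x * r x \<in> carrier_mat (vdim W (Suc x)) (vdim V' x)" if "1 \<le> x" "x < n" for x
    using p that by (auto intro!: carrier_matI simp: dr)
  obtain h where h: "\<And>x. 1 \<le> x \<Longrightarrow> x \<le> n \<Longrightarrow> h x \<in> carrier_mat (vdim W x) (vdim V' x)"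
    and eq: "\<And>x. 1 \<le> x \<Longrightarrow> x < n \<Longrightarrow> \<phi> x * r x = h (Suc x) * vmap V' x - vmap W x * h x"
    using cocycles_splitD[OF H phi] by auto
  have "\<phi> x = h (Suc x) * i (Suc x) * vmap V x - vmap W x * (h x * i x)" if x: "1 \<le> x" "x < n" for x
  proof -
    have x': "1 \<le> Suc x" "Suc x \<le> n" "x \<le> n" using x by auto
    have dims: "dim_row (\<phi> x) = vdim W (Suc x)" "dim_col (\<phi> x) = vdim V x"
      "dim_row (h x) = vdim W x" "dim_col (h x) = vdim V' x"
      "dim_row (h (Suc x)) = vdim W (Suc x)" "dim_col (h (Suc x)) = vdim V' (Suc x)"
      using p x h[OF x(1) x'(3)] h[OF x'(1,2)] by auto
    note d = dims dr[OF x(1) x'(3)] dr[OF x'(1,2)] is_repD[OF r(1) x] is_repD[OF r(2) x] is_repD[OF W x]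
    have "\<phi> x = \<phi> x * r x * i x"
      using r(5)[OF x(1) x'(3)] d by (simp add: mat_mult_assoc right_mult_one_mat')
    also have "\<dots> = h (Suc x) * vmap V' x * i x - vmap W x * h x * i x"
      unfolding eq[OF x] using d by (simp add: mat_minus_mult)
    also have "\<dots> = h (Suc x) * (i (Suc x) * vmap V x) - vmap W x * (h x * i x)"
      using d rep_hom_commute[OF r(3) x] by (simp add: mat_mult_assoc)
    also have "\<dots> = h (Suc x) * i (Suc x) * vmap V x - vmap W x * (h x * i x)"
      using d by (simp add: mat_mult_assoc)
    finally show ?thesis .
  qed
  moreover have "h x * i x \<in> homs V W x" if "1 \<le> x" "x \<le> n" for x
    using h[OF that] that by (auto intro!: carrier_matI simp: dr)
  ultimately show "\<exists>h. (\<forall>x. 1 \<le> x \<longrightarrow> x \<le> n \<longrightarrow> h x \<in> homs V W x) \<and>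
          (\<forall>x. 1 \<le> x \<longrightarrow> x < n \<longrightarrow> \<phi> x = h (Suc x) * vmap V x - vmap W x * h x)"
    by (intro exI[of _ "\<lambda>x. h x * i x"]) simp
qed

text \<open>Push the cocycle forward along i, split it in W', and apply r to the splitting.\<close>

lemma cocycles_split_retract_right:
  assumes ret: "retraction n W W' i r" and V: "is_rep n V" and H: "cocycles_split n V W'"
  shows "cocycles_split n V W"
  unfolding cocycles_split_def
proof (intro allI impI)
  fix \<phi> :: "nat \<Rightarrow> 'a mat"
  assume p: "\<forall>x. 1 \<le> x \<longrightarrow> x < n \<longrightarrow> \<phi> x \<in> arrow_homs V W x"
  note r = retractionD[OF ret]
    and dr = rep_homD[OF retractionD(3)[OF ret]] rep_homD[OF retractionD(4)[OF ret]]
  have phi: "i (Suc x) * \<phi> x \<in> carrier_mat (vdim W' (Suc x)) (vdim V x)" if "1 \<le> x" "x < n" for x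
    using p that by (auto intro!: carrier_matI simp: dr)
  obtain h where h: "\<And>x. 1 \<le> x \<Longrightarrow> x \<le> n \<Longrightarrow> h x \<in> carrier_mat (vdim W' x) (vdim V x)"
    and eq: "\<And>x. 1 \<le> x \<Longrightarrow> x < n \<Longrightarrow> i (Suc x) * \<phi> x = h (Suc x) * vmap V x - vmap W' x * h x"
    using cocycles_splitD[OF H phi] by auto
  have "\<phi> x = r (Suc x) * h (Suc x) * vmap V x - vmap W x * (r x * h x)" if x: "1 \<le> x" "x < n" for x
  proof -
    have x': "1 \<le> Suc x" "Suc x \<le> n" "x \<le> n" using x by auto
    have dims: "dim_row (\<phi> x) = vdim W (Suc x)" "dim_col (\<phi> x) = vdim V x"
      "dim_row (h x) = vdim W' x" "dim_col (h x) = vdim V x"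
      "dim_row (h (Suc x)) = vdim W' (Suc x)" "dim_col (h (Suc x)) = vdim V (Suc x)"
      using p x h[OF x(1) x'(3)] h[OF x'(1,2)] by auto
    note d = dims dr[OF x(1) x'(3)] dr[OF x'(1,2)] is_repD[OF r(1) x] is_repD[OF r(2) x] is_repD[OF V x]
    have "\<phi> x = r (Suc x) * (i (Suc x) * \<phi> x)"
      by (rule r(6)[symmetric]) (use x' d in auto)
    also have "\<dots> = r (Suc x) * (h (Suc x) * vmap V x) - r (Suc x) * (vmap W' x * h x)"
      unfolding eq[OF x] using d by (simp add: mat_mult_minus)
    also have "\<dots> = r (Suc x) * h (Suc x) * vmap V x - vmap W x * (r x * h x)"
      using d rep_hom_commute_assoc[OF r(4,2,1) x, of "h x"] by (simp add: mat_mult_assoc)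
    finally show ?thesis .
  qed
  moreover have "r x * h x \<in> homs V W x" if "1 \<le> x" "x \<le> n" for x
    using h[OF that] that by (auto intro!: carrier_matI simp: dr)
  ultimately show "\<exists>h. (\<forall>x. 1 \<le> x \<longrightarrow> x \<le> n \<longrightarrow> h x \<in> homs V W x) \<and>
          (\<forall>x. 1 \<le> x \<longrightarrow> x < n \<longrightarrow> \<phi> x = h (Suc x) * vmap V x - vmap W x * h x)"
    by (intro exI[of _ "\<lambda>x. r x * h x"]) simp
qed

text \<open>Exactness in matrix form. The section of g exists at each vertex separately; it need not
  be a morphism, and its failure to be one is what the extension class measures.\<close>

lemma short_exactD:
  assumes "short_exact n W f X g V" "1 \<le> x" "x \<le> n"
  shows "\<exists>\<sigma>\<in>homs V X x. g x * \<sigma> = 1\<^sub>m (vdim V x)"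
    and "g x * f x = 0\<^sub>m (vdim V x) (vdim W x)"
    and "M \<in> carrier_mat (vdim X x) c \<Longrightarrow> g x * M = 0\<^sub>m (vdim V x) c \<Longrightarrow>
      \<exists>N\<in>carrier_mat (vdim W x) c. f x * N = M"
proof -
  note se = assms(1)[unfolded short_exact_def]
  have x: "x \<in> {1..n}" using assms by auto
  have f: "f x \<in> homs W X x" and g: "g x \<in> homs X V x"
    using se x unfolding rep_hom_def by auto
  have im: "(\<lambda>w. f x *\<^sub>v w) ` carrier_vec (vdim W x)
          = {u \<in> carrier_vec (vdim X x). g x *\<^sub>v u = 0\<^sub>v (vdim V x)}"
    and sur: "(\<lambda>u. g x *\<^sub>v u) ` carrier_vec (vdim X x) = carrier_vec (vdim V x)"
    using se x by auto
  show "\<exists>\<sigma>\<in>homs V X x. g x * \<sigma> = 1\<^sub>m (vdim V x)"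
  proof (rule factor_through[OF g])
    fix j assume "j < vdim V x"
    then have "col (1\<^sub>m (vdim V x)) j \<in> (\<lambda>u. g x *\<^sub>v u) ` carrier_vec (vdim X x)"
      unfolding sur by auto
    then show "\<exists>w\<in>carrier_vec (vdim X x). g x *\<^sub>v w = col (1\<^sub>m (vdim V x)) j" by auto
  qed simp
  show "g x * f x = 0\<^sub>m (vdim V x) (vdim W x)"
  proof (rule mat_col_eqI)
    fix j assume "j < dim_col (0\<^sub>m (vdim V x) (vdim W x) :: 'a mat)"
    then have j: "j < vdim W x" by simp
    have "col (f x) j = f x *\<^sub>v unit_vec (vdim W x) j" 
      using f j by (intro eq_vecI) auto
    then have "col (f x) j \<in> (\<lambda>w. f x *\<^sub>v w) ` carrier_vec (vdim W x)" by auto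
    then have "g x *\<^sub>v col (f x) j = 0\<^sub>v (vdim V x)" unfolding im by auto
    then show "col (g x * f x) j = col (0\<^sub>m (vdim V x) (vdim W x)) j"
      using col_mult2[OF g f j] j by simp
  qed (use f g in auto)
  show "\<exists>N\<in>carrier_mat (vdim W x) c. f x * N = M" if M: "M \<in> carrier_mat (vdim X x) c" "g x * M = 0\<^sub>m (vdim V x) c"
  proof (rule factor_through[OF f M(1)])
    fix j assume j: "j < c"
    have "g x *\<^sub>v col M j = 0\<^sub>v (vdim V x)" using col_mult2[OF g M(1) j] M(2) j by simp
    then have "col M j \<in> (\<lambda>w. f x *\<^sub>v w) ` carrier_vec (vdim W x)" unfolding im using M j
      by auto
    then show "\<exists>w\<in>carrier_vec (vdim W x). f x *\<^sub>v w = col M j" by auto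
  qed
qed

subsection \<open>Extensions and direct sums\<close>

lemma mult_select_cols:
  fixes M :: "'a::semiring_1 mat"
  assumes "M \<in> carrier_mat r k" "\<And>j. j < c \<Longrightarrow> \<sigma> j < k"
  shows "M * mat k c (\<lambda>(i, j). if i = \<sigma> j then 1 else 0) = mat r c (\<lambda>(i, j). M $$ (i, \<sigma> j))"
proof (rule mat_ext[of _ r c])
  fix i j assume ij: "i < r" "j < c"
  have "(M * mat k c (\<lambda>(i, j). if i = \<sigma> j then 1 else 0)) $$ (i, j)
    = (\<Sum>l = 0..<k. M $$ (i, l) * (if l = \<sigma> j then 1 else 0))"
    using ij assms(1) by (auto simp: scalar_prod_def intro!: sum.cong)
  also have "\<dots> = (\<Sum>l = 0..<k. if l = \<sigma> j then M $$ (i, l) else 0)" by (intro sum.cong) auto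
  also have "\<dots> = M $$ (i, \<sigma> j)" using assms(2)[OF ij(2)] by simp
  finally show "(M * mat k c (\<lambda>(i, j). if i = \<sigma> j then 1 else 0)) $$ (i, j)
    = mat r c (\<lambda>(i, j). M $$ (i, \<sigma> j)) $$ (i, j)" using ij by simp
qed (use assms in auto)

lemma mult_select_rows:
  fixes M :: "'a::semiring_1 mat"
  assumes "M \<in> carrier_mat k c" "\<And>i. i < r \<Longrightarrow> \<sigma> i < k"
  shows "mat r k (\<lambda>(i, j). if j = \<sigma> i then 1 else 0) * M = mat r c (\<lambda>(i, j). M $$ (\<sigma> i, j))"
proof (rule mat_ext[of _ r c])
  fix i j assume ij: "i < r" "j < c"
  have "(mat r k (\<lambda>(i, j). if j = \<sigma> i then 1 else 0) * M) $$ (i, j)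
    = (\<Sum>l = 0..<k. (if l = \<sigma> i then 1 else 0) * M $$ (l, j))"
    using ij assms(1) by (auto simp: scalar_prod_def intro!: sum.cong)
  also have "\<dots> = (\<Sum>l = 0..<k. if l = \<sigma> i then M $$ (l, j) else 0)" by (intro sum.cong) auto
  also have "\<dots> = M $$ (\<sigma> i, j)" using assms(2)[OF ij(1)] by simp
  finally show "(mat r k (\<lambda>(i, j). if j = \<sigma> i then 1 else 0) * M) $$ (i, j)
    = mat r c (\<lambda>(i, j). M $$ (\<sigma> i, j)) $$ (i, j)" using ij by simp
qed (use assms in auto)

text \<open>With inclusions and projections as matrices, computations in direct sums and extensions
  are equations between products, without reference to entries.\<close>

definition inc1 :: "nat \<Rightarrow> nat \<Rightarrow> 'a::field mat" where
  "inc1 a b = mat (a + b) a (\<lambda>(i, j). if i = j then 1 else 0)"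
definition inc2 :: "nat \<Rightarrow> nat \<Rightarrow> 'a::field mat" where
  "inc2 a b = mat (a + b) b (\<lambda>(i, j). if i = a + j then 1 else 0)"
definition pr1 :: "nat \<Rightarrow> nat \<Rightarrow> 'a::field mat" where
  "pr1 a b = mat a (a + b) (\<lambda>(i, j). if j = i then 1 else 0)"
definition pr2 :: "nat \<Rightarrow> nat \<Rightarrow> 'a::field mat" where
  "pr2 a b = mat b (a + b) (\<lambda>(i, j). if j = a + i then 1 else 0)"

lemma dim_inc_pr [simp]:
  "dim_row (inc1 a b) = a + b" "dim_col (inc1 a b) = a"
  "dim_row (inc2 a b) = a + b" "dim_col (inc2 a b) = b"
  "dim_row (pr1 a b) = a" "dim_col (pr1 a b) = a + b"
  "dim_row (pr2 a b) = b" "dim_col (pr2 a b) = a + b"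
  by (simp_all add: inc1_def inc2_def pr1_def pr2_def)

lemma pr_inc [simp]:
  "pr1 a b * inc1 a b = 1\<^sub>m a" "pr2 a b * inc2 a b = 1\<^sub>m b"
  "pr1 a b * inc2 a b = 0\<^sub>m a b" "pr2 a b * inc1 a b = 0\<^sub>m b a"
proof -
  show "pr1 a b * inc1 a b = 1\<^sub>m a" unfolding inc1_def
    by (subst mult_select_cols[of _ a "a + b" _ "\<lambda>j. j"]) (auto simp: pr1_def intro!: eq_matI)
  show "pr2 a b * inc2 a b = 1\<^sub>m b" unfolding inc2_def
    by (subst mult_select_cols[of _ b "a + b" _ "\<lambda>j. a + j"]) (auto simp: pr2_def intro!: eq_matI)
  show "pr1 a b * inc2 a b = 0\<^sub>m a b" unfolding inc2_def
    by (subst mult_select_cols[of _ a "a + b" _ "\<lambda>j. a + j"]) (auto simp: pr1_def intro!: eq_matI)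
  show "pr2 a b * inc1 a b = 0\<^sub>m b a" unfolding inc1_def
    by (subst mult_select_cols[of _ b "a + b" _ "\<lambda>j. j"]) (auto simp: pr2_def intro!: eq_matI)
qed

lemma inc_pr_sum: "inc1 a b * pr1 a b + inc2 a b * pr2 a b = 1\<^sub>m (a + b)"
proof -
  have 1: "inc1 a b * pr1 a b = mat (a + b) (a + b) (\<lambda>(i, j). if i = j \<and> j < a then 1 else 0 :: 'a)"
  proof (rule mat_ext[of _ "a + b" "a + b"])
    fix i j assume ij: "i < a + b" "j < a + b"
    have "(inc1 a b * pr1 a b :: 'a mat) $$ (i, j) = (\<Sum>l = 0..<a. if l = j \<and> i = j then 1 else 0)"
      using ij by (auto simp: scalar_prod_def inc1_def pr1_def intro!: sum.cong)
    then show "(inc1 a b * pr1 a b :: 'a mat) $$ (i, j)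
      = mat (a + b) (a + b) (\<lambda>(i, j). if i = j \<and> j < a then 1 else 0 :: 'a) $$ (i, j)"
      using ij by (cases "i = j") auto
  qed auto
  have 2: "inc2 a b * pr2 a b = mat (a + b) (a + b) (\<lambda>(i, j). if i = j \<and> j \<ge> a then 1 else 0 :: 'a)"
  proof (rule mat_ext[of _ "a + b" "a + b"])
    fix i j assume ij: "i < a + b" "j < a + b"
    have "(inc2 a b * pr2 a b :: 'a mat) $$ (i, j) = (\<Sum>l = 0..<b. if l = j - a \<and> i = j \<and> j \<ge> a then 1 else 0)"
      using ij by (auto simp: scalar_prod_def inc2_def pr2_def intro!: sum.cong)
    then show "(inc2 a b * pr2 a b :: 'a mat) $$ (i, j)
      = mat (a + b) (a + b) (\<lambda>(i, j). if i = j \<and> j \<ge> a then 1 else 0 :: 'a) $$ (i, j)"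
      using ij by (cases "i = j \<and> j \<ge> a") auto
  qed auto
  show ?thesis unfolding 1 2 by (rule eq_matI) auto
qed

text \<open>By \<open>inc_pr_sum\<close> a matrix is recovered from its products with inclusions and
  projections, so only the four blocks have to be computed by entries.\<close>

lemma four_block_inc:
  fixes A :: "'a::field mat"
  assumes "A \<in> carrier_mat a' a" "B \<in> carrier_mat a' b" "C \<in> carrier_mat b' a" "D \<in> carrier_mat b' b"
  shows "four_block_mat A B C D * inc1 a b = inc1 a' b' * A + inc2 a' b' * C"
    and "four_block_mat A B C D * inc2 a b = inc1 a' b' * B + inc2 a' b' * D"
    and "pr1 a' b' * four_block_mat A B C D = A * pr1 a b + B * pr2 a b"
    and "pr2 a' b' * four_block_mat A B C D = C * pr1 a b + D * pr2 a b"
proof -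
  let ?F = "four_block_mat A B C D"
  have F: "?F \<in> carrier_mat (a' + b') (a + b)" using assms by auto
  have split: "inc1 a' b' * (pr1 a' b' * M) + inc2 a' b' * (pr2 a' b' * M) = M"
    if "M \<in> carrier_mat (a' + b') k" for M :: "'a mat" and k
  proof -
    have "(inc1 a' b' * pr1 a' b' + inc2 a' b' * pr2 a' b') * M = M"
      unfolding inc_pr_sum using that by simp
    then show ?thesis using that by (simp add: mat_add_mult mat_mult_assoc)
  qed
  have split': "M * inc1 a b * pr1 a b + M * inc2 a b * pr2 a b = M"
    if "M \<in> carrier_mat k (a + b)" for M :: "'a mat" and k
  proof -
    have "M * (inc1 a b * pr1 a b + inc2 a b * pr2 a b) = M"
      unfolding inc_pr_sum using that by simp
    then show ?thesis using that by (simp add: mat_mult_add mat_mult_assoc)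
  qed
  have c1: "?F * inc1 a b = mat (a' + b') a (\<lambda>(i, j). ?F $$ (i, j))"
    unfolding inc1_def by (rule mult_select_cols[OF F]) auto
  have c2: "?F * inc2 a b = mat (a' + b') b (\<lambda>(i, j). ?F $$ (i, a + j))"
    unfolding inc2_def by (rule mult_select_cols[OF F]) auto
  have sel1: "pr1 a' b' * M = mat a' k (\<lambda>(i, j). M $$ (i, j))" if "M \<in> carrier_mat (a' + b') k"
    for M :: "'a mat" and k
    unfolding pr1_def by (rule mult_select_rows[OF that]) auto
  have sel2: "pr2 a' b' * M = mat b' k (\<lambda>(i, j). M $$ (a' + i, j))" if "M \<in> carrier_mat (a' + b') k"
    for M :: "'a mat" and k
    unfolding pr2_def by (rule mult_select_rows[OF that]) auto
  have blocks: "pr1 a' b' * (?F * inc1 a b) = A" "pr2 a' b' * (?F * inc1 a b) = C"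
    "pr1 a' b' * (?F * inc2 a b) = B" "pr2 a' b' * (?F * inc2 a b) = D"
    unfolding c1 c2
    by (subst sel1[of _ a] sel1[of _ b] sel2[of _ a] sel2[of _ b];
        use assms in \<open>auto intro!: eq_matI\<close>)+
  note dA = assms[THEN carrier_matD(1)] assms[THEN carrier_matD(2)]
  have car: "?F * inc1 a b \<in> carrier_mat (a' + b') a" "?F * inc2 a b \<in> carrier_mat (a' + b') b"
    "pr1 a' b' * ?F \<in> carrier_mat a' (a + b)" "pr2 a' b' * ?F \<in> carrier_mat b' (a + b)"
    by (auto intro!: carrier_matI simp: dA)
  have blocks': "pr1 a' b' * ?F * inc1 a b = A" "pr2 a' b' * ?F * inc1 a b = C"
    "pr1 a' b' * ?F * inc2 a b = B" "pr2 a' b' * ?F * inc2 a b = D"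
    by (subst mat_mult_assoc; (rule blocks | simp add: dA))+
  show "?F * inc1 a b = inc1 a' b' * A + inc2 a' b' * C"
    by (rule split[OF car(1), unfolded blocks, symmetric])
  show "?F * inc2 a b = inc1 a' b' * B + inc2 a' b' * D"
    by (rule split[OF car(2), unfolded blocks, symmetric])
  show "pr1 a' b' * ?F = A * pr1 a b + B * pr2 a b"
    by (rule split'[OF car(3), unfolded blocks', symmetric])
  show "pr2 a' b' * ?F = C * pr1 a b + D * pr2 a b"
    by (rule split'[OF car(4), unfolded blocks', symmetric])
qed

text \<open>W is the submodule and V the quotient. The off-diagonal entry \<phi> is subject to no
  condition, as the quiver has no relations.\<close>

definition extension_rep :: "'k::field rep \<Rightarrow> 'k rep \<Rightarrow> (nat \<Rightarrow> 'k mat) \<Rightarrow> 'k rep" where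
  "extension_rep W V \<phi> =
     \<lparr>vdim = (\<lambda>x. vdim W x + vdim V x),
      vmap = (\<lambda>x. four_block_mat (vmap W x) (\<phi> x) (0\<^sub>m (vdim V (x + 1)) (vdim W x)) (vmap V x))\<rparr>"

lemma direct_sum_eq_extension:
  "direct_sum V W = extension_rep V W (\<lambda>x. 0\<^sub>m (vdim V (x + 1)) (vdim W x))"
  unfolding direct_sum_def extension_rep_def by simp

context
  fixes n and V W :: "'k::field rep" and \<phi> :: "nat \<Rightarrow> 'k mat" and X
  assumes V: "is_rep n V" and W: "is_rep n W"
    and phi: "\<And>x. 1 \<le> x \<Longrightarrow> x < n \<Longrightarrow> \<phi> x \<in> arrow_homs V W x"
  defines "X \<equiv> extension_rep W V \<phi>"
begin

lemma extension_vdim: "vdim X x = vdim W x + vdim V x"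
  by (simp add: X_def extension_rep_def)

lemma extension_is_rep: "is_rep n X"
  unfolding is_rep_def
proof
  fix x assume "x \<in> {1..<n}"
  then have x: "1 \<le> x" "x < n" by auto
  show "vmap X x \<in> carrier_mat (vdim X (x + 1)) (vdim X x)"
    using is_repD[OF V x] is_repD[OF W x] phi[OF x]
    by (intro carrier_matI) (auto simp: X_def extension_rep_def)
qed

lemma extension_vmap:
  assumes x: "1 \<le> x" "x < n"
  shows "vmap X x * inc1 (vdim W x) (vdim V x) = inc1 (vdim W (Suc x)) (vdim V (Suc x)) * vmap W x"
    and "vmap X x * inc2 (vdim W x) (vdim V x) =
      inc1 (vdim W (Suc x)) (vdim V (Suc x)) * \<phi> x + inc2 (vdim W (Suc x)) (vdim V (Suc x)) * vmap V x"
    and "pr1 (vdim W (Suc x)) (vdim V (Suc x)) * vmap X x =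
      vmap W x * pr1 (vdim W x) (vdim V x) + \<phi> x * pr2 (vdim W x) (vdim V x)"
    and "pr2 (vdim W (Suc x)) (vdim V (Suc x)) * vmap X x = vmap V x * pr2 (vdim W x) (vdim V x)"
proof -
  have F: "vmap X x = four_block_mat (vmap W x) (\<phi> x) (0\<^sub>m (vdim V (Suc x)) (vdim W x)) (vmap V x)"
    by (simp add: X_def extension_rep_def)
  have c: "vmap W x \<in> arrow_homs W W x" "vmap V x \<in> arrow_homs V V x"
    using is_repD[OF V x] is_repD[OF W x] by auto
  note b = four_block_inc[OF c(1) phi[OF x] zero_carrier_mat c(2)]
  show "vmap X x * inc1 (vdim W x) (vdim V x) = inc1 (vdim W (Suc x)) (vdim V (Suc x)) * vmap W x"
  proof -
    have "inc1 (vdim W (Suc x)) (vdim V (Suc x)) * vmap W x \<in> carrier_mat (vdim W (Suc x) + vdim V (Suc x)) (vdim W x)"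
      using c by (intro carrier_matI) auto
    then show ?thesis unfolding F b(1) by (simp add: mat_mult_zero)
  qed
  show "vmap X x * inc2 (vdim W x) (vdim V x) =
      inc1 (vdim W (Suc x)) (vdim V (Suc x)) * \<phi> x + inc2 (vdim W (Suc x)) (vdim V (Suc x)) * vmap V x"
    unfolding F b(2) ..
  show "pr1 (vdim W (Suc x)) (vdim V (Suc x)) * vmap X x =
      vmap W x * pr1 (vdim W x) (vdim V x) + \<phi> x * pr2 (vdim W x) (vdim V x)"
    unfolding F b(3) ..
  show "pr2 (vdim W (Suc x)) (vdim V (Suc x)) * vmap X x = vmap V x * pr2 (vdim W x) (vdim V x)"
  proof -
    have "vmap V x * pr2 (vdim W x) (vdim V x) \<in> carrier_mat (vdim V (Suc x)) (vdim W x + vdim V x)"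
      using c by (intro carrier_matI) auto
    then show ?thesis unfolding F b(4) by (simp add: mat_zero_mult)
  qed
qed

lemma extension_homs:
  shows "rep_hom n W X (\<lambda>x. inc1 (vdim W x) (vdim V x))"
    and "rep_hom n X V (\<lambda>x. pr2 (vdim W x) (vdim V x))"
proof -
  show "rep_hom n W X (\<lambda>x. inc1 (vdim W x) (vdim V x))"
    by (rule rep_homI) (auto simp: extension_vmap extension_vdim intro!: carrier_matI)
  show "rep_hom n X V (\<lambda>x. pr2 (vdim W x) (vdim V x))"
    by (rule rep_homI) (auto simp: extension_vmap extension_vdim intro!: carrier_matI)
qed

lemma extension_short_exact:
  "short_exact n W (\<lambda>x. inc1 (vdim W x) (vdim V x)) X (\<lambda>x. pr2 (vdim W x) (vdim V x)) V"
  unfolding short_exact_def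
proof (intro conjI ballI extension_homs)
  fix x assume "x \<in> {1..n}"
  let ?w = "vdim W x" and ?v = "vdim V x"
  let ?i1 = "inc1 ?w ?v :: 'k mat" and ?i2 = "inc2 ?w ?v :: 'k mat"
    and ?p1 = "pr1 ?w ?v :: 'k mat" and ?p2 = "pr2 ?w ?v :: 'k mat"
  have c: "?i1 \<in> carrier_mat (?w + ?v) ?w" "?i2 \<in> carrier_mat (?w + ?v) ?v"
    "?p1 \<in> carrier_mat ?w (?w + ?v)" "?p2 \<in> carrier_mat ?v (?w + ?v)"
    by (auto intro!: carrier_matI)
  have 1: "?p1 *\<^sub>v (?i1 *\<^sub>v w) = w" "?p2 *\<^sub>v (?i1 *\<^sub>v w) = 0\<^sub>v ?v"
    if "w \<in> carrier_vec ?w" for w :: "'k vec"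
  proof -
    have "0\<^sub>m ?v ?w *\<^sub>v w = 0\<^sub>v ?v" using that by (auto intro!: eq_vecI)
    then show "?p1 *\<^sub>v (?i1 *\<^sub>v w) = w" "?p2 *\<^sub>v (?i1 *\<^sub>v w) = 0\<^sub>v ?v"
      using assoc_mult_mat_vec[OF c(3,1) that] assoc_mult_mat_vec[OF c(4,1) that] that by auto
  qed
  have 2: "?p2 *\<^sub>v (?i2 *\<^sub>v w) = w" if "w \<in> carrier_vec ?v" for w :: "'k vec"
    using assoc_mult_mat_vec[OF c(4,2) that] that by auto
  have 3: "u = ?i1 *\<^sub>v (?p1 *\<^sub>v u) + ?i2 *\<^sub>v (?p2 *\<^sub>v u)"
    if u: "u \<in> carrier_vec (?w + ?v)" for u :: "'k vec"
  proof -
    have "u = (?i1 * ?p1 + ?i2 * ?p2) *\<^sub>v u"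
      unfolding inc_pr_sum using u by simp
    also have "\<dots> = (?i1 * ?p1) *\<^sub>v u + (?i2 * ?p2) *\<^sub>v u"
      by (rule add_mult_distrib_mat_vec[of _ "?w + ?v" "?w + ?v"]) (use c u in auto)
    finally show ?thesis using assoc_mult_mat_vec[OF c(1,3) u] assoc_mult_mat_vec[OF c(2,4) u] by simp
  qed
  show "inj_on ((*\<^sub>v) ?i1) (carrier_vec ?w)"
    by (rule inj_on_inverseI[of _ "(*\<^sub>v) ?p1"]) (rule 1)
  show "(*\<^sub>v) ?i1 ` carrier_vec ?w = {u \<in> carrier_vec (vdim X x). ?p2 *\<^sub>v u = 0\<^sub>v ?v}"
  proof (intro equalityI subsetI)
    fix u :: "'k vec"
    assume "u \<in> (*\<^sub>v) ?i1 ` carrier_vec ?w"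
    then show "u \<in> {u \<in> carrier_vec (vdim X x). ?p2 *\<^sub>v u = 0\<^sub>v ?v}"
      using 1 c by (auto simp: extension_vdim)
  next
    fix u :: "'k vec"
    assume "u \<in> {u \<in> carrier_vec (vdim X x). ?p2 *\<^sub>v u = 0\<^sub>v ?v}"
    then have u: "u \<in> carrier_vec (?w + ?v)" "?p2 *\<^sub>v u = 0\<^sub>v ?v"
      by (auto simp: extension_vdim)
    have z: "?i2 *\<^sub>v 0\<^sub>v ?v = 0\<^sub>v (?w + ?v)" using c by (auto intro!: eq_vecI)
    have "u = ?i1 *\<^sub>v (?p1 *\<^sub>v u)"
      using 3[OF u(1)] c u unfolding u(2) z by simp
    then show "u \<in> (*\<^sub>v) ?i1 ` carrier_vec ?w" using c u by auto
  qed
  show "(*\<^sub>v) ?p2 ` carrier_vec (vdim X x) = carrier_vec ?v"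
  proof (intro equalityI subsetI)
    fix w :: "'k vec" assume "w \<in> carrier_vec ?v"
    then show "w \<in> (*\<^sub>v) ?p2 ` carrier_vec (vdim X x)"
      using c 2[of w] by (intro image_eqI[of _ _ "?i2 *\<^sub>v w"]) (auto simp: extension_vdim)
  qed (use c in \<open>auto simp: extension_vdim\<close>)
qed

end

text \<open>A splitting of the extension defined by \<phi> has components h and 1. That it commutes
  with the arrows says, in the first component, that \<phi> is the coboundary of h.\<close>

lemma Ext1_zero_imp_cocycles_split:
  assumes V: "is_rep n V" and W: "is_rep n W" and E: "Ext1_zero n V W"
  shows "cocycles_split n V W"
  unfolding cocycles_split_def
proof (intro allI impI)
  fix \<phi> :: "nat \<Rightarrow> 'a mat"
  assume "\<forall>x. 1 \<le> x \<longrightarrow> x < n \<longrightarrow> \<phi> x \<in> arrow_homs V W x"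
  then have phi: "\<And>x. 1 \<le> x \<Longrightarrow> x < n \<Longrightarrow> \<phi> x \<in> arrow_homs V W x" by blast
  let ?X = "extension_rep W V \<phi>"
  let ?p1 = "\<lambda>x. pr1 (vdim W x) (vdim V x) :: 'a mat"
    and ?p2 = "\<lambda>x. pr2 (vdim W x) (vdim V x) :: 'a mat"
  have X: "is_rep n ?X" by (rule extension_is_rep[OF V W phi])
  obtain s where s: "rep_hom n V ?X s" and ps: "\<forall>x\<in>{1..n}. ?p2 x * s x = 1\<^sub>m (vdim V x)"
    using E[unfolded Ext1_zero_def, rule_format, OF X extension_short_exact[OF V W phi]] by blast
  have ds: "dim_row (s x) = vdim W x + vdim V x" "dim_col (s x) = vdim V x" if "1 \<le> x" "x \<le> n" for x
    using rep_homD[OF s that] by (auto simp: extension_rep_def)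
  have eq: "\<phi> x = ?p1 (Suc x) * s (Suc x) * vmap V x - vmap W x * (?p1 x * s x)" if x: "1 \<le> x" "x < n" for x
  proof -
    have x': "1 \<le> Suc x" "Suc x \<le> n" "x \<le> n" using x by auto
    note d = ds[OF x'(1,2)] ds[OF x(1) x'(3)] is_repD[OF V x] is_repD[OF W x]
      carrier_matD[OF phi[OF x]]
    have dX: "dim_row (vmap ?X x) = vdim W (Suc x) + vdim V (Suc x)" "dim_col (vmap ?X x) = vdim W x + vdim V x"
      using is_repD[OF X x] by (auto simp: extension_rep_def)
    have "?p1 (Suc x) * s (Suc x) * vmap V x = ?p1 (Suc x) * (s (Suc x) * vmap V x)"
      using d by (simp add: mat_mult_assoc)
    also have "\<dots> = ?p1 (Suc x) * (vmap ?X x * s x)" by (simp add: rep_hom_commute[OF s x])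
    also have "\<dots> = (?p1 (Suc x) * vmap ?X x) * s x"
      by (rule mat_mult_assoc[symmetric]) (simp_all add: d dX)
    also have "\<dots> = vmap W x * (?p1 x * s x) + \<phi> x * (?p2 x * s x)"
    proof -
      have e3: "?p1 (Suc x) * vmap ?X x = vmap W x * ?p1 x + \<phi> x * ?p2 x"
        by (rule extension_vmap(3)[OF V W _ x]) (rule phi)
      show ?thesis unfolding e3 using d by (simp add: mat_add_mult mat_mult_assoc)
    qed
    also have "\<dots> = vmap W x * (?p1 x * s x) + \<phi> x"
      using ps x x' d by (simp add: right_mult_one_mat')
    finally have e: "?p1 (Suc x) * s (Suc x) * vmap V x = vmap W x * (?p1 x * s x) + \<phi> x" .
    show ?thesis unfolding e using d phi[OF x] by (intro eq_matI) auto
  qed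
  have car: "?p1 x * s x \<in> homs V W x" if "1 \<le> x" "x \<le> n" for x
    using ds[OF that] by (intro carrier_matI) auto
  show "\<exists>h. (\<forall>x. 1 \<le> x \<longrightarrow> x \<le> n \<longrightarrow> h x \<in> homs V W x) \<and>
      (\<forall>x. 1 \<le> x \<longrightarrow> x < n \<longrightarrow> \<phi> x = h (Suc x) * vmap V x - vmap W x * h x)"
    using eq car by (intro exI[of _ "\<lambda>x. ?p1 x * s x"]) blast
qed

text \<open>Vertexwise sections \<sigma> of g commute with the arrows up to an error that g kills,
  hence up to some \<open>f * \<phi>\<close>. If \<phi> is the coboundary of h, then
  \<open>\<sigma> + f * h\<close> is a morphism.\<close>

lemma cocycles_split_imp_Ext1_zero:
  assumes V: "is_rep n V" and W: "is_rep n W" and C: "cocycles_split n V W"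
  shows "Ext1_zero n V W"
  unfolding Ext1_zero_def
proof (intro allI impI)
  fix X f g
  assume X: "is_rep n X" and se: "short_exact n W f X g V"
  have f: "rep_hom n W X f" and g: "rep_hom n X V g" using se unfolding short_exact_def by auto
  note sed = short_exactD[OF se]
  have "\<forall>x\<in>{1..n}. \<exists>\<sigma>. \<sigma> \<in> homs V X x \<and> g x * \<sigma> = 1\<^sub>m (vdim V x)"
    using sed(1) unfolding Bex_def by auto
  from bchoice[OF this] obtain \<sigma>
    where "\<forall>x\<in>{1..n}. \<sigma> x \<in> homs V X x \<and> g x * \<sigma> x = 1\<^sub>m (vdim V x)"
    by blast
  then have \<sigma>: "\<And>x. 1 \<le> x \<Longrightarrow> x \<le> n \<Longrightarrow> \<sigma> x \<in> homs V X x"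
    and g\<sigma>: "\<And>x. 1 \<le> x \<Longrightarrow> x \<le> n \<Longrightarrow> g x * \<sigma> x = 1\<^sub>m (vdim V x)" by auto
  have "\<exists>N. N \<in> arrow_homs V W x \<and>
      f (Suc x) * N = vmap X x * \<sigma> x - \<sigma> (Suc x) * vmap V x" if x: "1 \<le> x" "x < n" for x
  proof -
    have x': "1 \<le> Suc x" "Suc x \<le> n" "x \<le> n" using x by auto
    note d = carrier_matD[OF \<sigma>[OF x(1) x'(3)]] carrier_matD[OF \<sigma>[OF x'(1,2)]] is_repD[OF V x] is_repD[OF X x]
      rep_homD[OF g x(1) x'(3)] rep_homD[OF g x'(1,2)]
    have 1: "g (Suc x) * (vmap X x * \<sigma> x) = vmap V x"
      using rep_hom_commute_assoc[OF g X V x, of "\<sigma> x"] d g\<sigma>[OF x(1) x'(3)]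
        by (simp add: right_mult_one_mat')
    have 2: "g (Suc x) * (\<sigma> (Suc x) * vmap V x) = vmap V x"
      by (rule mat_one_assoc[OF g\<sigma>[OF x'(1,2)]]) (simp_all add: d)
    have "g (Suc x) * (vmap X x * \<sigma> x - \<sigma> (Suc x) * vmap V x) = vmap V x - vmap V x"
      using d by (subst mat_mult_minus) (simp_all add: 1 2)
    also have "\<dots> = 0\<^sub>m (vdim V (Suc x)) (vdim V x)" using d by (intro eq_matI) auto
    finally have 3: "g (Suc x) * (vmap X x * \<sigma> x - \<sigma> (Suc x) * vmap V x) = 0\<^sub>m (vdim V (Suc x)) (vdim V x)" .
    have "vmap X x * \<sigma> x - \<sigma> (Suc x) * vmap V x \<in> arrow_homs V X x"
      using d by (intro carrier_matI) auto
    from sed(3)[OF x'(1,2) this 3] show ?thesis by blast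
  qed
  then have "\<forall>x\<in>{1..<n}. \<exists>N. N \<in> arrow_homs V W x \<and>
      f (Suc x) * N = vmap X x * \<sigma> x - \<sigma> (Suc x) * vmap V x" by auto
  from bchoice[OF this] obtain \<phi>
    where "\<forall>x\<in>{1..<n}. \<phi> x \<in> arrow_homs V W x \<and>
      f (Suc x) * \<phi> x = vmap X x * \<sigma> x - \<sigma> (Suc x) * vmap V x" by blast
  then have phi: "\<And>x. 1 \<le> x \<Longrightarrow> x < n \<Longrightarrow> \<phi> x \<in> arrow_homs V W x"
    and f\<phi>: "\<And>x. 1 \<le> x \<Longrightarrow> x < n \<Longrightarrow> f (Suc x) * \<phi> x = vmap X x * \<sigma> x - \<sigma> (Suc x) * vmap V x"
    by auto
  obtain h where h: "\<And>x. 1 \<le> x \<Longrightarrow> x \<le> n \<Longrightarrow> h x \<in> homs V W x"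
    and heq: "\<And>x. 1 \<le> x \<Longrightarrow> x < n \<Longrightarrow> \<phi> x = h (Suc x) * vmap V x - vmap W x * h x"
    using cocycles_splitD[OF C phi] by auto
  define s where "s x = \<sigma> x + f x * h x" for x
  have s: "rep_hom n V X s"
  proof (rule rep_homI)
    fix x assume x: "1 \<le> x" "x \<le> n"
    show "s x \<in> homs V X x"
      using \<sigma>[OF x] h[OF x] rep_homD[OF f x] unfolding s_def by (auto intro!: carrier_matI)
  next
    fix x assume x: "1 \<le> x" "x < n"
    then have x': "1 \<le> Suc x" "Suc x \<le> n" "x \<le> n" by auto
    note d = carrier_matD[OF \<sigma>[OF x(1) x'(3)]] carrier_matD[OF \<sigma>[OF x'(1,2)]] is_repD[OF V x] is_repD[OF X x]
      is_repD[OF W x] carrier_matD[OF h[OF x(1) x'(3)]] carrier_matD[OF h[OF x'(1,2)]] carrier_matD[OF phi[OF x]]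
      rep_homD[OF f x(1) x'(3)] rep_homD[OF f x'(1,2)]
    have "f (Suc x) * \<phi> x = f (Suc x) * (h (Suc x) * vmap V x) - f (Suc x) * (vmap W x * h x)"
      unfolding heq[OF x] using d by (simp add: mat_mult_minus)
    also have "f (Suc x) * (vmap W x * h x) = vmap X x * (f x * h x)"
      by (rule rep_hom_commute_assoc[OF f W X x]) (simp add: d)
    finally have e: "vmap X x * \<sigma> x - \<sigma> (Suc x) * vmap V x
      = f (Suc x) * (h (Suc x) * vmap V x) - vmap X x * (f x * h x)" unfolding f\<phi>[OF x] .
    have c: "vmap X x * \<sigma> x \<in> arrow_homs V X x"
      "\<sigma> (Suc x) * vmap V x \<in> arrow_homs V X x"
      "f (Suc x) * (h (Suc x) * vmap V x) \<in> arrow_homs V X x"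
      "vmap X x * (f x * h x) \<in> arrow_homs V X x"
      by (auto intro!: carrier_matI simp: d)
    have "s (Suc x) * vmap V x = \<sigma> (Suc x) * vmap V x + f (Suc x) * (h (Suc x) * vmap V x)"
      unfolding s_def using d by (simp add: mat_add_mult mat_mult_assoc)
    also have "\<dots> = vmap X x * \<sigma> x + vmap X x * (f x * h x)"
    proof (rule mat_ext[of _ "vdim X (Suc x)" "vdim V x"])
      fix i j assume ij: "i < vdim X (Suc x)" "j < vdim V x"
      have "(vmap X x * \<sigma> x - \<sigma> (Suc x) * vmap V x) $$ (i, j)
        = (f (Suc x) * (h (Suc x) * vmap V x) - vmap X x * (f x * h x)) $$ (i, j)" by (simp only: e)
      then show "(\<sigma> (Suc x) * vmap V x + f (Suc x) * (h (Suc x) * vmap V x)) $$ (i, j)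
        = (vmap X x * \<sigma> x + vmap X x * (f x * h x)) $$ (i, j)"
        using ij c[THEN carrier_matD(1)] c[THEN carrier_matD(2)]
        by (simp del: index_mult_mat(1) add: algebra_simps)
    qed (use c in auto)
    also have "\<dots> = vmap X x * s x" unfolding s_def using d by (simp add: mat_mult_add)
    finally show "s (Suc x) * vmap V x = vmap X x * s x" .
  qed
  have "g x * s x = 1\<^sub>m (vdim V x)" if x: "1 \<le> x" "x \<le> n" for x
  proof -
    note d = carrier_matD[OF \<sigma>[OF x]] carrier_matD[OF h[OF x]] rep_homD[OF f x] rep_homD[OF g x]
    have "g x * (f x * h x) = 0\<^sub>m (vdim V x) (dim_col (h x))"
      by (rule mat_zero_assoc[OF sed(2)[OF x]]) (simp_all add: d)
    then show ?thesis unfolding s_def using d g\<sigma>[OF x] by (simp add: mat_mult_add)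
  qed
  then show "\<exists>s. rep_hom n V X s \<and> (\<forall>x\<in>{1..n}. g x * s x = 1\<^sub>m (vdim V x))"
    using s by auto
qed

lemma Ext1_zero_iff:
  "is_rep n V \<Longrightarrow> is_rep n W \<Longrightarrow> Ext1_zero n V W \<longleftrightarrow> cocycles_split n V W"
  using Ext1_zero_imp_cocycles_split cocycles_split_imp_Ext1_zero by blast

section \<open>Perpendicular categories and direct sums\<close>

lemma perp_iff:
  "is_rep n V \<Longrightarrow> W \<in> perp n V \<longleftrightarrow> is_rep n W \<and> Hom_zero n V W \<and> cocycles_split n V W"
  unfolding perp_def using Ext1_zero_iff by blast

lemma perp_retract_left:
  "retraction n V V' i r \<Longrightarrow> W \<in> perp n V' \<Longrightarrow> W \<in> perp n V"
  using Hom_zero_retract_left cocycles_split_retract_left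
  by (metis perp_iff retractionD(1,2))

lemma perp_retract_right:
  "retraction n W W' i r \<Longrightarrow> is_rep n V \<Longrightarrow> W' \<in> perp n V \<Longrightarrow> W \<in> perp n V"
  using Hom_zero_retract_right cocycles_split_retract_right
  by (metis perp_iff retractionD(1,2))

lemma rep_iso_retraction:
  assumes "rep_iso n V W" "is_rep n V" "is_rep n W"
  obtains f g where "retraction n V W f g" "retraction n W V g f"
  using assms unfolding rep_iso_def retraction_def by blast

context
  fixes n and A B :: "'k::field rep"
  assumes A: "is_rep n A" and B: "is_rep n B"
begin

lemma direct_sum_is_rep: "is_rep n (direct_sum A B)"
  unfolding direct_sum_eq_extension by (rule extension_is_rep[OF B A]) simp

lemma direct_sum_vmap:
  assumes x: "1 \<le> x" "x < n"
  shows "vmap (direct_sum A B) x * inc1 (vdim A x) (vdim B x) = inc1 (vdim A (Suc x)) (vdim B (Suc x)) * vmap A x"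
    and "vmap (direct_sum A B) x * inc2 (vdim A x) (vdim B x) = inc2 (vdim A (Suc x)) (vdim B (Suc x)) * vmap B x"
    and "pr1 (vdim A (Suc x)) (vdim B (Suc x)) * vmap (direct_sum A B) x = vmap A x * pr1 (vdim A x) (vdim B x)"
    and "pr2 (vdim A (Suc x)) (vdim B (Suc x)) * vmap (direct_sum A B) x = vmap B x * pr2 (vdim A x) (vdim B x)"
proof -
  let ?z = "\<lambda>x. 0\<^sub>m (vdim A (x + 1)) (vdim B x) :: 'k mat"
  have z: "?z x \<in> arrow_homs B A x" for x by simp
  note e = extension_vmap[OF B A z x, folded direct_sum_eq_extension]
  note d = is_repD[OF A x] is_repD[OF B x]
  have c: "inc2 (vdim A (Suc x)) (vdim B (Suc x)) * vmap B x \<in> carrier_mat (vdim A (Suc x) + vdim B (Suc x)) (vdim B x)"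
    "vmap A x * pr1 (vdim A x) (vdim B x) \<in> carrier_mat (vdim A (Suc x)) (vdim A x + vdim B x)"
    using d by (auto intro!: carrier_matI)
  show "vmap (direct_sum A B) x * inc1 (vdim A x) (vdim B x) = inc1 (vdim A (Suc x)) (vdim B (Suc x)) * vmap A x"
    by (rule e(1))
  show "vmap (direct_sum A B) x * inc2 (vdim A x) (vdim B x) = inc2 (vdim A (Suc x)) (vdim B (Suc x)) * vmap B x"
    unfolding e(2) using c by (simp add: mat_mult_zero)
  show "pr1 (vdim A (Suc x)) (vdim B (Suc x)) * vmap (direct_sum A B) x = vmap A x * pr1 (vdim A x) (vdim B x)"
    unfolding e(3) using c by (simp add: mat_zero_mult)
  show "pr2 (vdim A (Suc x)) (vdim B (Suc x)) * vmap (direct_sum A B) x = vmap B x * pr2 (vdim A x) (vdim B x)"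
    by (rule e(4))
qed

lemma direct_sum_vdim: "vdim (direct_sum A B) x = vdim A x + vdim B x"
  by (simp add: direct_sum_def)

lemma direct_sum_retractions:
  "retraction n A (direct_sum A B) (\<lambda>x. inc1 (vdim A x) (vdim B x)) (\<lambda>x. pr1 (vdim A x) (vdim B x))"
  "retraction n B (direct_sum A B) (\<lambda>x. inc2 (vdim A x) (vdim B x)) (\<lambda>x. pr2 (vdim A x) (vdim B x))"
  unfolding retraction_def using A B direct_sum_is_rep
  by (auto intro!: rep_homI carrier_matI simp: direct_sum_vmap direct_sum_vdim)

text \<open>Morphisms and cochains out of a sum are pairs; a splitting is assembled from its parts
  as \<open>h1 * pr1 + h2 * pr2\<close>.\<close>

lemma perp_direct_sum: "perp n (direct_sum A B) = perp n A \<inter> perp n B"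
proof (intro equalityI subsetI)
  fix W assume "W \<in> perp n (direct_sum A B)"
  then show "W \<in> perp n A \<inter> perp n B"
    using direct_sum_retractions perp_retract_left by blast
next
  fix W assume "W \<in> perp n A \<inter> perp n B"
  then have W: "is_rep n W" and H: "Hom_zero n A W" "Hom_zero n B W"
    and C: "cocycles_split n A W" "cocycles_split n B W" using perp_iff A B by auto
  let ?i1 = "\<lambda>x. inc1 (vdim A x) (vdim B x) :: 'k mat"
    and ?i2 = "\<lambda>x. inc2 (vdim A x) (vdim B x) :: 'k mat"
  let ?p1 = "\<lambda>x. pr1 (vdim A x) (vdim B x) :: 'k mat"
    and ?p2 = "\<lambda>x. pr2 (vdim A x) (vdim B x) :: 'k mat"
  let ?S = "direct_sum A B"
  note r1 = retractionD(3,4)[OF direct_sum_retractions(1)]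
    and r2 = retractionD(3,4)[OF direct_sum_retractions(2)]
  have split: "M = M * ?i1 x * ?p1 x + M * ?i2 x * ?p2 x" if "dim_col M = vdim A x + vdim B x"
    for M :: "'k mat" and x
  proof -
    have "M = M * (?i1 x * ?p1 x + ?i2 x * ?p2 x)" using that by (simp add: inc_pr_sum right_mult_one_mat')
    also have "\<dots> = M * ?i1 x * ?p1 x + M * ?i2 x * ?p2 x" using that
      by (simp add: mat_mult_add mat_mult_assoc)
    finally show ?thesis .
  qed
  have "Hom_zero n ?S W"
    unfolding Hom_zero_def
  proof (intro allI impI ballI)
    fix f x assume f: "rep_hom n ?S W f" and "x \<in> {1..n}"
    then have x: "1 \<le> x" "x \<le> n" by auto
    have "f x * ?i1 x = 0\<^sub>m (vdim W x) (vdim A x)" "f x * ?i2 x = 0\<^sub>m (vdim W x) (vdim B x)"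
      using Hom_zeroD[OF H(1) rep_hom_comp[OF A direct_sum_is_rep W r1(1) f] x]
        Hom_zeroD[OF H(2) rep_hom_comp[OF B direct_sum_is_rep W r2(1) f] x] by auto
    then show "f x = 0\<^sub>m (vdim W x) (vdim ?S x)"
      using split[of "f x" x] rep_homD[OF f x] by (simp add: direct_sum_vdim mat_zero_mult)
  qed
  moreover have "cocycles_split n ?S W"
    unfolding cocycles_split_def
  proof (intro allI impI)
    fix \<phi> :: "nat \<Rightarrow> 'k mat"
    assume "\<forall>x. 1 \<le> x \<longrightarrow> x < n \<longrightarrow> \<phi> x \<in> arrow_homs ?S W x"
    then have phi: "\<And>x. 1 \<le> x \<Longrightarrow> x < n \<Longrightarrow> \<phi> x \<in> carrier_mat (vdim W (Suc x)) (vdim A x + vdim B x)"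
      by (simp add: direct_sum_vdim)
    have phi1: "\<phi> x * ?i1 x \<in> arrow_homs A W x"
      and phi2: "\<phi> x * ?i2 x \<in> arrow_homs B W x" if "1 \<le> x" "x < n" for x
      using phi[OF that] by (auto intro!: carrier_matI)
    obtain h1 where h1: "\<And>x. 1 \<le> x \<Longrightarrow> x \<le> n \<Longrightarrow> h1 x \<in> homs A W x"
      and eq1: "\<And>x. 1 \<le> x \<Longrightarrow> x < n \<Longrightarrow> \<phi> x * ?i1 x = h1 (Suc x) * vmap A x - vmap W x * h1 x"
      using cocycles_splitD[OF C(1) phi1] by auto
    obtain h2 where h2: "\<And>x. 1 \<le> x \<Longrightarrow> x \<le> n \<Longrightarrow> h2 x \<in> homs B W x"
      and eq2: "\<And>x. 1 \<le> x \<Longrightarrow> x < n \<Longrightarrow> \<phi> x * ?i2 x = h2 (Suc x) * vmap B x - vmap W x * h2 x"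
      using cocycles_splitD[OF C(2) phi2] by auto
    define h where "h x = h1 x * ?p1 x + h2 x * ?p2 x" for x
    have h: "h x \<in> homs ?S W x" if "1 \<le> x" "x \<le> n" for x
      using h1[OF that] h2[OF that] by (auto intro!: carrier_matI simp: h_def direct_sum_vdim)
    have "\<phi> x = h (Suc x) * vmap ?S x - vmap W x * h x" if x: "1 \<le> x" "x < n" for x
    proof -
      have x': "1 \<le> Suc x" "Suc x \<le> n" "x \<le> n" using x by auto
      note d = carrier_matD[OF h1[OF x(1) x'(3)]] carrier_matD[OF h1[OF x'(1,2)]]
        carrier_matD[OF h2[OF x(1) x'(3)]] carrier_matD[OF h2[OF x'(1,2)]]
        is_repD[OF A x] is_repD[OF B x] is_repD[OF W x] is_repD[OF direct_sum_is_rep x, unfolded direct_sum_vdim]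
        carrier_matD[OF phi[OF x]]
      let ?a = "h1 (Suc x) * (vmap A x * ?p1 x)" and ?b = "vmap W x * (h1 x * ?p1 x)"
        and ?c = "h2 (Suc x) * (vmap B x * ?p2 x)" and ?d = "vmap W x * (h2 x * ?p2 x)"
      have c: "?a \<in> carrier_mat (vdim W (Suc x)) (vdim A x + vdim B x)" "?b \<in> carrier_mat (vdim W (Suc x)) (vdim A x + vdim B x)"
        "?c \<in> carrier_mat (vdim W (Suc x)) (vdim A x + vdim B x)" "?d \<in> carrier_mat (vdim W (Suc x)) (vdim A x + vdim B x)"
        using d by (auto intro!: carrier_matI)
      have "\<phi> x = \<phi> x * ?i1 x * ?p1 x + \<phi> x * ?i2 x * ?p2 x" by (rule split) (simp add: d)
      also have "\<dots> = (?a - ?b) + (?c - ?d)"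
        unfolding eq1[OF x] eq2[OF x] using d by (simp add: mat_minus_mult mat_mult_assoc)
      also have "\<dots> = (?a + ?c) - (?b + ?d)"
        by (rule mat_ext[of _ "vdim W (Suc x)" "vdim A x + vdim B x"])
          (use c[THEN carrier_matD(1)] c[THEN carrier_matD(2)] in \<open>auto intro!: carrier_matI simp del: index_mult_mat(1)\<close>)
      also have "?a + ?c = h (Suc x) * vmap ?S x"
        unfolding h_def direct_sum_vmap(3,4)[OF x, symmetric] using d
          by (simp add: mat_add_mult mat_mult_assoc)
      also have "?b + ?d = vmap W x * h x"
        unfolding h_def using d by (simp add: mat_mult_add)
      finally show ?thesis .
    qed
    then show "\<exists>h. (\<forall>x. 1 \<le> x \<longrightarrow> x \<le> n \<longrightarrow> h x \<in> homs ?S W x) \<and>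
      (\<forall>x. 1 \<le> x \<longrightarrow> x < n \<longrightarrow> \<phi> x = h (Suc x) * vmap ?S x - vmap W x * h x)"
      using h by (intro exI[of _ h]) blast
  qed
  ultimately show "W \<in> perp n ?S" using W perp_iff[OF direct_sum_is_rep] by blast
qed

end

text \<open>Turns the single direct sum in \<open>relatively_projective\<close> into one condition
  for each later object.\<close>

lemma direct_sum_list_perp:
  assumes "\<forall>E\<in>set Es. is_rep n E"
  shows "is_rep n (direct_sum_list Es) \<and>
    perp n (direct_sum_list Es) = {W. is_rep n W \<and> (\<forall>E\<in>set Es. W \<in> perp n E)}"
  using assms
proof (induction Es)
  case Nil
  \<comment> \<open>For the last object of a sequence the sum is empty, and every representation is
    perpendicular to it.\<close>
  have z: "is_rep n (zero_rep :: 'a rep)" by (auto simp: is_rep_def zero_rep_def)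
  have "Hom_zero n (zero_rep :: 'a rep) W" for W
    unfolding Hom_zero_def rep_hom_def by (auto simp: zero_rep_def intro!: eq_matI)
  moreover have "cocycles_split n (zero_rep :: 'a rep) W" if "is_rep n W" for W
    unfolding cocycles_split_def
  proof (intro allI impI exI[of _ "\<lambda>x. 0\<^sub>m (vdim W x) 0"] conjI)
    fix \<phi> :: "nat \<Rightarrow> 'a mat" and x
    assume p: "\<forall>x. 1 \<le> x \<longrightarrow> x < n \<longrightarrow> \<phi> x \<in> arrow_homs (zero_rep :: 'a rep) W x"
      and x: "1 \<le> x" "x < n"
    then show "\<phi> x = 0\<^sub>m (vdim W (Suc x)) 0 * vmap zero_rep x - vmap W x * 0\<^sub>m (vdim W x) 0"
      using is_repD[OF that x] by (intro eq_matI) (auto simp: zero_rep_def)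
  qed (simp add: zero_rep_def)
  ultimately show ?case using z perp_iff[OF z] by (auto simp: direct_sum_list_def)
next
  case (Cons E Es)
  then have E: "is_rep n E" and Es: "is_rep n (direct_sum_list Es)" by auto
  have "direct_sum_list (E # Es) = direct_sum E (direct_sum_list Es)" by (simp add: direct_sum_list_def)
  then show ?case
    using perp_direct_sum[OF E Es] direct_sum_is_rep[OF E Es] Cons perp_iff[OF E] by auto
qed

subsection \<open>Cokernels and epimorphisms in perpendicular categories\<close>

text \<open>The cokernels at the vertices carry the induced arrows
  \<open>\<pi> * vmap Y * s\<close>. The splittings s and t are families of matrices that need not
  commute with the arrows.\<close>

lemma cokernel_rep:
  assumes X: "is_rep n X" and Y: "is_rep n Y" and g: "rep_hom n X Y g"
  shows "\<exists>Z \<pi> s t. is_rep n Z \<and> rep_hom n Y Z \<pi> \<and>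
    (\<forall>x\<in>{1..n}. s x \<in> homs Z Y x \<and> t x \<in> homs Y X x \<and>
      \<pi> x * g x = 0\<^sub>m (vdim Z x) (vdim X x) \<and> \<pi> x * s x = 1\<^sub>m (vdim Z x) \<and>
      s x * \<pi> x + g x * t x = 1\<^sub>m (vdim Y x))"
proof -
  define P where "P x r \<pi> s t \<longleftrightarrow> \<pi> \<in> carrier_mat r (vdim Y x) \<and> s \<in> carrier_mat (vdim Y x) r \<and>
    t \<in> homs Y X x \<and> \<pi> * g x = 0\<^sub>m r (vdim X x) \<and> \<pi> * s = 1\<^sub>m r \<and>
    s * \<pi> + g x * t = 1\<^sub>m (vdim Y x)" for x r \<pi> s t
  have "\<forall>x\<in>{1..n}. \<exists>q. P x (fst q) (fst (snd q)) (fst (snd (snd q))) (snd (snd (snd q)))"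
  proof
    fix x assume "x \<in> {1..n}"
    then have "g x \<in> homs X Y x" using g unfolding rep_hom_def by auto
    from cokernel_matrix[OF this] obtain r \<pi> s t where "P x r \<pi> s t" unfolding P_def by blast
    then show "\<exists>q. P x (fst q) (fst (snd q)) (fst (snd (snd q))) (snd (snd (snd q)))"
      by (intro exI[of _ "(r, \<pi>, s, t)"]) simp
  qed
  from bchoice[OF this] obtain q
    where q: "\<forall>x\<in>{1..n}. P x (fst (q x)) (fst (snd (q x))) (fst (snd (snd (q x)))) (snd (snd (snd (q x))))"
    by blast
  define r \<pi> s t where "r x = fst (q x)" and "\<pi> x = fst (snd (q x))" and "s x = fst (snd (snd (q x)))"
    and "t x = snd (snd (snd (q x)))" for x
  have P: "P x (r x) (\<pi> x) (s x) (t x)" if "1 \<le> x" "x \<le> n" for x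
    using q that unfolding r_def \<pi>_def s_def t_def by auto
  define Z where "Z = \<lparr>vdim = r, vmap = \<lambda>x. \<pi> (x + 1) * vmap Y x * s x\<rparr>"
  have Zd: "vdim Z x = r x" for x by (simp add: Z_def)
  have Z: "is_rep n Z"
    unfolding is_rep_def
  proof
    fix x assume "x \<in> {1..<n}"
    then have x: "1 \<le> x" "x \<le> n" "1 \<le> x + 1" "x + 1 \<le> n" by auto
    show "vmap Z x \<in> carrier_mat (vdim Z (x + 1)) (vdim Z x)"
      using P[OF x(1,2)] P[OF x(3,4)] unfolding P_def Z_def by (auto intro!: carrier_matI)
  qed
  have "rep_hom n Y Z \<pi>"
  proof (rule rep_homI)
    fix x assume x: "1 \<le> x" "x < n"
    then have x': "1 \<le> Suc x" "Suc x \<le> n" "x \<le> n" by auto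
    note p = P[OF x(1) x'(3), unfolded P_def] P[OF x'(1,2), unfolded P_def]
    note d = is_repD[OF Y x] is_repD[OF X x] rep_homD[OF g x(1) x'(3)] rep_homD[OF g x'(1,2)]
    have c: "dim_row (\<pi> x) = r x" "dim_col (\<pi> x) = vdim Y x" "dim_row (s x) = vdim Y x" "dim_col (s x) = r x"
      "dim_row (t x) = vdim X x" "dim_col (t x) = vdim Y x"
      "dim_row (\<pi> (Suc x)) = r (Suc x)" "dim_col (\<pi> (Suc x)) = vdim Y (Suc x)" using p by auto
    \<comment> \<open>Insert \<open>s x * \<pi> x + g x * t x = 1\<close>; the second summand dies
      because g commutes with the arrows and \<open>\<pi> * g = 0\<close>.\<close>
    have "\<pi> (Suc x) * vmap Y x = \<pi> (Suc x) * (vmap Y x * (s x * \<pi> x + g x * t x))"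
      using p d by (simp add: right_mult_one_mat')
    also have "\<dots> = \<pi> (Suc x) * (vmap Y x * (s x * \<pi> x)) + \<pi> (Suc x) * (vmap Y x * (g x * t x))"
      using c d by (simp add: mat_mult_add)
    also have "vmap Y x * (g x * t x) = g (Suc x) * (vmap X x * t x)"
      by (rule rep_hom_commute_assoc[OF g X Y x, symmetric]) (simp add: c)
    also have "\<pi> (Suc x) * (g (Suc x) * (vmap X x * t x)) = 0\<^sub>m (r (Suc x)) (dim_col (vmap X x * t x))"
      by (rule mat_zero_assoc[of _ _ _ "vdim X (Suc x)"]) (use p c d in auto)
    also have "\<pi> (Suc x) * (vmap Y x * (s x * \<pi> x)) = vmap Z x * \<pi> x"
      using c d by (simp add: Z_def mat_mult_assoc)
    also have "vmap Z x * \<pi> x + 0\<^sub>m (r (Suc x)) (dim_col (vmap X x * t x)) = vmap Z x * \<pi> x"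
      by (rule right_add_zero_mat) (auto intro!: carrier_matI simp: Z_def c)
    finally show "\<pi> (Suc x) * vmap Y x = vmap Z x * \<pi> x" .
  qed (use P in \<open>auto simp: P_def Zd\<close>)
  then show ?thesis using Z P unfolding P_def
    by (intro exI[of _ Z] exI[of _ \<pi>] exI[of _ s] exI[of _ t]) (simp add: Zd)
qed

text \<open>Right exactness of Ext makes Ext from V to Z vanish. A morphism from V to Z has its
  obstruction to lifting to Y in the Ext from V to the image of g, a quotient of the Ext from V to
  X, which is zero. So it lifts, and the lift is zero because Hom from V to Y is.\<close>

lemma cokernel_in_perp:
  assumes V: "is_rep n V" and X: "X \<in> perp n V" and Y: "Y \<in> perp n V" and Z: "is_rep n Z"
    and g: "rep_hom n X Y g" and p: "rep_hom n Y Z \<pi>"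
    and st: "\<And>x. 1 \<le> x \<Longrightarrow> x \<le> n \<Longrightarrow> s x \<in> homs Z Y x"
      "\<And>x. 1 \<le> x \<Longrightarrow> x \<le> n \<Longrightarrow> t x \<in> homs Y X x"
      "\<And>x. 1 \<le> x \<Longrightarrow> x \<le> n \<Longrightarrow> \<pi> x * g x = 0\<^sub>m (vdim Z x) (vdim X x)"
      "\<And>x. 1 \<le> x \<Longrightarrow> x \<le> n \<Longrightarrow> \<pi> x * s x = 1\<^sub>m (vdim Z x)"
      "\<And>x. 1 \<le> x \<Longrightarrow> x \<le> n \<Longrightarrow> s x * \<pi> x + g x * t x = 1\<^sub>m (vdim Y x)"
  shows "Z \<in> perp n V"
proof -
  have Xr: "is_rep n X" and CX: "cocycles_split n V X" and Yr: "is_rep n Y"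
    and HY: "Hom_zero n V Y" and CY: "cocycles_split n V Y" using X Y perp_iff[OF V] by auto
  note ds = carrier_matD[OF st(1)] carrier_matD[OF st(2)]
  have "Hom_zero n V Z"
    unfolding Hom_zero_def
  proof (intro allI impI ballI)
    fix f x0 assume f: "rep_hom n V Z f" and x0: "x0 \<in> {1..n}"
    \<comment> \<open>F lifts f at each vertex, and \<phi> is its failure to be a morphism. It turns
      out that \<open>\<pi> * \<phi> = 0\<close>, so \<phi> comes from X through t.\<close>
    define F where "F x = s x * f x" for x
    define \<phi> where "\<phi> x = F (Suc x) * vmap V x - vmap Y x * F x" for x
    have Fd: "dim_row (F x) = vdim Y x" "dim_col (F x) = vdim V x" if "1 \<le> x" "x \<le> n" for x
      using ds[OF that] rep_homD[OF f that] by (auto simp: F_def)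
    have \<pi>F: "\<pi> x * F x = f x" if x: "1 \<le> x" "x \<le> n" for x
      unfolding F_def by (rule mat_one_assoc[OF st(4)[OF x]]) (simp_all add: ds[OF x] rep_homD[OF f x] rep_homD[OF p x])
    have phi: "t (Suc x) * \<phi> x \<in> arrow_homs V X x" if x: "1 \<le> x" "x < n" for x
      using ds[of "Suc x"] Fd[of x] is_repD[OF Yr x] x by (auto intro!: carrier_matI simp: \<phi>_def)
    obtain \<eta> where \<eta>: "\<And>x. 1 \<le> x \<Longrightarrow> x \<le> n \<Longrightarrow> \<eta> x \<in> homs V X x"
      and eq: "\<And>x. 1 \<le> x \<Longrightarrow> x < n \<Longrightarrow> t (Suc x) * \<phi> x = \<eta> (Suc x) * vmap V x - vmap X x * \<eta> x"
      using cocycles_splitD[OF CX phi] by auto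
    \<comment> \<open>A splitting \<eta> of \<open>t * \<phi>\<close> in X corrects the vertexwise
      lift to a genuine one.\<close>
    have "rep_hom n V Y (\<lambda>x. F x - g x * \<eta> x)"
    proof (rule rep_homI)
      fix x assume x: "1 \<le> x" "x < n"
      then have x': "1 \<le> Suc x" "Suc x \<le> n" "x \<le> n" by auto
      note d = ds[OF x(1) x'(3)] ds[OF x'(1,2)] Fd[OF x(1) x'(3)] Fd[OF x'(1,2)]
        carrier_matD[OF \<eta>[OF x(1) x'(3)]] carrier_matD[OF \<eta>[OF x'(1,2)]]
        rep_homD[OF g x(1) x'(3)] rep_homD[OF g x'(1,2)] rep_homD[OF p x(1) x'(3)] rep_homD[OF p x'(1,2)]
        rep_homD[OF f x(1) x'(3)] rep_homD[OF f x'(1,2)]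
        is_repD[OF V x] is_repD[OF Xr x] is_repD[OF Yr x] is_repD[OF Z x]
      have \<phi>d: "dim_row (\<phi> x) = vdim Y (Suc x)" "dim_col (\<phi> x) = vdim V x"
        by (auto simp: \<phi>_def d)
      have "\<pi> (Suc x) * \<phi> x = \<pi> (Suc x) * (F (Suc x) * vmap V x) - \<pi> (Suc x) * (vmap Y x * F x)"
        unfolding \<phi>_def by (rule mat_mult_minus) (simp_all add: d)
      also have "\<pi> (Suc x) * (F (Suc x) * vmap V x) = \<pi> (Suc x) * F (Suc x) * vmap V x"
        by (rule mat_mult_assoc[symmetric]) (simp_all add: d)
      also have "\<dots> = vmap Z x * f x" unfolding \<pi>F[OF x'(1,2)] by (rule rep_hom_commute[OF f x])
      also have "\<pi> (Suc x) * (vmap Y x * F x) = vmap Z x * (\<pi> x * F x)"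
        by (rule rep_hom_commute_assoc[OF p Yr Z x]) (simp add: d)
      also have "\<dots> = vmap Z x * f x" unfolding \<pi>F[OF x(1) x'(3)] ..
      also have "vmap Z x * f x - vmap Z x * f x = 0\<^sub>m (vdim Z (Suc x)) (vdim V x)"
        by (rule eq_matI) (auto simp: d)
      finally have \<pi>\<phi>: "\<pi> (Suc x) * \<phi> x = 0\<^sub>m (vdim Z (Suc x)) (vdim V x)" .
      have "\<phi> x = (s (Suc x) * \<pi> (Suc x) + g (Suc x) * t (Suc x)) * \<phi> x"
        unfolding st(5)[OF x'(1,2)] by (simp add: left_mult_one_mat' \<phi>d)
      also have "\<dots> = s (Suc x) * (\<pi> (Suc x) * \<phi> x) + g (Suc x) * (t (Suc x) * \<phi> x)"
        by (simp add: mat_add_mult mat_mult_assoc d \<phi>d)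
      also have "\<dots> = g (Suc x) * (t (Suc x) * \<phi> x)"
        unfolding \<pi>\<phi>
          by (simp add: mat_mult_zero d) (rule left_add_zero_mat, auto intro!: carrier_matI simp: d \<phi>d)
      also have "\<dots> = g (Suc x) * (\<eta> (Suc x) * vmap V x) - g (Suc x) * (vmap X x * \<eta> x)"
        unfolding eq[OF x] by (rule mat_mult_minus) (simp_all add: d)
      also have "g (Suc x) * (vmap X x * \<eta> x) = vmap Y x * (g x * \<eta> x)"
        by (rule rep_hom_commute_assoc[OF g Xr Yr x]) (simp add: d)
      finally have e: "F (Suc x) * vmap V x - vmap Y x * F x
        = g (Suc x) * (\<eta> (Suc x) * vmap V x) - vmap Y x * (g x * \<eta> x)" unfolding \<phi>_def .
      let ?a = "F (Suc x) * vmap V x" and ?b = "vmap Y x * F x"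
        and ?c = "g (Suc x) * (\<eta> (Suc x) * vmap V x)" and ?d = "vmap Y x * (g x * \<eta> x)"
      have c: "dim_row ?a = vdim Y (Suc x)" "dim_col ?a = vdim V x" "dim_row ?b = vdim Y (Suc x)" "dim_col ?b = vdim V x"
        "dim_row ?c = vdim Y (Suc x)" "dim_col ?c = vdim V x" "dim_row ?d = vdim Y (Suc x)" "dim_col ?d = vdim V x"
        by (auto simp: d)
      have "?a - ?c = ?b - ?d"
      proof (rule mat_ext[of _ "vdim Y (Suc x)" "vdim V x"])
        fix i j assume ij: "i < vdim Y (Suc x)" "j < vdim V x"
        have "(?a - ?b) $$ (i, j) = (?c - ?d) $$ (i, j)" by (simp only: e)
        then show "(?a - ?c) $$ (i, j) = (?b - ?d) $$ (i, j)"
          using ij c by (simp del: index_mult_mat add: algebra_simps)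
      qed (auto intro!: carrier_matI simp: c simp del: index_mult_mat)
      moreover have "(F (Suc x) - g (Suc x) * \<eta> (Suc x)) * vmap V x = ?a - ?c"
        by (simp add: mat_minus_mult mat_mult_assoc d)
      moreover have "vmap Y x * (F x - g x * \<eta> x) = ?b - ?d" by (simp add: mat_mult_minus d)
      ultimately show "(F (Suc x) - g (Suc x) * \<eta> (Suc x)) * vmap V x = vmap Y x * (F x - g x * \<eta> x)" by simp
    next
      fix x assume x: "1 \<le> x" "x \<le> n"
      show "F x - g x * \<eta> x \<in> homs V Y x"
        by (auto intro!: carrier_matI simp: rep_homD[OF g x] carrier_matD[OF \<eta>[OF x]])
    qed
    from Hom_zeroD[OF HY this, of x0] x0
    have z: "F x0 - g x0 * \<eta> x0 = 0\<^sub>m (vdim Y x0) (vdim V x0)" by simp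
    have x: "1 \<le> x0" "x0 \<le> n" using x0 by auto
    note d = ds[OF x] Fd[OF x] carrier_matD[OF \<eta>[OF x]] rep_homD[OF g x] rep_homD[OF p x] rep_homD[OF f x]
    have "\<pi> x0 * (F x0 - g x0 * \<eta> x0) = f x0 - \<pi> x0 * (g x0 * \<eta> x0)"
      unfolding \<pi>F[OF x, symmetric] by (rule mat_mult_minus) (simp_all add: d)
    also have "\<pi> x0 * (g x0 * \<eta> x0) = 0\<^sub>m (vdim Z x0) (dim_col (\<eta> x0))"
      by (rule mat_zero_assoc[OF st(3)[OF x]]) (simp_all add: d)
    also have "f x0 - \<dots> = f x0" by (rule eq_matI) (auto simp: d)
    finally show "f x0 = 0\<^sub>m (vdim Z x0) (vdim V x0)" unfolding z by (simp add: mat_mult_zero d)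
  qed
  moreover have "cocycles_split n V Z"
    unfolding cocycles_split_def
  proof (intro allI impI)
    fix \<phi> :: "nat \<Rightarrow> 'a mat"
    assume "\<forall>x. 1 \<le> x \<longrightarrow> x < n \<longrightarrow> \<phi> x \<in> arrow_homs V Z x"
    then have phi: "\<And>x. 1 \<le> x \<Longrightarrow> x < n \<Longrightarrow> \<phi> x \<in> arrow_homs V Z x" by blast
    \<comment> \<open>A cochain lifts from Z to Y by applying s, with no compatibility to check;
      this is the right exactness.\<close>
    have phi': "s (Suc x) * \<phi> x \<in> arrow_homs V Y x" if x: "1 \<le> x" "x < n" for x
      using ds[of "Suc x"] phi[OF x] x by (auto intro!: carrier_matI)
    obtain h where h: "\<And>x. 1 \<le> x \<Longrightarrow> x \<le> n \<Longrightarrow> h x \<in> homs V Y x"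
      and eq: "\<And>x. 1 \<le> x \<Longrightarrow> x < n \<Longrightarrow> s (Suc x) * \<phi> x = h (Suc x) * vmap V x - vmap Y x * h x"
      using cocycles_splitD[OF CY phi'] by auto
    have "\<phi> x = \<pi> (Suc x) * h (Suc x) * vmap V x - vmap Z x * (\<pi> x * h x)" if x: "1 \<le> x" "x < n" for x
    proof -
      have x': "1 \<le> Suc x" "Suc x \<le> n" "x \<le> n" using x by auto
      note d = ds[OF x(1) x'(3)] ds[OF x'(1,2)] carrier_matD[OF h[OF x(1) x'(3)]] carrier_matD[OF h[OF x'(1,2)]]
        rep_homD[OF p x(1) x'(3)] rep_homD[OF p x'(1,2)] is_repD[OF V x] is_repD[OF Yr x] is_repD[OF Z x]
        carrier_matD[OF phi[OF x]]
      have "\<phi> x = \<pi> (Suc x) * (s (Suc x) * \<phi> x)"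
        by (rule mat_one_assoc[OF st(4)[OF x'(1,2)], symmetric]) (simp_all add: d)
      also have "\<dots> = \<pi> (Suc x) * (h (Suc x) * vmap V x) - \<pi> (Suc x) * (vmap Y x * h x)"
        unfolding eq[OF x] by (rule mat_mult_minus) (simp_all add: d)
      also have "\<pi> (Suc x) * (vmap Y x * h x) = vmap Z x * (\<pi> x * h x)"
        by (rule rep_hom_commute_assoc[OF p Yr Z x]) (simp add: d)
      also have "\<pi> (Suc x) * (h (Suc x) * vmap V x) = \<pi> (Suc x) * h (Suc x) * vmap V x"
        by (rule mat_mult_assoc[symmetric]) (simp_all add: d)
      finally show ?thesis .
    qed
    moreover have "\<pi> x * h x \<in> homs V Z x" if "1 \<le> x" "x \<le> n" for x
      using h[OF that] rep_homD[OF p that] by (auto intro!: carrier_matI)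
    ultimately show "\<exists>h. (\<forall>x. 1 \<le> x \<longrightarrow> x \<le> n \<longrightarrow> h x \<in> homs V Z x) \<and>
      (\<forall>x. 1 \<le> x \<longrightarrow> x < n \<longrightarrow> \<phi> x = h (Suc x) * vmap V x - vmap Z x * h x)"
      by (intro exI[of _ "\<lambda>x. \<pi> x * h x"]) blast
  qed
  ultimately show ?thesis using Z perp_iff[OF V] by blast
qed

lemma zero_rep_hom: "is_rep n V \<Longrightarrow> is_rep n W \<Longrightarrow> rep_hom n V W (\<lambda>x. 0\<^sub>m (vdim W x) (vdim V x))"
  by (rule rep_homI) (auto simp: mat_zero_mult mat_mult_zero is_repD)

text \<open>The cokernel of a morphism between objects of a perpendicular category lies in it again,
  so epimorphisms of that subcategory are surjective.\<close>

lemma epi_in_perp_right_inverse: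
  assumes V: "is_rep n V" and X: "X \<in> perp n V" and Y: "Y \<in> perp n V"
    and e: "epi_in n (perp n V) X Y g"
  shows "\<exists>t. \<forall>x\<in>{1..n}. t x \<in> homs Y X x \<and> g x * t x = 1\<^sub>m (vdim Y x)"
proof -
  have r: "is_rep n X" "is_rep n Y" using X Y unfolding perp_def by auto
  have g: "rep_hom n X Y g" using e unfolding epi_in_def by auto
  obtain Z \<pi> s t where Z: "is_rep n Z" and p: "rep_hom n Y Z \<pi>" and
    st: "\<forall>x\<in>{1..n}. s x \<in> homs Z Y x \<and> t x \<in> homs Y X x \<and>
      \<pi> x * g x = 0\<^sub>m (vdim Z x) (vdim X x) \<and> \<pi> x * s x = 1\<^sub>m (vdim Z x) \<and>
      s x * \<pi> x + g x * t x = 1\<^sub>m (vdim Y x)"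
    using cokernel_rep[OF r g] by blast
  have ZC: "Z \<in> perp n V"
    by (rule cokernel_in_perp[OF V X Y Z g p, of s t]) (use st in auto)
  have z: "rep_hom n Y Z (\<lambda>x. 0\<^sub>m (vdim Z x) (vdim Y x))" by (rule zero_rep_hom[OF r(2) Z])
  have "\<forall>x\<in>{1..n}. \<pi> x * g x = 0\<^sub>m (vdim Z x) (vdim Y x) * g x"
    using st rep_homD[OF g] by (auto simp: mat_zero_mult)
  then have pz: "\<forall>x\<in>{1..n}. \<pi> x = 0\<^sub>m (vdim Z x) (vdim Y x)"
    using e ZC p z unfolding epi_in_def by blast
  have "g x * t x = 1\<^sub>m (vdim Y x)" if x: "x \<in> {1..n}" for x
  proof -
    have d: "dim_row (s x) = vdim Y x" "dim_col (s x) = vdim Z x" "dim_row (g x) = vdim Y x" "dim_col (t x) = vdim Y x"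
      using st x rep_homD[OF g, of x] by auto
    have "1\<^sub>m (vdim Y x) = s x * \<pi> x + g x * t x" using st x by simp
    also have "s x * \<pi> x = 0\<^sub>m (vdim Y x) (vdim Y x)"
      using pz x d by (simp add: mat_mult_zero)
    also have "0\<^sub>m (vdim Y x) (vdim Y x) + g x * t x = g x * t x"
      by (rule left_add_zero_mat) (auto intro!: carrier_matI simp: d)
    finally show ?thesis ..
  qed
  then show ?thesis using st by blast
qed

lemma mat_minus_zeroD:
  fixes A :: "'a::ring mat"
  assumes "A \<in> carrier_mat r c" "B \<in> carrier_mat r c" "0\<^sub>m r c = A - B"
  shows "A = B"
proof (rule mat_ext[OF assms(1,2)])
  fix i j assume ij: "i < r" "j < c"
  have "(0\<^sub>m r c :: 'a mat) $$ (i, j) = (A - B) $$ (i, j)" by (simp only: assms(3))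
  then show "A $$ (i, j) = B $$ (i, j)" using ij assms(1,2) by simp
qed

subsection \<open>Hom and Ext from interval modules\<close>

primrec path_map :: "'k::field rep \<Rightarrow> nat \<Rightarrow> nat \<Rightarrow> 'k mat" where
  "path_map V x 0 = 1\<^sub>m (vdim V x)"
| "path_map V x (Suc k) = vmap V (x + k) * path_map V x k"

lemma path_map_dims:
  assumes "is_rep n V" "1 \<le> x" "x + k \<le> n"
  shows "dim_row (path_map V x k) = vdim V (x + k)" "dim_col (path_map V x k) = vdim V x"
  using assms(3)
proof (induction k)
  case (Suc k)
  {
    case 1 then show ?case using is_repD[OF assms(1), of "x + k"] assms(2) by simp
  next
    case 2 then show ?case using Suc by simp
  }
qed simp_all

lemma path_map_add:
  assumes "is_rep n V" "1 \<le> x" "x + k + l \<le> n"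
  shows "path_map V x (k + l) = path_map V (x + k) l * path_map V x k"
  using assms(3)
proof (induction l)
  case 0
  then show ?case using path_map_dims[OF assms(1,2), of k] by (simp add: left_mult_one_mat')
next
  case (Suc l)
  then show ?case
    using path_map_dims[OF assms(1,2), of k] path_map_dims[OF assms(1), of "x + k" l] assms(2)
      is_repD[OF assms(1), of "x + k + l"]
    by (simp add: mat_mult_assoc add.assoc)
qed

lemma path_map_commute:
  assumes V: "is_rep n V" and W: "is_rep n W" and g: "rep_hom n V W g" and "1 \<le> x" "x + k \<le> n"
  shows "g (x + k) * path_map V x k = path_map W x k * g x"
  using assms(5)
proof (induction k)
  case 0
  then show ?case using rep_homD[OF g, of x] assms(4) by (simp add: right_mult_one_mat' left_mult_one_mat')
next
  case (Suc k)
  then have IH: "g (x + k) * path_map V x k = path_map W x k * g x"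
    and k: "1 \<le> x + k" "x + k < n" "x + k \<le> n"
    using assms(4) by auto
  have "g (x + Suc k) * path_map V x (Suc k) = g (Suc (x + k)) * (vmap V (x + k) * path_map V x k)" by simp
  also have "\<dots> = vmap W (x + k) * (g (x + k) * path_map V x k)"
    by (rule rep_hom_commute_assoc[OF g V W k(1,2)]) (simp add: path_map_dims[OF V assms(4) k(3)])
  also have "\<dots> = path_map W x (Suc k) * g x" unfolding IH
    using path_map_dims[OF W assms(4) k(3)] is_repD[OF W k(1,2)] rep_homD[OF g, of x] assms(4) k
    by (simp add: mat_mult_assoc)
  finally show ?case .
qed

text \<open>Vertices are shifted by one and the zero space is added at n: in these terms Hom and Ext
  from \<open>M\<^sub>a\<^sub>,\<^sub>b\<close> to W are the kernel and the cokernel of one map, \<open>transit n W a b\<close>.\<close>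

definition udim :: "nat \<Rightarrow> 'k rep \<Rightarrow> nat \<Rightarrow> nat" where
  "udim n W a = (if a < n then vdim W (Suc a) else 0)"

definition transit :: "nat \<Rightarrow> 'k::field rep \<Rightarrow> nat \<Rightarrow> nat \<Rightarrow> 'k mat" where
  "transit n W a b = (if b < n then path_map W (Suc a) (b - a) else 0\<^sub>m 0 (udim n W a))"

text \<open>Elements are one-column matrices, so that applying a map is matrix multiplication and
  the product laws serve for both.\<close>

abbreviation colvecs :: "nat \<Rightarrow> 'k mat set" where
  "colvecs d \<equiv> carrier_mat d 1"

lemma transit_dims:
  assumes "is_rep n W" "a \<le> b" "b \<le> n"
  shows "dim_row (transit n W a b) = udim n W b" "dim_col (transit n W a b) = udim n W a"
  using assms path_map_dims[OF assms(1), of "Suc a" "b - a"] by (auto simp: transit_def udim_def)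

lemma transit_trans:
  assumes W: "is_rep n W" and "a \<le> b" "b \<le> c" "c \<le> n"
  shows "transit n W b c * transit n W a b = transit n W a c"
proof (cases "c < n")
  case True
  then have "path_map W (Suc a) ((b - a) + (c - b)) = path_map W (Suc a + (b - a)) (c - b) * path_map W (Suc a) (b - a)"
    using assms by (intro path_map_add[OF W]) auto
  then show ?thesis using assms True by (simp add: transit_def)
next
  case False
  then show ?thesis using assms transit_dims[OF W, of a b] by (simp add: transit_def mat_zero_mult)
qed

lemma transit_trans_assoc:
  assumes W: "is_rep n W" and "a \<le> b" "b \<le> c" "c \<le> n" and u: "u \<in> colvecs (udim n W a)"
  shows "transit n W b c * (transit n W a b * u) = transit n W a c * u"
  unfolding transit_trans[OF assms(1-4), symmetric]
  by (rule mat_mult_assoc[symmetric]) (use assms transit_dims[OF W] in auto)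

lemma transit_colvecs: "is_rep n W \<Longrightarrow> a \<le> b \<Longrightarrow> b \<le> n \<Longrightarrow> u \<in> colvecs (udim n W a) \<Longrightarrow> transit n W a b * u \<in> colvecs (udim n W b)"
  using transit_dims[of n W a b] by (auto intro!: carrier_matI)

text \<open>The bound \<open>b < n\<close> is there because a morphism has no component at the added
  zero space.\<close>

lemma transit_commute:
  assumes V: "is_rep n V" and W: "is_rep n W" and g: "rep_hom n V W g" and "a \<le> b" "b < n"
    and u: "u \<in> colvecs (udim n V a)"
  shows "g (Suc b) * (transit n V a b * u) = transit n W a b * (g (Suc a) * u)"
proof (rule mat_eq_assoc)
  show "g (Suc b) * transit n V a b = transit n W a b * g (Suc a)"
    using path_map_commute[OF V W g, of "Suc a" "b - a"] assms by (simp add: transit_def)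
qed (use assms transit_dims[OF V, of a b] transit_dims[OF W, of a b] rep_homD[OF g, of "Suc a"] rep_homD[OF g, of "Suc b"] in
    \<open>auto simp: udim_def\<close>)

section \<open>Morphisms and cocycles out of an interval module\<close>

lemma interval_rep_simps:
  "vdim (interval_rep a b) x = (if a < x \<and> x \<le> b then 1 else 0)"
  "vmap (interval_rep a b) x = (if a < x \<and> x + 1 \<le> b then 1\<^sub>m 1
     else 0\<^sub>m (if a < x + 1 \<and> x + 1 \<le> b then 1 else 0) (if a < x \<and> x \<le> b then 1 else 0))"
  by (simp_all add: interval_rep_def Let_def)

lemma interval_is_rep: "is_rep n (interval_rep a b)"
  by (auto simp: is_rep_def interval_rep_simps)

text \<open>An interval module is generated by its basis vector at vertex a + 1; u is the image of
  this generator.\<close>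

definition interval_hom :: "'k::field rep \<Rightarrow> nat \<Rightarrow> nat \<Rightarrow> 'k mat \<Rightarrow> nat \<Rightarrow> 'k mat" where
  "interval_hom W a b u x = (if a < x \<and> x \<le> b then path_map W (Suc a) (x - Suc a) * u else 0\<^sub>m (vdim W x) 0)"

lemma interval_hom_rep_hom:
  assumes W: "is_rep n W" and "a < b" "b \<le> n" and u: "u \<in> colvecs (udim n W a)"
    and z: "transit n W a b * u = 0\<^sub>m (udim n W b) 1"
  shows "rep_hom n (interval_rep a b) W (interval_hom W a b u)"
proof (rule rep_homI)
  fix x assume x: "1 \<le> x" "x \<le> n"
  show "interval_hom W a b u x \<in> homs (interval_rep a b :: 'a rep) W x"
    using path_map_dims[OF W, of "Suc a" "x - Suc a"] u x
    by (auto intro!: carrier_matI simp: interval_hom_def interval_rep_simps)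
next
  fix x assume x: "1 \<le> x" "x < n"
  have dW: "dim_row (vmap W x) = vdim W (Suc x)" "dim_col (vmap W x) = vdim W x" using is_repD[OF W x] by auto
  consider "x < a" | "x = a" | "a < x" "x < b" | "x = b" | "b < x" by linarith
  then show "interval_hom W a b u (Suc x) * vmap (interval_rep a b) x = vmap W x * interval_hom W a b u x"
  proof cases
    case 3
    have "path_map W (Suc a) (x - a) = vmap W x * path_map W (Suc a) (x - Suc a)"
      using 3 by (simp add: Suc_diff_Suc[symmetric] del: diff_Suc_Suc)
    then show ?thesis using 3 dW path_map_dims[OF W, of "Suc a" "x - Suc a"] x u assms
      by (simp add: interval_hom_def interval_rep_simps mat_mult_assoc udim_def right_mult_one_mat')
  next
    \<comment> \<open>The arrow leaving the support is the single relation on the generator, and the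
      one place where z enters.\<close>
    case 4
    have "path_map W (Suc a) (x - a) = vmap W x * path_map W (Suc a) (x - Suc a)"
      using 4 assms by (simp add: Suc_diff_Suc[symmetric] del: diff_Suc_Suc)
    then have "vmap W x * (path_map W (Suc a) (x - Suc a) * u) = 0\<^sub>m (vdim W (Suc x)) 1"
      using z 4 x dW path_map_dims[OF W, of "Suc a" "x - Suc a"] u assms
      by (simp add: transit_def udim_def mat_mult_assoc)
    then show ?thesis using 4 assms
      by (simp add: interval_hom_def interval_rep_simps mat_mult_zero)
  qed (use x dW assms in \<open>auto simp: interval_hom_def interval_rep_simps mat_mult_zero mat_mult_dim0 intro!: eq_matI\<close>)
qed

text \<open>Converse to \<open>interval_hom_rep_hom\<close>: following the arrows inside the support
  determines f from the image of the generator.\<close>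

lemma hom_from_interval:
  assumes W: "is_rep n W" and ab: "a < b" "b \<le> n" and f: "rep_hom n (interval_rep a b) W f"
  shows "f (Suc a) \<in> colvecs (udim n W a)" "transit n W a b * f (Suc a) = 0\<^sub>m (udim n W b) 1"
    and "1 \<le> x \<Longrightarrow> x \<le> n \<Longrightarrow> f x = interval_hom W a b (f (Suc a)) x"
proof -
  note fd = rep_homD[OF f, unfolded interval_rep_simps]
  show u: "f (Suc a) \<in> colvecs (udim n W a)"
    using fd[of "Suc a"] assms by (auto intro!: carrier_matI simp: udim_def)
  have *: "f (Suc a + k) = path_map W (Suc a) k * f (Suc a)" if "a + k < b" for k
    using that
  proof (induction k)
    case 0
    then show ?case using u assms by (simp add: udim_def left_mult_one_mat')
  next
    case (Suc k)
    have "f (Suc (Suc a + k)) * vmap (interval_rep a b) (Suc a + k) = vmap W (Suc a + k) * f (Suc a + k)"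
      by (rule rep_hom_commute[OF f]) (use Suc assms in auto)
    then show ?case
      using Suc assms fd(2)[of "Suc (Suc a + k)"] path_map_dims[OF W, of "Suc a" k] u is_repD[OF W, of "Suc a + k"]
      by (simp add: interval_rep_simps right_mult_one_mat' mat_mult_assoc udim_def)
  qed
  show "transit n W a b * f (Suc a) = 0\<^sub>m (udim n W b) 1"
  proof (cases "b < n")
    case True
    have e: "b = Suc a + (b - Suc a)" using assms by simp
    have "f (Suc b) * vmap (interval_rep a b) b = vmap W b * f b"
      by (rule rep_hom_commute[OF f]) (use True assms in auto)
    also have "f b = path_map W (Suc a) (b - Suc a) * f (Suc a)" using *[of "b - Suc a"] assms by simp
    also have "vmap W b * (path_map W (Suc a) (b - Suc a) * f (Suc a)) = path_map W (Suc a) (b - a) * f (Suc a)"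
    proof -
      have "path_map W (Suc a) (b - a) = vmap W b * path_map W (Suc a) (b - Suc a)"
        using assms by (simp add: Suc_diff_Suc[symmetric] del: diff_Suc_Suc)
      then show ?thesis using assms True path_map_dims[OF W, of "Suc a" "b - Suc a"] u is_repD[OF W, of b]
        by (simp add: mat_mult_assoc udim_def)
    qed
    finally show ?thesis using True assms fd[of "Suc b"]
      by (simp add: transit_def udim_def interval_rep_simps mat_mult_zero)
  next
    case False
    then show ?thesis using u assms by (simp add: transit_def udim_def mat_zero_mult)
  qed
  show "f x = interval_hom W a b (f (Suc a)) x" if x: "1 \<le> x" "x \<le> n"
  proof (cases "a < x \<and> x \<le> b")
    case True
    then have "a + (x - Suc a) < b" "Suc a + (x - Suc a) = x" using ab by auto
    then show ?thesis using *[of "x - Suc a"] True by (simp add: interval_hom_def)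
  next
    case False
    then show ?thesis using fd[OF x] by (auto simp: interval_hom_def intro!: eq_matI)
  qed
qed

lemma Hom_zero_interval_iff:
  assumes W: "is_rep n W" and ab: "a < b" "b \<le> n"
  shows "Hom_zero n (interval_rep a b) W \<longleftrightarrow>
    (\<forall>u\<in>colvecs (udim n W a). transit n W a b * u = 0\<^sub>m (udim n W b) 1 \<longrightarrow> u = 0\<^sub>m (udim n W a) 1)"
proof
  assume H: "Hom_zero n (interval_rep a b) W"
  show "\<forall>u\<in>colvecs (udim n W a). transit n W a b * u = 0\<^sub>m (udim n W b) 1 \<longrightarrow> u = 0\<^sub>m (udim n W a) 1"
  proof (intro ballI impI)
    fix u assume u: "u \<in> colvecs (udim n W a)" "transit n W a b * u = 0\<^sub>m (udim n W b) 1"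
    from Hom_zeroD[OF H interval_hom_rep_hom[OF W ab u], of "Suc a"]
    show "u = 0\<^sub>m (udim n W a) 1"
      using u ab by (simp add: interval_hom_def interval_rep_simps udim_def left_mult_one_mat')
  qed
next
  assume H: "\<forall>u\<in>colvecs (udim n W a). transit n W a b * u = 0\<^sub>m (udim n W b) 1 \<longrightarrow> u = 0\<^sub>m (udim n W a) 1"
  show "Hom_zero n (interval_rep a b) W"
    unfolding Hom_zero_def
  proof (intro allI impI ballI)
    fix f x assume f: "rep_hom n (interval_rep a b) W f" and "x \<in> {1..n}"
    then have x: "1 \<le> x" "x \<le> n" by auto
    note h = hom_from_interval[OF W ab f]
    have "f (Suc a) = 0\<^sub>m (udim n W a) 1" using H h(1,2) by blast
    then show "f x = 0\<^sub>m (vdim W x) (vdim (interval_rep a b :: 'a rep) x)"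
      using h(3)[OF x] path_map_dims[OF W, of "Suc a" "x - Suc a"] x ab
      by (auto simp: interval_hom_def interval_rep_simps mat_mult_zero udim_def)
  qed
qed

text \<open>The solution with initial value 0 of the recursion
  \<open>h (Suc x) = vmap W x * h x + \<phi> x\<close>, which a splitting of \<phi> has to satisfy
  inside the support.\<close>

primrec path_sum :: "'k::field rep \<Rightarrow> (nat \<Rightarrow> 'k mat) \<Rightarrow> nat \<Rightarrow> nat \<Rightarrow> 'k mat" where
  "path_sum W \<phi> x 0 = 0\<^sub>m (vdim W x) 1"
| "path_sum W \<phi> x (Suc k) = vmap W (x + k) * path_sum W \<phi> x k + \<phi> (x + k)"

text \<open>Inside the support the equations for h can be solved upwards from any initial value. The
  one obstruction is the arrow out of b, where the next value of h is an empty matrix: the initial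
  value must be chosen so that the recursion returns 0 there.\<close>

lemma cocycles_split_interval_iff:
  fixes W :: "'k::field rep"
  assumes W: "is_rep n W" and ab: "a < b" "b \<le> n"
  shows "cocycles_split n (interval_rep a b) W \<longleftrightarrow>
    (\<forall>w\<in>colvecs (udim n W b). \<exists>u\<in>colvecs (udim n W a). transit n W a b * u = w)"
proof
  assume C: "cocycles_split n (interval_rep a b) W"
  show "\<forall>w\<in>colvecs (udim n W b). \<exists>u\<in>colvecs (udim n W a). transit n W a b * u = w"
  proof
    fix w :: "'k mat"
    assume w: "w \<in> colvecs (udim n W b)"
    show "\<exists>u\<in>colvecs (udim n W a). transit n W a b * u = w"
    proof (cases "b < n")
      case False
      then show ?thesis using w ab
        by (intro bexI[of _ "0\<^sub>m (udim n W a) 1"]) (auto simp: transit_def udim_def intro!: eq_matI)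
    next
      case True
      \<comment> \<open>Concentrated on the arrow out of b, so that h just follows the arrows up to
        b. The sign compensates the minus in the coboundary.\<close>
      define \<phi> where "\<phi> x = (if x = b then - w else 0\<^sub>m (vdim W (Suc x)) (if a < x \<and> x \<le> b then 1 else 0))" for x
      have phi: "\<phi> x \<in> arrow_homs (interval_rep a b :: 'k rep) W x" for x
        using w ab True by (auto simp: \<phi>_def interval_rep_simps udim_def)
      obtain h where h: "\<And>x. 1 \<le> x \<Longrightarrow> x \<le> n \<Longrightarrow> h x \<in> homs (interval_rep a b :: 'k rep) W x"
        and eq: "\<And>x. 1 \<le> x \<Longrightarrow> x < n \<Longrightarrow> \<phi> x = h (Suc x) * vmap (interval_rep a b) x - vmap W x * h x"
        using cocycles_splitD[OF C phi] by auto
      have u: "h (Suc a) \<in> colvecs (udim n W a)" using h[of "Suc a"] ab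
        by (simp add: interval_rep_simps udim_def)
      have *: "h (Suc a + k) = path_map W (Suc a) k * h (Suc a)" if "a + k < b" for k
        using that
      proof (induction k)
        case 0
        then show ?case using u ab by (simp add: udim_def left_mult_one_mat')
      next
        case (Suc k)
        let ?x = "Suc a + k"
        have x: "1 \<le> ?x" "?x < n" "?x < b" "?x \<le> n" "Suc ?x \<le> n" using Suc ab by auto
        have hx: "h (Suc ?x) \<in> colvecs (vdim W (Suc ?x))" "h ?x \<in> colvecs (vdim W ?x)"
          using h[of "Suc ?x"] h[of ?x] x by (auto simp: interval_rep_simps)
        have "0\<^sub>m (vdim W (Suc ?x)) 1 = h (Suc ?x) - vmap W ?x * h ?x"
          using eq[OF x(1,2)] x hx by (simp add: \<phi>_def interval_rep_simps)
        then have "h (Suc ?x) = vmap W ?x * h ?x"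
          by (rule mat_minus_zeroD[rotated 2])
            (use hx is_repD[OF W x(1,2)] in \<open>auto intro!: carrier_matI\<close>)
        then show ?case using Suc path_map_dims[OF W, of "Suc a" k] u is_repD[OF W x(1,2)] x
          by (simp add: mat_mult_assoc udim_def)
      qed
      have b: "1 \<le> b" "b < n" using ab True by auto
      have hb: "h b \<in> colvecs (vdim W b)" "h (Suc b) \<in> carrier_mat (vdim W (Suc b)) 0"
        using h[of b] h[of "Suc b"] b ab by (auto simp: interval_rep_simps)
      have pb: "path_map W (Suc a) (b - a) = vmap W b * path_map W (Suc a) (b - Suc a)"
        using ab by (simp add: Suc_diff_Suc[symmetric] del: diff_Suc_Suc)
      have "h b = path_map W (Suc a) (b - Suc a) * h (Suc a)" using *[of "b - Suc a"] ab by simp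
      then have tb: "vmap W b * h b = transit n W a b * h (Suc a)"
        using b ab pb path_map_dims[OF W, of "Suc a" "b - Suc a"] is_repD[OF W b] u
        by (simp add: transit_def mat_mult_assoc udim_def)
      have z: "h (Suc b) * vmap (interval_rep a b) b = 0\<^sub>m (vdim W (Suc b)) 1"
        using hb b ab by (simp add: interval_rep_simps mat_mult_zero)
      have "- w = 0\<^sub>m (vdim W (Suc b)) 1 - vmap W b * h b"
        using eq[OF b] unfolding z by (simp add: \<phi>_def)
      then have e: "- w = 0\<^sub>m (vdim W (Suc b)) 1 - transit n W a b * h (Suc a)" unfolding tb .
      have "transit n W a b * h (Suc a) = w"
      proof (rule mat_ext[of _ "vdim W (Suc b)" 1])
        have c: "transit n W a b * h (Suc a) \<in> colvecs (vdim W (Suc b))" "w \<in> colvecs (vdim W (Suc b))"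
          using transit_colvecs[OF W _ _ u, of b] w ab b by (auto simp: udim_def)
        then show "transit n W a b * h (Suc a) \<in> colvecs (vdim W (Suc b))" "w \<in> colvecs (vdim W (Suc b))" by auto
        fix i j assume ij: "i < vdim W (Suc b)" "j < (1::nat)"
        have "(- w) $$ (i, j) = (0\<^sub>m (vdim W (Suc b)) 1 - transit n W a b * h (Suc a)) $$ (i, j)"
          by (simp only: e)
        then show "(transit n W a b * h (Suc a)) $$ (i, j) = w $$ (i, j)"
          using ij c[THEN carrier_matD(1)] c[THEN carrier_matD(2)] by (simp del: index_mult_mat)
      qed
      then show ?thesis using u by blast
    qed
  qed
next
  assume S: "\<forall>w\<in>colvecs (udim n W b). \<exists>u\<in>colvecs (udim n W a). transit n W a b * u = w"
  show "cocycles_split n (interval_rep a b) W"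
    unfolding cocycles_split_def
  proof (intro allI impI)
    fix \<phi> :: "nat \<Rightarrow> 'k mat"
    assume "\<forall>x. 1 \<le> x \<longrightarrow> x < n \<longrightarrow> \<phi> x \<in> arrow_homs (interval_rep a b :: 'k rep) W x"
    then have phi: "\<And>x. 1 \<le> x \<Longrightarrow> x < n \<Longrightarrow> \<phi> x \<in> carrier_mat (vdim W (Suc x)) (if a < x \<and> x \<le> b then 1 else 0)"
      by (simp add: interval_rep_simps)
    let ?p = "\<lambda>k. path_sum W \<phi> (Suc a) k"
    have p: "?p k \<in> colvecs (vdim W (Suc a + k))" if "a + k \<le> b" "a + k < n" for k
      using that
    proof (induction k)
      case (Suc k)
      then show ?case using phi[of "Suc a + k"] is_repD[OF W, of "Suc a + k"] by (auto intro!: carrier_matI)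
    qed simp
    \<comment> \<open>The value that cancels the particular solution beyond b. For
      \<open>b = n\<close> there is no arrow out of b and nothing to cancel.\<close>
    define w where "w = (if b < n then - ?p (b - a) else 0\<^sub>m 0 1)"
    have "w \<in> colvecs (udim n W b)" using p[of "b - a"] ab by (auto simp: w_def udim_def)
    then obtain u where u: "u \<in> colvecs (udim n W a)" "transit n W a b * u = w" using S by blast
    \<comment> \<open>The general solution inside the support: the particular one plus the
      propagated initial value u.\<close>
    define h where "h x = (if a < x \<and> x \<le> b then ?p (x - Suc a) + path_map W (Suc a) (x - Suc a) * u else 0\<^sub>m (vdim W x) 0)" for x
    have hc: "h x \<in> carrier_mat (vdim W x) (if a < x \<and> x \<le> b then 1 else 0)" if "1 \<le> x" "x \<le> n" for x
      using that p[of "x - Suc a"] path_map_dims[OF W, of "Suc a" "x - Suc a"] u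
        by (auto intro!: carrier_matI simp: h_def)
    have step: "vmap W x * h x + \<phi> x = ?p (x - a) + path_map W (Suc a) (x - a) * u" if x: "a < x" "x \<le> b" "x < n" for x
    proof -
      have e: "x - a = Suc (x - Suc a)" "Suc (a + (x - Suc a)) = x" using x by auto
      have d: "dim_row (vmap W x) = vdim W (Suc x)" "dim_col (vmap W x) = vdim W x"
        using is_repD[OF W, of x] x by auto
      have pc: "?p (x - Suc a) \<in> colvecs (vdim W x)" using p[of "x - Suc a"] x e by auto
      have pp: "path_map W (Suc a) (x - Suc a) \<in> carrier_mat (vdim W x) (vdim W (Suc a))"
        using path_map_dims[OF W, of "Suc a" "x - Suc a"] x by (intro carrier_matI) auto
      have uc: "u \<in> colvecs (vdim W (Suc a))" using u x by (simp add: udim_def)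
      have \<phi>c: "\<phi> x \<in> colvecs (vdim W (Suc x))" using phi[of x] x by simp
      have "vmap W x * h x + \<phi> x = vmap W x * ?p (x - Suc a) + vmap W x * (path_map W (Suc a) (x - Suc a) * u) + \<phi> x"
        unfolding h_def using x pc pp uc d by (simp add: mat_mult_add)
      also have "\<dots> = (vmap W x * ?p (x - Suc a) + \<phi> x) + vmap W x * (path_map W (Suc a) (x - Suc a) * u)"
        by (rule mat_ext[of _ "vdim W (Suc x)" 1])
          (use d pc pp uc \<phi>c in \<open>auto intro!: carrier_matI simp del: index_mult_mat(1)\<close>)
      also have "\<dots> = ?p (x - a) + path_map W (Suc a) (x - a) * u"
        unfolding e(1) using e(2) d pp uc by (simp add: mat_mult_assoc)
      finally show ?thesis .
    qed
    have "\<phi> x = h (Suc x) * vmap (interval_rep a b) x - vmap W x * h x" if x: "1 \<le> x" "x < n" for x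
    proof (cases "a < x \<and> x \<le> b")
      case False
      then show ?thesis using phi[OF x] hc[of x] hc[of "Suc x"] x is_repD[OF W x]
        by (intro eq_matI) (auto simp: interval_rep_simps)
    next
      case True
      have d: "dim_row (vmap W x) = vdim W (Suc x)" "dim_col (vmap W x) = vdim W x" using is_repD[OF W x]
        by auto
      have hx: "h x \<in> colvecs (vdim W x)" using hc[of x] x True by simp
      have \<phi>c: "\<phi> x \<in> colvecs (vdim W (Suc x))" using phi[of x] x True by simp
      have e: "h (Suc x) * vmap (interval_rep a b) x = vmap W x * h x + \<phi> x"
      proof (cases "x = b")
        case False
        then have "h (Suc x) = vmap W x * h x + \<phi> x" using step[of x] True x by (simp add: h_def)
        moreover have "vmap W x * h x + \<phi> x \<in> colvecs (vdim W (Suc x))"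
          using d hx \<phi>c by (auto intro!: carrier_matI)
        then have "(vmap W x * h x + \<phi> x) * 1\<^sub>m 1 = vmap W x * h x + \<phi> x"
          by (rule right_mult_one_mat)
        ultimately show ?thesis using False True by (simp add: interval_rep_simps)
      next
        case xb: True
        have "h (Suc x) * vmap (interval_rep a b) x = 0\<^sub>m (vdim W (Suc x)) 1"
          using xb ab by (simp add: h_def interval_rep_simps mat_mult_zero)
        moreover have "vmap W x * h x + \<phi> x = ?p (b - a) + - ?p (b - a)"
          using step[of x] xb x ab u(2) by (simp add: transit_def w_def)
        moreover have "?p (b - a) \<in> colvecs (vdim W (Suc x))" using p[of "b - a"] ab xb x by simp
        ultimately show ?thesis by (auto intro!: eq_matI)
      qed
      show ?thesis unfolding e using d hx \<phi>c by (intro eq_matI) auto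
    qed
    then show "\<exists>h. (\<forall>x. 1 \<le> x \<longrightarrow> x \<le> n \<longrightarrow> h x \<in> homs (interval_rep a b :: 'k rep) W x) \<and>
      (\<forall>x. 1 \<le> x \<longrightarrow> x < n \<longrightarrow> \<phi> x = h (Suc x) * vmap (interval_rep a b) x - vmap W x * h x)"
      using hc by (intro exI[of _ h]) (simp add: interval_rep_simps)
  qed
qed

definition transit_bij :: "nat \<Rightarrow> 'k::field rep \<Rightarrow> nat \<Rightarrow> nat \<Rightarrow> bool" where
  "transit_bij n W a b \<longleftrightarrow> bij_betw ((*) (transit n W a b)) (colvecs (udim n W a)) (colvecs (udim n W b))"

lemma perp_interval_iff:
  fixes W :: "'k::field rep"
  assumes ab: "a < b" "b \<le> n"
  shows "W \<in> perp n (interval_rep a b) \<longleftrightarrow> is_rep n W \<and> transit_bij n W a b"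
proof (cases "is_rep n W")
  case W: True
  let ?T = "transit n W a b"
  note d = transit_dims[OF W less_imp_le[OF ab(1)] ab(2)]
  have into: "?T * u \<in> colvecs (udim n W b)" if "u \<in> colvecs (udim n W a)" for u
    by (rule transit_colvecs[OF W less_imp_le[OF ab(1)] ab(2) that])
  have inj: "inj_on ((*) ?T) (colvecs (udim n W a)) \<longleftrightarrow>
    (\<forall>u\<in>colvecs (udim n W a). ?T * u = 0\<^sub>m (udim n W b) 1 \<longrightarrow> u = 0\<^sub>m (udim n W a) 1)" (is "?i \<longleftrightarrow> ?k")
  proof
    assume i: ?i
    have "?T * 0\<^sub>m (udim n W a) 1 = 0\<^sub>m (udim n W b) 1" using d by (simp add: mat_mult_zero)
    then show ?k using inj_onD[OF i, of _ "0\<^sub>m (udim n W a) 1"] by simp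
  next
    assume k: ?k
    show ?i
    proof (rule inj_onI)
      fix u v assume uv: "u \<in> colvecs (udim n W a)" "v \<in> colvecs (udim n W a)" "?T * u = ?T * v"
      have "?T * (u - v) = ?T * u - ?T * v" by (rule mat_mult_minus) (use uv d in auto)
      also have "\<dots> = 0\<^sub>m (udim n W b) 1" unfolding uv(3) using into[OF uv(2)]
        by (rule minus_r_inv_mat)
      finally have "?T * (u - v) = 0\<^sub>m (udim n W b) 1" .
      moreover have "u - v \<in> colvecs (udim n W a)" by (rule minus_carrier_mat[OF uv(2)])
      ultimately have "0\<^sub>m (udim n W a) 1 = u - v" using k by metis
      with uv(1,2) show "u = v" by (rule mat_minus_zeroD)
    qed
  qed
  have surj: "(*) ?T ` colvecs (udim n W a) = colvecs (udim n W b) \<longleftrightarrow>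
    (\<forall>w\<in>colvecs (udim n W b). \<exists>u\<in>colvecs (udim n W a). ?T * u = w)"
  proof
    assume e: "(*) ?T ` colvecs (udim n W a) = colvecs (udim n W b)"
    show "\<forall>w\<in>colvecs (udim n W b). \<exists>u\<in>colvecs (udim n W a). ?T * u = w"
      unfolding e[symmetric] by blast
  next
    assume *: "\<forall>w\<in>colvecs (udim n W b). \<exists>u\<in>colvecs (udim n W a). ?T * u = w"
    show "(*) ?T ` colvecs (udim n W a) = colvecs (udim n W b)"
    proof (intro equalityI subsetI)
      fix w :: "'k mat"
      assume w: "w \<in> colvecs (udim n W b)"
      show "w \<in> (*) ?T ` colvecs (udim n W a)"
      proof (rule bexE[OF bspec[OF * w]])
        fix u assume "u \<in> colvecs (udim n W a)" "?T * u = w"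
        then show ?thesis by (intro image_eqI[of w _ u]) simp_all
      qed
    next
      fix w :: "'k mat"
      assume "w \<in> (*) ?T ` colvecs (udim n W a)"
      then show "w \<in> colvecs (udim n W b)" using into by (elim imageE) simp
    qed
  qed
  show ?thesis
    unfolding perp_iff[OF interval_is_rep] Hom_zero_interval_iff[OF W ab] cocycles_split_interval_iff[OF W ab]
      transit_bij_def bij_betw_def inj surj ..
qed (simp add: perp_def)

section \<open>Perpendicularity between interval modules\<close>

lemma interval_udim: "d \<le> n \<Longrightarrow> udim n (interval_rep c d) a = (if a \<in> {c..<d} then 1 else 0)"
  by (auto simp: udim_def interval_rep_simps)

lemma interval_path_map: "c \<le> a \<Longrightarrow> a + k < d \<Longrightarrow> path_map (interval_rep c d) (Suc a) k = 1\<^sub>m 1"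
  by (induction k) (auto simp: interval_rep_simps)

lemma interval_transit: "a \<le> b \<Longrightarrow> d \<le> n \<Longrightarrow> c \<le> a \<Longrightarrow> b < d \<Longrightarrow> transit n (interval_rep c d) a b = 1\<^sub>m 1"
  by (simp add: transit_def interval_path_map)

text \<open>The shift of vertices turns the support \<open>(c, d]\<close> into
  \<open>[c, d)\<close>. With both points inside, the map is the identity; with exactly one inside,
  the dimensions differ; with both outside, the spaces are zero.\<close>

lemma interval_transit_bij_iff:
  assumes "a < b" "b \<le> n" "d \<le> n"
  shows "transit_bij n (interval_rep c d :: 'k::field rep) a b \<longleftrightarrow> (a \<in> {c..<d} \<longleftrightarrow> b \<in> {c..<d})"
proof -
  let ?W = "interval_rep c d :: 'k rep"
  let ?A = "a \<in> {c..<d}" and ?B = "b \<in> {c..<d}"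
  have udim: "udim n ?W a = (if ?A then 1 else 0)" "udim n ?W b = (if ?B then 1 else 0)"
    by (rule interval_udim[OF assms(3)])+
  have td: "dim_row (transit n ?W a b) = (if ?B then 1 else 0)" "dim_col (transit n ?W a b) = (if ?A then 1 else 0)"
    by (simp_all add: transit_dims[OF interval_is_rep less_imp_le[OF assms(1)] assms(2)] udim)
  have c0: "colvecs 0 = {0\<^sub>m 0 1 :: 'k mat}" by (auto intro!: eq_matI)
  have ne: "(1\<^sub>m 1 :: 'k mat) \<noteq> 0\<^sub>m 1 1"
    by (auto dest!: arg_cong[of _ _ "\<lambda>M. M $$ (0, 0)"])
  consider "?A" "?B" | "\<not> ?A" "\<not> ?B" | "?A" "\<not> ?B" | "\<not> ?A" "?B" by blast
  then show ?thesis
  proof cases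
    case 1
    have "transit n ?W a b = 1\<^sub>m 1" using 1 assms by (intro interval_transit) auto
    moreover have "bij_betw ((*) (1\<^sub>m 1)) (colvecs 1) (colvecs 1 :: 'k mat set)"
      by (rule bij_betw_cong[THEN iffD1, OF _ bij_betw_id]) auto
    ultimately show ?thesis using 1 unfolding transit_bij_def udim by simp
  next
    case 2
    then have "transit n ?W a b * 0\<^sub>m 0 1 = 0\<^sub>m 0 1" using td by (auto intro!: eq_matI)
    then show ?thesis using 2(1,2)
      unfolding transit_bij_def udim if_not_P[OF 2(1)] if_not_P[OF 2(2)] c0 bij_betw_def
      by auto
  next
    case 3
    have "transit n ?W a b * 1\<^sub>m 1 = transit n ?W a b * 0\<^sub>m 1 1" using td 3
      by (auto intro!: eq_matI)
    then have "\<not> inj_on ((*) (transit n ?W a b)) (colvecs 1)"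
      using ne by (auto dest: inj_onD[of _ _ "1\<^sub>m 1" "0\<^sub>m 1 1"])
    then show ?thesis using 3 unfolding transit_bij_def udim bij_betw_def by simp
  next
    case 4
    have "(*) (transit n ?W a b) ` colvecs 0 \<noteq> colvecs 1"
    proof
      assume *: "(*) (transit n ?W a b) ` colvecs 0 = colvecs 1"
      have "(1\<^sub>m 1 :: 'k mat) \<in> colvecs 1" "(0\<^sub>m 1 1 :: 'k mat) \<in> colvecs 1" by auto
      then show False using ne unfolding *[symmetric] c0 by auto
    qed
    then show ?thesis using 4 unfolding transit_bij_def udim if_not_P[OF 4(1)] if_P[OF 4(2)] bij_betw_def
      by auto
  qed
qed

subsection \<open>Indecomposable modules are interval modules\<close>

text \<open>Isomorphic modules have equal support, which is enough to tell interval modules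
  apart.\<close>

lemma rep_iso_vdim_zero_iff:
  assumes "rep_iso n V W" "1 \<le> x" "x \<le> n"
  shows "vdim V x = 0 \<longleftrightarrow> vdim W x = 0"
proof -
  obtain f g where fg: "rep_hom n V W f" "rep_hom n W V g"
    and e: "g x * f x = 1\<^sub>m (vdim V x)" "f x * g x = 1\<^sub>m (vdim W x)"
    using assms unfolding rep_iso_def by auto
  note d = rep_homD[OF fg(1) assms(2,3)] rep_homD[OF fg(2) assms(2,3)]
  show ?thesis
  proof
    assume "vdim V x = 0"
    then have "f x * g x = 0\<^sub>m (vdim W x) (vdim W x)" using d by (simp add: mat_mult_dim0)
    then have *: "(1\<^sub>m (vdim W x) :: 'a mat) = 0\<^sub>m (vdim W x) (vdim W x)" using e by simp
    show "vdim W x = 0" using arg_cong[OF *, of "\<lambda>M. M $$ (0, 0)"] by (cases "vdim W x") auto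
  next
    assume "vdim W x = 0"
    then have "g x * f x = 0\<^sub>m (vdim V x) (vdim V x)" using d by (simp add: mat_mult_dim0)
    then have *: "(1\<^sub>m (vdim V x) :: 'a mat) = 0\<^sub>m (vdim V x) (vdim V x)" using e by simp
    show "vdim V x = 0" using arg_cong[OF *, of "\<lambda>M. M $$ (0, 0)"] by (cases "vdim V x") auto
  qed
qed

lemma rep_iso_interval_unique:
  assumes "rep_iso n E (interval_rep a b)" "rep_iso n E (interval_rep c d)"
    and "a < b" "b \<le> n" "c < d" "d \<le> n"
  shows "a = c" "b = d"
proof -
  have *: "(a < x \<and> x \<le> b) \<longleftrightarrow> (c < x \<and> x \<le> d)" if "1 \<le> x" "x \<le> n" for x
    using rep_iso_vdim_zero_iff[OF assms(1) that] rep_iso_vdim_zero_iff[OF assms(2) that]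
    by (auto simp: interval_rep_simps split: if_splits)
  show "a = c" using *[of "Suc a"] *[of "Suc c"] assms(3-6) by auto
  show "b = d" using *[of b] *[of d] assms(3-6) by auto
qed

section \<open>Retracts are direct summands\<close>

lemma inverse_rep_hom:
  assumes V: "is_rep n V" and W: "is_rep n W" and f: "rep_hom n V W f"
    and g: "\<And>x. 1 \<le> x \<Longrightarrow> x \<le> n \<Longrightarrow> g x \<in> homs W V x"
    and gf: "\<And>x. 1 \<le> x \<Longrightarrow> x \<le> n \<Longrightarrow> g x * f x = 1\<^sub>m (vdim V x)"
    and fg: "\<And>x. 1 \<le> x \<Longrightarrow> x \<le> n \<Longrightarrow> f x * g x = 1\<^sub>m (vdim W x)"
  shows "rep_hom n W V g"
proof (rule rep_homI[OF g])
  fix x assume x: "1 \<le> x" "x < n"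
  then have x': "1 \<le> Suc x" "Suc x \<le> n" "x \<le> n" by auto
  note d = carrier_matD[OF g[OF x(1) x'(3)]] carrier_matD[OF g[OF x'(1,2)]]
    rep_homD[OF f x(1) x'(3)] rep_homD[OF f x'(1,2)] is_repD[OF V x] is_repD[OF W x]
  have "g (Suc x) * vmap W x = g (Suc x) * (vmap W x * (f x * g x))"
    unfolding fg[OF x(1) x'(3)] by (simp add: right_mult_one_mat' d)
  also have "vmap W x * (f x * g x) = f (Suc x) * (vmap V x * g x)"
    by (rule rep_hom_commute_assoc[OF f V W x, symmetric]) (simp add: d)
  also have "g (Suc x) * (f (Suc x) * (vmap V x * g x)) = vmap V x * g x"
    by (rule mat_one_assoc[OF gf[OF x'(1,2)]]) (simp_all add: d)
  finally show "g (Suc x) * vmap W x = vmap V x * g x" .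
qed

text \<open>Passing from s to s' gives \<open>r * s' = 0\<close> and keeps
  \<open>\<pi> * s' = 1\<close>, so that r and \<pi> together are inverse to \<iota> and s'
  together.\<close>

lemma split_matrix:
  fixes \<iota> r \<pi> s t :: "'k::field mat"
  assumes c: "\<iota> \<in> carrier_mat d m" "r \<in> carrier_mat m d" "\<pi> \<in> carrier_mat k d" "s \<in> carrier_mat d k" "t \<in> carrier_mat m d"
    and r\<iota>: "r * \<iota> = 1\<^sub>m m" and \<pi>\<iota>: "\<pi> * \<iota> = 0\<^sub>m k m"
      and \<pi>s: "\<pi> * s = 1\<^sub>m k" and st: "s * \<pi> + \<iota> * t = 1\<^sub>m d"
  defines "s' \<equiv> s - \<iota> * (r * s)"
  shows "(inc1 m k * r + inc2 m k * \<pi>) * (\<iota> * pr1 m k + s' * pr2 m k) = 1\<^sub>m (m + k)"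
    and "(\<iota> * pr1 m k + s' * pr2 m k) * (inc1 m k * r + inc2 m k * \<pi>) = 1\<^sub>m d"
    and "\<iota> * r + s' * \<pi> = 1\<^sub>m d"
proof -
  note D = c[THEN carrier_matD(1)] c[THEN carrier_matD(2)]
  have r\<iota>': "r * (\<iota> * Z) = Z" if "dim_row Z = m" for Z
    by (rule mat_one_assoc[OF r\<iota>]) (simp_all add: D that)
  have \<pi>\<iota>': "\<pi> * (\<iota> * Z) = 0\<^sub>m k (dim_col Z)" if "dim_row Z = m" for Z
    by (rule mat_zero_assoc[OF \<pi>\<iota>]) (simp_all add: D that)
  have s': "s' \<in> carrier_mat d k" using c by (auto intro!: carrier_matI simp: s'_def)
  note D' = D carrier_matD[OF s']
  have "r * s' = r * s - r * (\<iota> * (r * s))" unfolding s'_def by (rule mat_mult_minus) (simp_all add: D)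
  also have "\<dots> = 0\<^sub>m m k" using r\<iota>'[of "r * s"] c by (auto intro!: eq_matI simp: D)
  finally have rs: "r * s' = 0\<^sub>m m k" .
  have "\<pi> * s' = \<pi> * s - \<pi> * (\<iota> * (r * s))" unfolding s'_def
    by (rule mat_mult_minus) (simp_all add: D)
  also have "\<dots> = 1\<^sub>m k" using \<pi>\<iota>'[of "r * s"] \<pi>s by (auto intro!: eq_matI simp: D)
  finally have ps: "\<pi> * s' = 1\<^sub>m k" .
  have "r * (s * \<pi>) + r * (\<iota> * t) = r"
  proof -
    have "r * (s * \<pi> + \<iota> * t) = r" unfolding st using c by simp
    then show ?thesis by (simp add: mat_mult_add D)
  qed
  then have rsp: "r * (s * \<pi>) + t = r" using r\<iota>'[of t] D by simp
  have "\<iota> * (r * (s * \<pi>)) + \<iota> * t = \<iota> * r"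
  proof -
    have "\<iota> * (r * (s * \<pi>) + t) = \<iota> * r" unfolding rsp ..
    then show ?thesis by (simp add: mat_mult_add D)
  qed
  then have e: "\<iota> * r = \<iota> * (r * (s * \<pi>)) + \<iota> * t" ..
  have "s' * \<pi> = s * \<pi> - \<iota> * (r * (s * \<pi>))" unfolding s'_def
    by (simp add: mat_minus_mult mat_mult_assoc D)
  then have "\<iota> * r + s' * \<pi> = (\<iota> * (r * (s * \<pi>)) + \<iota> * t) + (s * \<pi> - \<iota> * (r * (s * \<pi>)))" unfolding e by simp
  also have "\<dots> = s * \<pi> + \<iota> * t"
    by (rule mat_ext[of _ d d]) (auto intro!: carrier_matI simp: D simp del: index_mult_mat(1))
  finally show 3: "\<iota> * r + s' * \<pi> = 1\<^sub>m d" using st by simp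
  have pr_inc': "pr1 m k * (inc1 m k * Z) = Z" "pr2 m k * (inc1 m k * Z) = 0\<^sub>m k (dim_col Z)" if "dim_row Z = m" for Z :: "'k mat"
    by (rule mat_one_assoc[OF pr_inc(1)] mat_zero_assoc[OF pr_inc(4)]; simp add: that)+
  have pr_inc'': "pr2 m k * (inc2 m k * Z) = Z" "pr1 m k * (inc2 m k * Z) = 0\<^sub>m m (dim_col Z)" if "dim_row Z = k" for Z :: "'k mat"
    by (rule mat_one_assoc[OF pr_inc(2)] mat_zero_assoc[OF pr_inc(3)]; simp add: that)+
  have q1: "r * (\<iota> * pr1 m k + s' * pr2 m k) = pr1 m k"
  proof -
    have "r * (s' * pr2 m k) = 0\<^sub>m m (dim_col (pr2 m k :: 'k mat))"
      by (rule mat_zero_assoc[OF rs]) (simp_all add: D')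
    then have "r * (\<iota> * pr1 m k + s' * pr2 m k) = pr1 m k + 0\<^sub>m m (m + k)"
      using r\<iota>'[of "pr1 m k"] by (simp add: mat_mult_add D')
    then show ?thesis by (simp add: carrier_matI)
  qed
  have q2: "\<pi> * (\<iota> * pr1 m k + s' * pr2 m k) = pr2 m k"
  proof -
    have "\<pi> * (s' * pr2 m k) = pr2 m k" by (rule mat_one_assoc[OF ps]) (simp_all add: D')
    then have "\<pi> * (\<iota> * pr1 m k + s' * pr2 m k) = 0\<^sub>m k (m + k) + pr2 m k"
      using \<pi>\<iota>'[of "pr1 m k"] by (simp add: mat_mult_add D')
    then show ?thesis by (simp add: carrier_matI)
  qed
  have "(inc1 m k * r + inc2 m k * \<pi>) * (\<iota> * pr1 m k + s' * pr2 m k)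
    = inc1 m k * (r * (\<iota> * pr1 m k + s' * pr2 m k)) + inc2 m k * (\<pi> * (\<iota> * pr1 m k + s' * pr2 m k))"
    by (subst mat_add_mult; (subst mat_mult_assoc)?; (subst mat_mult_assoc)?; simp add: D')
  then show "(inc1 m k * r + inc2 m k * \<pi>) * (\<iota> * pr1 m k + s' * pr2 m k) = 1\<^sub>m (m + k)"
    unfolding q1 q2 inc_pr_sum .
  have q3: "pr1 m k * (inc1 m k * r + inc2 m k * \<pi>) = r"
  proof -
    have "pr1 m k * (inc1 m k * r + inc2 m k * \<pi>) = r + 0\<^sub>m m d"
      using pr_inc'(1)[of r] pr_inc''(2)[of \<pi>] by (simp add: mat_mult_add D')
    then show ?thesis using c by simp
  qed
  have q4: "pr2 m k * (inc1 m k * r + inc2 m k * \<pi>) = \<pi>"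
  proof -
    have "pr2 m k * (inc1 m k * r + inc2 m k * \<pi>) = 0\<^sub>m k d + \<pi>"
      using pr_inc'(2)[of r] pr_inc''(1)[of \<pi>] by (simp add: mat_mult_add D')
    then show ?thesis using c by simp
  qed
  have "(\<iota> * pr1 m k + s' * pr2 m k) * (inc1 m k * r + inc2 m k * \<pi>)
    = \<iota> * (pr1 m k * (inc1 m k * r + inc2 m k * \<pi>)) + s' * (pr2 m k * (inc1 m k * r + inc2 m k * \<pi>))"
    by (subst mat_add_mult; (subst mat_mult_assoc)?; (subst mat_mult_assoc)?; simp add: D')
  then show "(\<iota> * pr1 m k + s' * pr2 m k) * (inc1 m k * r + inc2 m k * \<pi>) = 1\<^sub>m d"
    unfolding q3 q4 3 .
qed

text \<open>The complement is the cokernel of \<iota>. When it is zero at every vertex, \<iota> and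
  r are themselves inverse to each other, which gives an isomorphism with M instead of with a
  sum.\<close>

lemma retract_is_summand:
  fixes V M :: "'k::field rep"
  assumes ret: "retraction n M V \<iota> r"
  shows "\<exists>Z. is_rep n Z \<and> rep_iso n V (direct_sum M Z) \<and>
    (\<not> nonzero_rep n Z \<longrightarrow> rep_iso n V M)"
proof -
  note R = retractionD[OF ret]
  obtain Z \<pi> s t where Z: "is_rep n Z" and p: "rep_hom n V Z \<pi>" and
    st: "\<forall>x\<in>{1..n}. s x \<in> homs Z V x \<and> t x \<in> homs V M x \<and>
      \<pi> x * \<iota> x = 0\<^sub>m (vdim Z x) (vdim M x) \<and> \<pi> x * s x = 1\<^sub>m (vdim Z x) \<and>
      s x * \<pi> x + \<iota> x * t x = 1\<^sub>m (vdim V x)"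
    using cokernel_rep[OF R(1,2,3)] by blast
  let ?S = "direct_sum M Z"
  define s' where "s' x = s x - \<iota> x * (r x * s x)" for x
  define f where "f x = inc1 (vdim M x) (vdim Z x) * r x + inc2 (vdim M x) (vdim Z x) * \<pi> x" for x
  define g where "g x = \<iota> x * pr1 (vdim M x) (vdim Z x) + s' x * pr2 (vdim M x) (vdim Z x)" for x
  have S: "is_rep n ?S" by (rule direct_sum_is_rep[OF R(1) Z])
  have spl: "f x * g x = 1\<^sub>m (vdim ?S x)" "g x * f x = 1\<^sub>m (vdim V x)" "\<iota> x * r x + s' x * \<pi> x = 1\<^sub>m (vdim V x)"
    if x: "1 \<le> x" "x \<le> n" for x
  proof -
    have c: "\<iota> x \<in> homs M V x" "r x \<in> homs V M x"
      "\<pi> x \<in> homs V Z x"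
      using rep_homD[OF R(3) x] rep_homD[OF R(4) x] rep_homD[OF p x] by auto
    have st': "s x \<in> homs Z V x" "t x \<in> homs V M x"
      "\<pi> x * \<iota> x = 0\<^sub>m (vdim Z x) (vdim M x)" "\<pi> x * s x = 1\<^sub>m (vdim Z x)"
      "s x * \<pi> x + \<iota> x * t x = 1\<^sub>m (vdim V x)" using st x by auto
    note sm = split_matrix[OF c st'(1,2) R(5)[OF x] st'(3-5)]
    show "f x * g x = 1\<^sub>m (vdim ?S x)" "g x * f x = 1\<^sub>m (vdim V x)" "\<iota> x * r x + s' x * \<pi> x = 1\<^sub>m (vdim V x)"
      using sm unfolding f_def g_def s'_def by (simp_all add: direct_sum_vdim[OF R(1) Z])
  qed
  have f: "rep_hom n V ?S f"
  proof (rule rep_homI)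
    fix x assume x: "1 \<le> x" "x \<le> n"
    show "f x \<in> homs V ?S x"
      using rep_homD[OF p x] by (auto intro!: carrier_matI simp: f_def direct_sum_vdim[OF R(1) Z])
  next
    fix x assume x: "1 \<le> x" "x < n"
    then have x': "1 \<le> Suc x" "Suc x \<le> n" "x \<le> n" by auto
    note d = rep_homD[OF R(4) x(1) x'(3)] rep_homD[OF R(4) x'(1,2)] rep_homD[OF p x(1) x'(3)] rep_homD[OF p x'(1,2)]
      is_repD[OF R(1) x] is_repD[OF R(2) x] is_repD[OF Z x] is_repD[OF S x, unfolded direct_sum_vdim[OF R(1) Z]]
    let ?i1 = "inc1 (vdim M (Suc x)) (vdim Z (Suc x)) :: 'k mat"
      and ?i2 = "inc2 (vdim M (Suc x)) (vdim Z (Suc x)) :: 'k mat"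
    have "f (Suc x) * vmap V x = ?i1 * (r (Suc x) * vmap V x) + ?i2 * (\<pi> (Suc x) * vmap V x)"
      unfolding f_def by (simp add: mat_add_mult mat_mult_assoc d)
    also have "\<dots> = ?i1 * (vmap M x * r x) + ?i2 * (vmap Z x * \<pi> x)"
      unfolding rep_hom_commute[OF R(4) x] rep_hom_commute[OF p x] ..
    also have "?i1 * (vmap M x * r x) = vmap ?S x * (inc1 (vdim M x) (vdim Z x) * r x)"
      by (rule mat_eq_assoc[OF direct_sum_vmap(1)[OF R(1) Z x, symmetric]]) (simp_all add: d)
    also have "?i2 * (vmap Z x * \<pi> x) = vmap ?S x * (inc2 (vdim M x) (vdim Z x) * \<pi> x)"
      by (rule mat_eq_assoc[OF direct_sum_vmap(2)[OF R(1) Z x, symmetric]]) (simp_all add: d)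
    also have "vmap ?S x * (inc1 (vdim M x) (vdim Z x) * r x) + vmap ?S x * (inc2 (vdim M x) (vdim Z x) * \<pi> x) = vmap ?S x * f x"
      unfolding f_def by (rule mat_mult_add[symmetric]) (simp_all add: d)
    finally show "f (Suc x) * vmap V x = vmap ?S x * f x" .
  qed
  have g: "rep_hom n ?S V g"
  proof (rule inverse_rep_hom[OF R(2) S f _ spl(2) spl(1)])
    fix x assume x: "1 \<le> x" "x \<le> n"
    have "dim_row (s x) = vdim V x" "dim_col (s x) = vdim Z x" using st x by auto
    then show "g x \<in> homs ?S V x"
      using rep_homD[OF R(3) x] by (auto intro!: carrier_matI simp: g_def s'_def direct_sum_vdim[OF R(1) Z])
  qed
  have "rep_iso n V ?S" unfolding rep_iso_def
    using f g spl(1,2) by (intro exI[of _ f] exI[of _ g]) auto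
  moreover have "rep_iso n V M" if nz: "\<not> nonzero_rep n Z"
  proof -
    have "\<iota> x * r x = 1\<^sub>m (vdim V x)" if x: "1 \<le> x" "x \<le> n" for x
    proof -
      have z: "vdim Z x = 0" using nz x unfolding nonzero_rep_def by auto
      have d: "dim_row (s' x) = vdim V x" "dim_row (\<iota> x) = vdim V x" "dim_col (r x) = vdim V x"
        using rep_homD[OF R(3) x] rep_homD[OF R(4) x] by (auto simp: s'_def)
      have "s' x * \<pi> x = 0\<^sub>m (vdim V x) (vdim V x)"
        using rep_homD[OF p x] z d by (simp add: mat_mult_dim0)
      then have "\<iota> x * r x + 0\<^sub>m (vdim V x) (vdim V x) = 1\<^sub>m (vdim V x)" using spl(3)[OF x]
        by simp
      moreover have "\<iota> x * r x + 0\<^sub>m (vdim V x) (vdim V x) = \<iota> x * r x"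
        by (rule right_add_zero_mat) (auto intro!: carrier_matI simp: d)
      ultimately show ?thesis by simp
    qed
    then show ?thesis using R(3-5) unfolding rep_iso_def
      by (intro exI[of _ r] exI[of _ \<iota>]) auto
  qed
  ultimately show ?thesis using Z by blast
qed

text \<open>An indecomposable module is split off by an interval module: take the least vertex of the
  support and the longest nonzero path leaving it; the absence of smaller vertices in the support
  is what allows a retraction.\<close>

lemma interval_retract:
  fixes V :: "'k::field rep"
  assumes V: "is_rep n V" and nz: "nonzero_rep n V"
  shows "\<exists>a b \<iota> r. a < b \<and> b \<le> n \<and> retraction n (interval_rep a b) V \<iota> r"
proof -
  define z where "z = (LEAST x. 1 \<le> x \<and> x \<le> n \<and> vdim V x \<noteq> 0)"
  have ex: "\<exists>x. 1 \<le> x \<and> x \<le> n \<and> vdim V x \<noteq> 0" using nz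
    unfolding nonzero_rep_def by auto
  have z: "1 \<le> z" "z \<le> n" "vdim V z \<noteq> 0" using LeastI_ex[OF ex] unfolding z_def by auto
  have z_least: "vdim V x = 0" if "1 \<le> x" "x < z" for x
    using not_less_Least[of x "\<lambda>x. 1 \<le> x \<and> x \<le> n \<and> vdim V x \<noteq> 0"] that z
      unfolding z_def by auto
  define a where "a = z - 1"
  have az: "Suc a = z" using z by (simp add: a_def)
  \<comment> \<open>The vertices that a nonzero path map from z reaches.\<close>
  define B where "B = {b. a < b \<and> b \<le> n \<and> path_map V z (b - z) \<noteq> 0\<^sub>m (vdim V b) (vdim V z)}"
  have "z \<in> B"
  proof -
    have "(1\<^sub>m (vdim V z) :: 'k mat) \<noteq> 0\<^sub>m (vdim V z) (vdim V z)"
      using z(3) by (auto dest!: arg_cong[of _ _ "\<lambda>M. M $$ (0, 0)"])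
    then show ?thesis using z az by (auto simp: B_def)
  qed
  have finB: "finite B" by (rule finite_subset[of _ "{..n}"]) (auto simp: B_def)
  define b where "b = Max B"
  have "b \<in> B" unfolding b_def using finB \<open>z \<in> B\<close> by (metis Max_in empty_iff)
  then have ab: "a < b" "b \<le> n" and P0: "path_map V z (b - z) \<noteq> 0\<^sub>m (vdim V b) (vdim V z)"
    unfolding B_def by auto
  have bmax: "c \<le> b" if "c \<in> B" for c unfolding b_def using finB that by (rule Max_ge)
  let ?P = "path_map V z (b - z)"
  have P: "?P \<in> carrier_mat (vdim V b) (vdim V z)"
    using path_map_dims[OF V z(1), of "b - z"] ab az by (intro carrier_matI) auto
  obtain p q where pq: "p < vdim V b" "q < vdim V z" "?P $$ (p, q) \<noteq> 0"
  proof -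
    have "\<exists>p<vdim V b. \<exists>q<vdim V z. ?P $$ (p, q) \<noteq> 0"
    proof (rule ccontr)
      assume *: "\<not> ?thesis"
      have "?P = 0\<^sub>m (vdim V b) (vdim V z)" by (rule mat_ext[OF P]) (use * in auto)
      then show False using P0 by simp
    qed
    then show thesis using that by blast
  qed
  \<comment> \<open>u is a basis vector and l a scaled coordinate, taken at a nonzero entry of the
    path map so that \<open>l * (?P * u) = 1\<close>.\<close>
  define u where "u = mat (vdim V z) 1 (\<lambda>(i, j). if i = q then 1 else 0 :: 'k)"
  define l where "l = mat 1 (vdim V b) (\<lambda>(i, j). if j = p then 1 / ?P $$ (p, q) else 0)"
  have u: "u \<in> colvecs (vdim V z)" by (simp add: u_def)
  have l: "l \<in> carrier_mat 1 (vdim V b)" by (simp add: l_def)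
  have Pu: "?P * u = mat (vdim V b) 1 (\<lambda>(i, j). ?P $$ (i, q))"
    unfolding u_def by (rule mult_select_cols[OF P, of 1 "\<lambda>_. q"]) (use pq in auto)
  have lPu: "l * (?P * u) = 1\<^sub>m 1"
  proof (rule mat_ext[of _ 1 1])
    fix i j assume ij: "i < (1::nat)" "j < (1::nat)"
    have "(l * (?P * u)) $$ (i, j) = (\<Sum>k = 0..<vdim V b. (if k = p then 1 / ?P $$ (p, q) else 0) * ?P $$ (k, q))"
      using ij unfolding Pu by (auto simp: l_def scalar_prod_def intro!: sum.cong)
    also have "\<dots> = (\<Sum>k = 0..<vdim V b. if k = p then 1 / ?P $$ (p, q) * ?P $$ (k, q) else 0)"
      by (intro sum.cong) auto
    also have "\<dots> = 1" using pq by simp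
    finally show "(l * (?P * u)) $$ (i, j) = 1\<^sub>m 1 $$ (i, j)" using ij by simp
  qed (use l Pu in \<open>auto intro!: carrier_matI\<close>)
  let ?M = "interval_rep a b :: 'k rep"
  have ua: "u \<in> colvecs (udim n V a)" using u az ab by (simp add: udim_def)
  have "transit n V a b * u = 0\<^sub>m (udim n V b) 1"
  proof (cases "b < n")
    case True
    \<comment> \<open>By maximality of b the path map to b + 1 is zero, so u satisfies the relation
      of the generator.\<close>
    have "Suc b \<notin> B" using bmax[of "Suc b"] by auto
    then have "path_map V z (Suc b - z) = 0\<^sub>m (vdim V (Suc b)) (vdim V z)" using True ab
      unfolding B_def by auto
    then show ?thesis using True az u by (auto simp: transit_def udim_def mat_zero_mult)
  next
    case False
    then show ?thesis using ua by (auto simp: transit_def udim_def mat_zero_mult)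
  qed
  then have \<iota>: "rep_hom n ?M V (interval_hom V a b u)" by (rule interval_hom_rep_hom[OF V ab ua])
  \<comment> \<open>Follow the path to b and evaluate l there. This commutes with the arrows inside
    the support by construction.\<close>
  define r where "r x = (if a < x \<and> x \<le> b then l * path_map V x (b - x) else 0\<^sub>m 0 (vdim V x))" for x
  have pd: "dim_row (path_map V x (b - x)) = vdim V b" "dim_col (path_map V x (b - x)) = vdim V x" if "a < x" "x \<le> b" for x
    using path_map_dims[OF V, of x "b - x"] that ab by auto
  have r: "rep_hom n V ?M r"
  proof (rule rep_homI)
    fix x assume x: "1 \<le> x" "x \<le> n"
    show "r x \<in> homs V ?M x"
      using l pd[of x] by (auto intro!: carrier_matI simp: r_def interval_rep_simps)
  next
    fix x assume x: "1 \<le> x" "x < n"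
    have dV: "dim_row (vmap V x) = vdim V (Suc x)" "dim_col (vmap V x) = vdim V x" using is_repD[OF V x]
      by auto
    consider "x < a" | "x = a" | "a < x" "x < b" | "x = b" | "b < x" by linarith
    then show "r (Suc x) * vmap V x = vmap ?M x * r x"
    proof cases
      case 3
      have "path_map V x (Suc 0 + (b - Suc x)) = path_map V (x + Suc 0) (b - Suc x) * path_map V x (Suc 0)"
        by (rule path_map_add[OF V]) (use 3 ab x in auto)
      then have "path_map V x (b - x) = path_map V (Suc x) (b - Suc x) * vmap V x"
        using 3 dV by (simp add: Suc_diff_Suc right_mult_one_mat')
      then have "r (Suc x) * vmap V x = r x"
        using 3 pd[of "Suc x"] l dV by (simp add: r_def mat_mult_assoc)
      moreover have "1\<^sub>m 1 * r x = r x"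
        using 3 l by (simp add: r_def left_mult_one_mat')
      ultimately show ?thesis using 3 by (simp add: interval_rep_simps)
    next
      \<comment> \<open>The arrow entering the support: here \<open>vdim V a = 0\<close>, by the
        choice of z as least, is what makes r commute.\<close>
      case 2
      have "vdim V x = 0" using z_least[of x] 2 x az by auto
      then show ?thesis using 2 ab dV l by (auto intro!: eq_matI simp: interval_rep_simps r_def)
    qed (use dV in \<open>auto intro!: eq_matI simp: interval_rep_simps r_def\<close>)
  qed
  have "r x * interval_hom V a b u x = 1\<^sub>m (vdim ?M x)" if x: "1 \<le> x" "x \<le> n" for x
  proof (cases "a < x \<and> x \<le> b")
    case True
    have "path_map V z ((x - z) + (b - x)) = path_map V (z + (x - z)) (b - x) * path_map V z (x - z)"
      by (rule path_map_add[OF V z(1)]) (use True ab az in auto)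
    then have Pe: "?P = path_map V x (b - x) * path_map V z (x - z)" using True az by simp
    have pz: "dim_row (path_map V z (x - z)) = vdim V x" "dim_col (path_map V z (x - z)) = vdim V z"
      using path_map_dims[OF V z(1), of "x - z"] True az x by auto
    have "r x * interval_hom V a b u x = l * (path_map V x (b - x) * path_map V z (x - z) * u)"
      using True pd[of x] pz l u az by (simp add: r_def interval_hom_def mat_mult_assoc)
    also have "\<dots> = 1\<^sub>m 1" unfolding Pe[symmetric] by (rule lPu)
    finally show ?thesis using True by (simp add: interval_rep_simps)
  next
    case False
    then show ?thesis by (auto intro!: eq_matI simp: r_def interval_hom_def interval_rep_simps)
  qed
  then have "retraction n ?M V (interval_hom V a b u) r"
    unfolding retraction_def using V \<iota> r interval_is_rep by auto
  then show ?thesis using ab by blast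
qed

lemma indecomposable_is_interval:
  assumes "indecomposable n V"
  shows "\<exists>a b. a < b \<and> b \<le> n \<and> rep_iso n V (interval_rep a b)"
proof -
  have V: "is_rep n V" "nonzero_rep n V" using assms unfolding indecomposable_def by auto
  obtain a b \<iota> r where ab: "a < b" "b \<le> n" and ret: "retraction n (interval_rep a b) V \<iota> r"
    using interval_retract[OF V] by blast
  obtain Z where Z: "is_rep n Z" "rep_iso n V (direct_sum (interval_rep a b) Z)"
    "\<not> nonzero_rep n Z \<longrightarrow> rep_iso n V (interval_rep a b)"
    using retract_is_summand[OF ret] by blast
  have "nonzero_rep n (interval_rep a b :: 'a rep)"
    unfolding nonzero_rep_def using ab by (intro bexI[of _ b]) (auto simp: interval_rep_simps)
  then have "\<not> nonzero_rep n Z"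
    using assms Z(1,2) interval_is_rep unfolding indecomposable_def by blast
  then show ?thesis using ab Z(3) by blast
qed

subsection \<open>Projectivity of an interval module in a perpendicular category\<close>

text \<open>Two out of three for bijections, applied to a composite of transition maps.\<close>

lemma transit_bij_comp:
  fixes W :: "'k::field rep"
  assumes W: "is_rep n W" and le: "l \<le> m" "m \<le> h" "h \<le> n"
  shows "transit_bij n W l m \<Longrightarrow> transit_bij n W m h \<longleftrightarrow> transit_bij n W l h"
    and "transit_bij n W m h \<Longrightarrow> transit_bij n W l m \<longleftrightarrow> transit_bij n W l h"
proof -
  let ?f = "(*) (transit n W l m)" and ?g = "(*) (transit n W m h)"
  have comp: "bij_betw (?g \<circ> ?f) (colvecs (udim n W l)) (colvecs (udim n W h)) \<longleftrightarrow> transit_bij n W l h"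
    unfolding transit_bij_def
    by (rule bij_betw_cong) (simp only: o_apply transit_trans_assoc[OF W le])
  have im: "?f ` colvecs (udim n W l) \<subseteq> colvecs (udim n W m)"
    using transit_colvecs[OF W le(1), of _] le by (auto simp only: image_subset_iff)
  show "transit_bij n W l m \<Longrightarrow> transit_bij n W m h \<longleftrightarrow> transit_bij n W l h"
    unfolding comp[symmetric] unfolding transit_bij_def by (rule bij_betw_comp_iff)
  show "transit_bij n W m h \<Longrightarrow> transit_bij n W l m \<longleftrightarrow> transit_bij n W l h"
    unfolding comp[symmetric] unfolding transit_bij_def by (rule bij_betw_comp_iff2[OF _ im])
qed

lemma transit_bij_refl: "transit_bij n (W :: 'k::field rep) x x"
proof (cases "x < n")
  case True
  have "bij_betw ((*) (transit n W x x)) (colvecs (udim n W x)) (colvecs (udim n W x)) \<longleftrightarrow>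
    bij_betw id (colvecs (udim n W x)) (colvecs (udim n W x) :: 'k mat set)"
    by (intro bij_betw_cong) (use True in \<open>auto simp: transit_def udim_def\<close>)
  then show ?thesis unfolding transit_bij_def by (simp only: bij_betw_id)
next
  case False
  have "bij_betw ((*) (transit n W x x)) (colvecs 0) (colvecs 0) \<longleftrightarrow> bij_betw id (colvecs 0) (colvecs 0 :: 'k mat set)"
    by (intro bij_betw_cong) (use False in \<open>auto simp: transit_def udim_def intro!: eq_matI\<close>)
  then show ?thesis unfolding transit_bij_def using False by (simp only: bij_betw_id udim_def if_False)
qed

text \<open>A walk in the diagram goes up and down. With min and max bijectivity becomes a symmetric
  relation between vertices, and each order of x, y, z is an instance of two out of three.\<close>

lemma transit_bij_transitive:
  assumes W: "is_rep n W" and "x \<le> n" "y \<le> n" "z \<le> n"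
    and "transit_bij n W (min x y) (max x y)" "transit_bij n W (min y z) (max y z)"
  shows "transit_bij n W (min x z) (max x z)"
proof -
  note [simp] = min_absorb1 min_absorb2 max_absorb1 max_absorb2
  consider "x \<le> y" "y \<le> z" | "x \<le> z" "z \<le> y" | "y \<le> x" "x \<le> z" | "y \<le> z" "z \<le> x"
    | "z \<le> x" "x \<le> y" | "z \<le> y" "y \<le> x" by linarith
  then show ?thesis
  proof cases
    case 1 then show ?thesis using transit_bij_comp[OF W, of x y z] assms by simp
  next
    case 2 then show ?thesis using transit_bij_comp[OF W, of x z y] assms by simp
  next
    case 3 then show ?thesis using transit_bij_comp[OF W, of y x z] assms by simp
  next
    case 4 then show ?thesis using transit_bij_comp[OF W, of y z x] assms by simp
  next
    case 5 then show ?thesis using transit_bij_comp[OF W, of z x y] assms by simp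
  next
    case 6 then show ?thesis using transit_bij_comp[OF W, of z y x] assms by simp
  qed
qed

text \<open>Extend f to P along r, lift, and restrict along \<iota>. It is used to replace an object
  of the sequence by the interval module isomorphic to it.\<close>

lemma projective_in_retract:
  assumes P: "projective_in n C P" and ret: "retraction n M P \<iota> r" and M: "M \<in> C"
    and C: "\<And>X. X \<in> C \<Longrightarrow> is_rep n X"
  shows "projective_in n C M"
  unfolding projective_in_def
proof (intro conjI ballI allI impI M)
  fix X Y g f
  assume X: "X \<in> C" and Y: "Y \<in> C" and e: "epi_in n C X Y g" and f: "rep_hom n M Y f"
  note R = retractionD[OF ret]
  have g: "rep_hom n X Y g" using e unfolding epi_in_def by blast
  have "rep_hom n P Y (\<lambda>x. f x * r x)" by (rule rep_hom_comp[OF R(2,1) C[OF Y] R(4) f])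
  then obtain h where h: "rep_hom n P X h" and gh: "\<forall>x\<in>{1..n}. g x * h x = f x * r x"
    using P X Y e unfolding projective_in_def by blast
  have "rep_hom n M X (\<lambda>x. h x * \<iota> x)" by (rule rep_hom_comp[OF R(1,2) C[OF X] R(3) h])
  moreover have "g x * (h x * \<iota> x) = f x" if x: "x \<in> {1..n}" for x
  proof -
    have x': "1 \<le> x" "x \<le> n" using x by auto
    note d = rep_homD[OF g x'] rep_homD[OF h x'] rep_homD[OF f x'] rep_homD[OF R(3) x'] rep_homD[OF R(4) x']
    have "g x * (h x * \<iota> x) = f x * (r x * \<iota> x)"
      by (rule mat_eq_assoc) (use gh x d in auto)
    then show ?thesis using R(5)[OF x'] d by (simp add: right_mult_one_mat')
  qed
  ultimately show "\<exists>h. rep_hom n M X h \<and> (\<forall>x\<in>{1..n}. g x * h x = f x)"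
    by (intro exI[of _ "\<lambda>x. h x * \<iota> x"]) blast
qed

lemma hom_from_interval_eq:
  assumes W: "is_rep n W" and ab: "a < b" "b \<le> n" and f: "rep_hom n (interval_rep a b) W f"
    and g: "rep_hom n (interval_rep a b) W g" and eq: "f (Suc a) = g (Suc a)" and x: "1 \<le> x" "x \<le> n"
  shows "f x = g x"
  using hom_from_interval(3)[OF W ab f x] hom_from_interval(3)[OF W ab g x] eq by simp

text \<open>A morphism from the interval module is an image for the generator. An epimorphism of the
  subcategory is surjective at vertex i + 1, so a preimage exists; \<open>lift\<close> asks to
  adjust it so that it also satisfies the relation at j.\<close>

lemma projective_interval:
  assumes V: "is_rep n V" and ab: "i < j" "j \<le> n" and M: "interval_rep i j \<in> perp n V"
    and lift: "\<And>X Y g u. X \<in> perp n V \<Longrightarrow> Y \<in> perp n V \<Longrightarrow> rep_hom n X Y g \<Longrightarrow>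
      u \<in> colvecs (udim n X i) \<Longrightarrow> transit n Y i j * (g (Suc i) * u) = 0\<^sub>m (udim n Y j) 1 \<Longrightarrow>
      \<exists>v\<in>colvecs (udim n X i). g (Suc i) * v = g (Suc i) * u \<and> transit n X i j * v = 0\<^sub>m (udim n X j) 1"
  shows "projective_in n (perp n V) (interval_rep i j :: 'k::field rep)"
  unfolding projective_in_def
proof (intro conjI ballI allI impI M)
  fix X Y :: "'k rep" and g f
  assume X: "X \<in> perp n V" and Y: "Y \<in> perp n V" and e: "epi_in n (perp n V) X Y g"
    and f: "rep_hom n (interval_rep i j) Y f"
  have r: "is_rep n X" "is_rep n Y" using X Y unfolding perp_def by auto
  have g: "rep_hom n X Y g" using e unfolding epi_in_def by blast
  have i: "1 \<le> Suc i" "Suc i \<le> n" "i < n" using ab by auto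
  obtain t where t: "\<forall>x\<in>{1..n}. t x \<in> homs Y X x \<and> g x * t x = 1\<^sub>m (vdim Y x)"
    using epi_in_perp_right_inverse[OF V X Y e] by blast
  then have ti: "t (Suc i) \<in> carrier_mat (vdim X (Suc i)) (vdim Y (Suc i))" "g (Suc i) * t (Suc i) = 1\<^sub>m (vdim Y (Suc i))"
    using i by auto
  note hf = hom_from_interval[OF r(2) ab f]
  have fc: "f (Suc i) \<in> colvecs (vdim Y (Suc i))" using hf(1) i by (simp add: udim_def)
  note gd = rep_homD[OF g i(1,2)]
  \<comment> \<open>t is a right inverse at each vertex but no morphism, so this preimage need not
    satisfy the relation at j.\<close>
  have gt: "g (Suc i) * (t (Suc i) * f (Suc i)) = f (Suc i)"
    by (rule mat_one_assoc[OF ti(2)]) (use ti fc gd in auto)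
  have tf: "t (Suc i) * f (Suc i) \<in> colvecs (udim n X i)" using ti fc i
    by (auto intro!: carrier_matI simp: udim_def)
  obtain v where v: "v \<in> colvecs (udim n X i)" "g (Suc i) * v = f (Suc i)" "transit n X i j * v = 0\<^sub>m (udim n X j) 1"
    using lift[OF X Y g tf] hf(2) unfolding gt by blast
  let ?h = "interval_hom X i j v"
  have h: "rep_hom n (interval_rep i j) X ?h" by (rule interval_hom_rep_hom[OF r(1) ab v(1,3)])
  have gh: "rep_hom n (interval_rep i j) Y (\<lambda>x. g x * ?h x)"
    by (rule rep_hom_comp[OF interval_is_rep r h g])
  have "?h (Suc i) = v" using v(1) ab i by (simp add: interval_hom_def udim_def left_mult_one_mat')
  then have "g (Suc i) * ?h (Suc i) = f (Suc i)" using v(2) by simp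
  then have "\<forall>x\<in>{1..n}. g x * ?h x = f x"
    using hom_from_interval_eq[OF r(2) ab gh f] by auto
  then show "\<exists>h. rep_hom n (interval_rep i j) X h \<and> (\<forall>x\<in>{1..n}. g x * h x = f x)"
    using h by blast
qed

text \<open>Subtracting from u the image of a vector at k < i makes its image at j vanish; this does not
  change \<open>g u\<close>, because the corresponding vector of Y at k is zero.\<close>

lemma lift_by_transit_bij:
  assumes X: "is_rep n X" and Y: "is_rep n Y" and g: "rep_hom n X Y g"
    and le: "k < i" "i < j" "j < n" and bX: "transit_bij n X k j" and bY: "transit_bij n Y k j"
    and u: "u \<in> colvecs (udim n X i)"
      and z: "transit n Y i j * (g (Suc i) * u) = 0\<^sub>m (udim n Y j) 1"
  shows "\<exists>v\<in>colvecs (udim n X i). g (Suc i) * v = g (Suc i) * u \<and> transit n X i j * v = 0\<^sub>m (udim n X j) 1"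
proof -
  have o: "k \<le> i" "i \<le> j" "k \<le> j" "i < n" "i \<le> n" "j \<le> n" "k < n" using le by auto
  have c: "transit n X i j * u \<in> colvecs (udim n X j)" by (rule transit_colvecs[OF X o(2,6) u])
  then have "transit n X i j * u \<in> (*) (transit n X k j) ` colvecs (udim n X k)" using bX
    unfolding transit_bij_def bij_betw_def by simp
  then obtain w where w: "w \<in> colvecs (udim n X k)" "transit n X i j * u = transit n X k j * w" by blast
  have gw: "g (Suc k) * w \<in> colvecs (udim n Y k)"
    using rep_homD[OF g, of "Suc k"] w(1) o by (auto intro!: carrier_matI simp: udim_def)
  have "transit n Y k j * (g (Suc k) * w) = g (Suc j) * (transit n X k j * w)"
    by (rule transit_commute[OF X Y g o(3) le(3) w(1), symmetric])
  also have "\<dots> = transit n Y i j * (g (Suc i) * u)"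
    unfolding w(2)[symmetric] by (rule transit_commute[OF X Y g o(2) le(3) u])
  \<comment> \<open>Both vectors at k have image 0 at j, and the map from k to j is injective for
    Y.\<close>
  also have "\<dots> = transit n Y k j * 0\<^sub>m (udim n Y k) 1"
    unfolding z using transit_dims[OF Y o(3,6)] by (simp add: mat_mult_zero)
  finally have gw0: "g (Suc k) * w = 0\<^sub>m (udim n Y k) 1"
    using bY gw unfolding transit_bij_def bij_betw_def by (auto dest: inj_onD)
  have kw: "transit n X k i * w \<in> colvecs (udim n X i)" by (rule transit_colvecs[OF X o(1,5) w(1)])
  have dg: "dim_col (g (Suc i)) = udim n X i" "dim_row (g (Suc i)) = udim n Y i"
    using rep_homD[OF g, of "Suc i"] o by (auto simp: udim_def)
  define v where "v = u - transit n X k i * w"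
  have v: "v \<in> colvecs (udim n X i)" unfolding v_def by (rule minus_carrier_mat[OF kw])
  have "g (Suc i) * (transit n X k i * w) = transit n Y k i * (g (Suc k) * w)"
    by (rule transit_commute[OF X Y g o(1,4) w(1)])
  also have "\<dots> = 0\<^sub>m (udim n Y i) 1" unfolding gw0 using transit_dims[OF Y o(1,5)]
    by (simp add: mat_mult_zero)
  finally have e1: "g (Suc i) * (transit n X k i * w) = 0\<^sub>m (udim n Y i) 1" .
  have "g (Suc i) * v = g (Suc i) * u - g (Suc i) * (transit n X k i * w)"
    unfolding v_def by (rule mat_mult_minus) (use u kw dg in auto)
  also have "\<dots> = g (Suc i) * u" unfolding e1 using u dg by (auto intro!: eq_matI)
  finally have e2: "g (Suc i) * v = g (Suc i) * u" .
  have "transit n X i j * v = transit n X i j * u - transit n X i j * (transit n X k i * w)"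
    unfolding v_def by (rule mat_mult_minus) (use u kw transit_dims[OF X o(2,6)] in auto)
  also have "transit n X i j * (transit n X k i * w) = transit n X k j * w"
    by (rule transit_trans_assoc[OF X o(1,2,6) w(1)])
  also have "transit n X i j * u - transit n X k j * w = 0\<^sub>m (udim n X j) 1"
    unfolding w(2)[symmetric] using c by (rule minus_r_inv_mat)
  finally show ?thesis using v e2 by blast
qed

text \<open>The space at n is zero, hence so is any space in bijection with it.\<close>

lemma transit_bij_to_top:
  fixes X :: "'k::field rep" and z :: "'k mat"
  assumes X: "is_rep n X" and "j \<le> n" and b: "transit_bij n X j n" and z: "z \<in> colvecs (udim n X j)"
  shows "z = 0\<^sub>m (udim n X j) 1"
proof -
  have inj: "inj_on ((*) (transit n X j n)) (colvecs (udim n X j))" using b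
    unfolding transit_bij_def bij_betw_def by simp
  have "transit n X j n * z = transit n X j n * 0\<^sub>m (udim n X j) 1"
    using transit_dims[OF X assms(2)] z by (auto intro!: eq_matI simp: udim_def)
  then show ?thesis by (rule inj_onD[OF inj _ z]) simp
qed

text \<open>The quotient map from \<open>M\<^sub>i\<^sub>,\<^sub>m\<^sub>+\<^sub>1\<close> onto \<open>M\<^sub>i\<^sub>,\<^sub>j\<close> does not split.\<close>

lemma not_projective_interval:
  assumes "i < j" "j \<le> m" "m < n" and X: "interval_rep i (Suc m) \<in> C"
    and M: "interval_rep i j \<in> C"
  shows "\<not> projective_in n C (interval_rep i j :: 'k::field rep)"
proof
  let ?X = "interval_rep i (Suc m) :: 'k rep" and ?M = "interval_rep i j :: 'k rep"
  assume P: "projective_in n C ?M"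
  \<comment> \<open>The projection onto the vertices up to j; s is a section at each vertex, not a
    morphism.\<close>
  define g where "g x = (if i < x \<and> x \<le> j then 1\<^sub>m 1 else 0\<^sub>m 0 (vdim ?X x) :: 'k mat)" for x
  define s where "s x = (if i < x \<and> x \<le> j then 1\<^sub>m 1 else 0\<^sub>m (vdim ?X x) 0 :: 'k mat)" for x
  have g: "rep_hom n ?X ?M g"
  proof (rule rep_homI)
    fix x assume x: "1 \<le> x" "x < n"
    consider "x < i" | "x = i" | "i < x" "x < j" | "j \<le> x" by linarith
    then show "g (Suc x) * vmap ?X x = vmap ?M x * g x"
      by cases (use assms in \<open>auto simp: g_def interval_rep_simps intro!: eq_matI\<close>)
  qed (use assms in \<open>auto simp: g_def interval_rep_simps\<close>)
  have gs: "g x * s x = 1\<^sub>m (vdim ?M x)" for x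
    by (auto simp: g_def s_def interval_rep_simps intro!: eq_matI)
  \<comment> \<open>Surjectivity at every vertex makes g epi against any test object.\<close>
  have "epi_in n C ?X ?M g"
    unfolding epi_in_def
  proof (intro conjI ballI allI impI g)
    fix Z :: "'k rep" and u v x
    assume uv: "rep_hom n ?M Z u" "rep_hom n ?M Z v" "\<forall>x\<in>{1..n}. u x * g x = v x * g x"
      and "x \<in> {1..n}"
    then have x: "1 \<le> x" "x \<le> n" by auto
    have d: "dim_row (s x) = vdim ?X x" using assms by (auto simp: s_def interval_rep_simps)
    have "u x * (g x * s x) = v x * (g x * s x)"
      by (rule mat_eq_assoc) (use uv x d rep_homD[OF g x] rep_homD[OF uv(1) x] rep_homD[OF uv(2) x] in auto)
    then show "u x = v x"
      unfolding gs using rep_homD[OF uv(1) x] rep_homD[OF uv(2) x] by (simp add: right_mult_one_mat')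
  qed
  moreover have "rep_hom n ?M ?M (\<lambda>x. 1\<^sub>m (vdim ?M x))"
    by (rule rep_homI) (auto simp: interval_rep_simps)
  ultimately obtain h where h: "rep_hom n ?M ?X h"
    and gh: "\<forall>x\<in>{1..n}. g x * h x = 1\<^sub>m (vdim ?M x)"
    using P X M unfolding projective_in_def by blast
  have j: "1 \<le> j" "j < n" "j \<le> n" "1 \<le> Suc j" "Suc j \<le> n" using assms by auto
  have hj: "h j \<in> carrier_mat 1 1" using rep_homD[OF h j(1,3)] assms
    by (auto intro!: carrier_matI simp: interval_rep_simps)
  \<comment> \<open>The arrow from j to j + 1 is zero in \<open>?M\<close> but the identity in
    \<open>?X\<close>, whose support contains j + 1 as \<open>j \<le> m\<close>. So
    \<open>h j = 0\<close>, against \<open>g j * h j = 1\<close>.\<close>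
  have "h (Suc j) * vmap ?M j = 0\<^sub>m 1 1"
    using rep_homD[OF h j(4,5)] assms by (simp add: interval_rep_simps mat_mult_dim0)
  moreover have "vmap ?X j * h j = h j" using hj assms by (simp add: interval_rep_simps)
  ultimately have "h j = 0\<^sub>m 1 1" using rep_hom_commute[OF h j(1,2)] by simp
  moreover have "g j * h j = 1\<^sub>m 1" using gh j assms by (simp add: interval_rep_simps)
  ultimately have "(1\<^sub>m 1 :: 'k mat) = 0\<^sub>m 1 1" using assms by (simp add: g_def)
  from arg_cong[OF this, of "\<lambda>M. M $$ (0, 0)"] show False by simp
qed

subsection \<open>Combinatorics of strand diagrams\<close>

text \<open>Position q of the sequence contributes the strand \<open>(a q, b q)\<close>. The last
  assumption is, by \<open>interval_transit_bij_iff\<close>, the condition that the q-th interval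
  module lies in the perpendicular category of the p-th.\<close>

locale strand_config =
  fixes n :: nat and a b :: "nat \<Rightarrow> nat"
  assumes strand_less: "q < n \<Longrightarrow> a q < b q"
    and strand_le: "q < n \<Longrightarrow> b q \<le> n"
    and later_respects: "q < p \<Longrightarrow> p < n \<Longrightarrow> a p \<in> {a q..<b q} \<longleftrightarrow> b p \<in> {a q..<b q}"
begin

definition edges :: "nat set \<Rightarrow> (nat \<times> nat) set" where
  "edges Q = (\<Union>q\<in>Q. {(a q, b q), (b q, a q)})"

definition conn :: "nat set \<Rightarrow> nat \<Rightarrow> nat \<Rightarrow> bool" where
  "conn Q x y \<longleftrightarrow> (x, y) \<in> (edges Q)\<^sup>*"

text \<open>Both this and \<open>later_respects\<close> exclude exactly the orders
  \<open>a q \<le> a p < b q \<le> b p\<close> and \<open>a p < a q \<le> b p < b q\<close>.\<close>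

lemma earlier_respects:
  assumes "q < p" "p < n"
  shows "a q \<in> {a p<..b p} \<longleftrightarrow> b q \<in> {a p<..b p}"
  using later_respects[OF assms] strand_less[of p] strand_less[of q] assms by auto

text \<open>A strict crossing violates \<open>later_respects\<close> whichever of the two strands
  comes later.\<close>

lemma noncrossing:
  assumes "p < n" "q < n" "a p < a q" "a q < b p"
  shows "b q \<le> b p"
proof (rule ccontr)
  assume "\<not> b q \<le> b p"
  then show False
    using assms later_respects[of p q] later_respects[of q p] strand_less[of p] strand_less[of q]
    by (cases p q rule: linorder_cases) auto
qed

section \<open>Components of the graph formed by a set of strands\<close>

lemma conn_refl [simp]: "conn Q x x"
  by (simp add: conn_def)

lemma conn_trans [trans]: "conn Q x y \<Longrightarrow> conn Q y z \<Longrightarrow> conn Q x z"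
  unfolding conn_def by (rule rtrancl_trans)

lemma conn_sym: "conn Q x y \<Longrightarrow> conn Q y x"
proof -
  have "sym (edges Q)" unfolding edges_def sym_def by auto
  then show "conn Q x y \<Longrightarrow> conn Q y x"
    unfolding conn_def by (meson sym_rtrancl symD)
qed

lemma conn_mono: "Q \<subseteq> R \<Longrightarrow> conn Q x y \<Longrightarrow> conn R x y"
  unfolding conn_def edges_def
  by (erule rtrancl_mono[THEN subsetD, rotated]) auto

lemma conn_edge: "q \<in> Q \<Longrightarrow> conn Q (a q) (b q)"
  unfolding conn_def edges_def by blast

lemma conn_edge_iff: "q \<in> Q \<Longrightarrow> conn Q x (a q) \<longleftrightarrow> conn Q x (b q)"
  by (meson conn_edge conn_trans conn_sym)

lemma conn_closed:
  assumes "conn Q x y" "\<And>q. q \<in> Q \<Longrightarrow> a q \<in> A \<longleftrightarrow> b q \<in> A"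
  shows "x \<in> A \<longleftrightarrow> y \<in> A"
  using assms(1) unfolding conn_def
  by (induction rule: rtrancl_induct) (use assms(2) in \<open>auto simp: edges_def\<close>)

text \<open>Applies \<open>conn_closed\<close> to the vertices that lie in A or outside the
  component of x, so that only strands of this component have to be checked.\<close>

lemma conn_closed_within:
  assumes "conn Q x y" "\<And>q. q \<in> Q \<Longrightarrow> conn Q x (a q) \<Longrightarrow> a q \<in> A \<longleftrightarrow> b q \<in> A"
  shows "x \<in> A \<longleftrightarrow> y \<in> A"
proof -
  have "x \<in> {z. conn Q x z \<longrightarrow> z \<in> A} \<longleftrightarrow> y \<in> {z. conn Q x z \<longrightarrow> z \<in> A}"
    by (rule conn_closed[OF assms(1)]) (use assms(2) conn_edge_iff in auto)
  then show ?thesis using assms(1) by simp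
qed

text \<open>A walk can be shortened so that it uses strand q at most once.\<close>

lemma conn_insertD:
  assumes "conn (insert q Q) x y"
  shows "conn Q x y \<or> conn Q x (a q) \<and> conn Q (b q) y \<or> conn Q x (b q) \<and> conn Q (a q) y"
  using assms unfolding conn_def
proof (induction rule: rtrancl_induct)
  case base
  then show ?case by simp
next
  case (step y z)
  then consider "(y, z) \<in> edges Q" | "y = a q" "z = b q" | "y = b q" "z = a q"
    unfolding edges_def by auto
  then show ?case
    by cases (use step.IH in \<open>auto intro: rtrancl_into_rtrancl\<close>)
qed

text \<open>The latest strand of a cycle closed by strand p would have to cross the boundary of an
  interval that no earlier strand crosses.\<close>

lemma not_conn_strand:
  assumes "Q \<subseteq> {..<n}" "p < n" "p \<notin> Q"
  shows "\<not> conn Q (a p) (b p)"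
proof -
  have "finite Q" using assms(1) finite_subset by blast
  then show ?thesis using assms
  proof (induction Q rule: finite_linorder_max_induct)
    case empty
    then show ?case using strand_less[of p] by (auto simp: conn_def edges_def)
  next
    case (insert q Q)
    let ?Q = "insert q Q"
    show ?case
    proof
      assume c: "conn ?Q (a p) (b p)"
      show False
      proof (cases "q < p")
        case True
        \<comment> \<open>Here p is later than all strands of the walk, so the walk stays on one
          side of \<open>(a p, b p]\<close>, which contains \<open>b p\<close> but not
          \<open>a p\<close>.\<close>
        have "a p \<in> {a p<..b p} \<longleftrightarrow> b p \<in> {a p<..b p}"
          by (rule conn_closed[OF c], rule earlier_respects)
            (use insert True in auto)
        then show False using strand_less insert by auto
      next
        case False
        then have pq: "p < q" "q < n" using insert by auto
        \<comment> \<open>Now q is the latest. Neither Q nor p crosses \<open>(a q, b q]\<close>,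
          whereas strand q does, and a walk from \<open>a p\<close> to \<open>b p\<close> must use
          q.\<close>
        have cl: "x \<in> {a q<..b q} \<longleftrightarrow> y \<in> {a q<..b q}" if "conn Q x y" for x y
          by (rule conn_closed[OF that], rule earlier_respects) (use insert in auto)
        have "\<not> conn Q (a p) (b p)" using insert by auto
        with conn_insertD[OF c] cl earlier_respects[OF pq] strand_less[OF pq(2)]
        show False by fastforce
      qed
    qed
  qed
qed

text \<open>c names the component of a vertex. By \<open>not_conn_strand\<close> each new strand
  joins two different components and so lowers their number by one.\<close>

lemma conn_classes:
  assumes "Q \<subseteq> {..<n}"
  shows "\<exists>c :: nat \<Rightarrow> nat. (\<forall>x\<le>n. \<forall>y\<le>n. c x = c y \<longleftrightarrow> conn Q x y) \<and>
    card (c ` {..n}) + card Q = Suc n"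
proof -
  have "finite Q" using assms(1) finite_subset by blast
  then show ?thesis using assms
  proof (induction Q rule: finite_induct)
    case empty
    then show ?case by (intro exI[of _ "\<lambda>x. x"]) (auto simp: conn_def edges_def)
  next
    case (insert q Q)
    have "Q \<subseteq> {..<n}" using insert.prems by simp
    from insert.IH[OF this] obtain c :: "nat \<Rightarrow> nat"
      where c1: "\<forall>x\<le>n. \<forall>y\<le>n. c x = c y \<longleftrightarrow> conn Q x y"
        and c2: "card (c ` {..n}) + card Q = Suc n" by blast
    have q: "q < n" "a q < b q" "b q \<le> n" using insert strand_less strand_le by auto
    then have ab: "c (a q) \<noteq> c (b q)"
      using c1 not_conn_strand[of Q q] insert by auto
    \<comment> \<open>Merges the class of \<open>b q\<close> into that of
      \<open>a q\<close>.\<close>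
    define d where "d x = (if c x = c (b q) then c (a q) else c x)" for x
    have *: "conn (insert q Q) (a q) (b q)" by (rule conn_edge) simp
    have d1: "conn (insert q Q) x y" if "x \<le> n" "y \<le> n" "d x = d y" for x y
    proof -
      have m: "conn Q x y \<Longrightarrow> conn (insert q Q) x y" for x y by (rule conn_mono[of Q]) auto
      have "c x = c y \<or> c x = c (b q) \<and> c y = c (a q) \<or> c x = c (a q) \<and> c y = c (b q)"
        using that(3) unfolding d_def by (auto split: if_splits)
      moreover have "a q \<le> n" using q by simp
      ultimately have "conn Q x y \<or> conn Q x (b q) \<and> conn Q y (a q) \<or> conn Q x (a q) \<and> conn Q y (b q)"
        using c1 q(3) that(1,2) by blast
      then show ?thesis using m * by (meson conn_sym conn_trans)
    qed
    have d2: "d x = d y" if "x \<le> n" "y \<le> n" "conn (insert q Q) x y" for x y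
    proof -
      have "a q \<le> n" using q by simp
      then have "c x = c y \<or> c x = c (a q) \<and> c (b q) = c y \<or> c x = c (b q) \<and> c (a q) = c y"
        using conn_insertD[OF that(3)] c1 that(1,2) q(3) by blast
      then show ?thesis unfolding d_def by auto
    qed
    have "d ` {..n} = c ` {..n} - {c (b q)}"
    proof
      show "d ` {..n} \<subseteq> c ` {..n} - {c (b q)}" using q ab by (auto simp: d_def)
      show "c ` {..n} - {c (b q)} \<subseteq> d ` {..n}"
      proof
        fix z assume "z \<in> c ` {..n} - {c (b q)}"
        then obtain x where "x \<le> n" "z = c x" "c x \<noteq> c (b q)" by auto
        then show "z \<in> d ` {..n}" by (intro image_eqI[of _ _ x]) (auto simp: d_def)
      qed
    qed
    moreover have "c (b q) \<in> c ` {..n}" using q by auto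
    ultimately have "Suc (card (d ` {..n})) = card (c ` {..n})"
      using card_Suc_Diff1[of "c ` {..n}" "c (b q)"] by simp
    then have "card (d ` {..n}) + card (insert q Q) = Suc n" using c2 insert.hyps by simp
    then show ?case using d1 d2 by blast
  qed
qed

text \<open>An acyclic graph with n edges on n + 1 vertices has one component.\<close>

lemma conn_all:
  assumes "x \<le> n" "y \<le> n"
  shows "conn {..<n} x y"
proof -
  obtain c :: "nat \<Rightarrow> nat" where c: "\<forall>x\<le>n. \<forall>y\<le>n. c x = c y \<longleftrightarrow> conn {..<n} x y"
    and card: "card (c ` {..n}) + card {..<n} = Suc n" using conn_classes[of "{..<n}"] by blast
  then have "card (c ` {..n}) = 1" by simp
  then obtain z where "c ` {..n} = {z}" by (rule card_1_singletonE)
  then have "c x \<in> {z}" "c y \<in> {z}" using assms by blast+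
  then have "c x = c y" by simp
  then show ?thesis using assms c by blast
qed

text \<open>A strand (c, d) outside the component of x and y cannot separate x from y, since the
  component would have to cross it.\<close>

lemma noncrossing_component:
  assumes Q: "Q \<subseteq> {..<n}" and xy: "conn Q x y" and q: "q \<in> Q" and nc: "\<not> conn Q x (a q)"
    and "x < y"
  shows "a q \<in> {x<..<y} \<longleftrightarrow> b q \<in> {x<..<y}"
proof -
  have "x \<in> {a q<..<b q} \<longleftrightarrow> y \<in> {a q<..<b q}"
  proof (rule conn_closed_within[OF xy])
    fix r assume r: "r \<in> Q" "conn Q x (a r)"
    then have cr: "conn Q x (b r)" using conn_edge_iff by blast
    have nb: "\<not> conn Q x (b q)" using nc conn_edge_iff q by blast
    have ne: "a r \<noteq> a q" "a r \<noteq> b q" "b r \<noteq> a q" "b r \<noteq> b q"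
      using r(2) nc cr nb by auto
    have rq: "r < n" "q < n" using r q Q by auto
    have "a r < a q \<and> a q < b r \<longrightarrow> b q \<le> b r" "a q < a r \<and> a r < b q \<longrightarrow> b r \<le> b q"
      using noncrossing rq by blast+
    then show "a r \<in> {a q<..<b q} \<longleftrightarrow> b r \<in> {a q<..<b q}"
      using ne strand_less[OF rq(1)] strand_less[OF rq(2)] unfolding greaterThanLessThan_iff
      by linarith
  qed
  moreover have "x \<noteq> a q" "y \<noteq> a q" "x \<noteq> b q" "y \<noteq> b q"
    using nc xy conn_edge_iff[OF q] conn_edge[OF q] conn_sym[OF conn_edge[OF q]] by auto
  moreover have "a q < b q" using q Q strand_less by auto
  ultimately show ?thesis using \<open>x < y\<close> by auto
qed

text \<open>If i were in another component than k and j, no strand of its component could separate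
  the two sides of the interval between k and j, yet i is inside and m outside.\<close>

lemma components_do_not_cross:
  assumes Q: "Q \<subseteq> {..<n}" and "k < i" "i < j" "j < m" "conn Q k j" "conn Q i m"
  shows "conn Q k i"
proof (rule ccontr)
  assume nki: "\<not> conn Q k i"
  have "i \<in> {k<..<j} \<longleftrightarrow> m \<in> {k<..<j}"
  proof (rule conn_closed_within[OF assms(6)])
    fix q assume q: "q \<in> Q" "conn Q i (a q)"
    then have "\<not> conn Q k (a q)" using nki conn_trans conn_sym by blast
    then show "a q \<in> {k<..<j} \<longleftrightarrow> b q \<in> {k<..<j}"
      using noncrossing_component[OF Q assms(5) q(1)] assms by simp
  qed
  then show False using assms by simp
qed

section \<open>The component of an end point under the later strands\<close>

definition later :: "nat \<Rightarrow> nat set" where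
  "later p = {p<..<n}"

lemma conn_le: 
  assumes "conn Q x y" "x \<le> n" "Q \<subseteq> {..<n}"
  shows "y \<le> n"
proof -
  have "x \<in> {..n} \<longleftrightarrow> y \<in> {..n}"
  proof (rule conn_closed[OF assms(1)])
    fix q assume "q \<in> Q"
    then have "q < n" using assms(3) by blast
    then show "a q \<in> {..n} \<longleftrightarrow> b q \<in> {..n}" using strand_le[of q] strand_less[of q]
      by simp
  qed
  then show ?thesis using assms by simp
qed

text \<open>Later strands respect \<open>[a p, b p)\<close>. This interval misses
  \<open>b p\<close>, hence the whole component of \<open>b p\<close>.\<close>

lemma later_component_ge:
  assumes "conn (later p) k (b p)" "\<not> (\<exists>k<a p. conn (later p) k (b p))"
  shows "b p \<le> k"
proof -
  have "k \<in> {a p..<b p} \<longleftrightarrow> b p \<in> {a p..<b p}"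
    by (rule conn_closed[OF assms(1)], rule later_respects) (auto simp: later_def)
  then show ?thesis using assms by auto
qed

text \<open>m is the largest vertex of the component. Strands of the component end in
  \<open>[b p, m]\<close>, and the others cannot separate \<open>b p\<close> from m by
  \<open>noncrossing_component\<close>. The resulting interval is the shifted support of the module
  that will refute projectivity.\<close>

lemma component_interval:
  assumes p: "p < n"
    and min: "\<And>k. conn (later p) k (b p) \<Longrightarrow> b p \<le> k"
    and nn: "\<not> conn (later p) (b p) n"
  shows "\<exists>m. b p \<le> m \<and> m < n \<and> conn (later p) (b p) m \<and>
    (\<forall>q\<in>later p. a q \<in> {a p..m} \<longleftrightarrow> b q \<in> {a p..m})"
proof -
  let ?L = "later p" and ?j = "b p"
  have L: "?L \<subseteq> {..<n}" unfolding later_def by auto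
  have j: "?j \<le> n" using p strand_le by blast
  define K where "K = {x. conn ?L ?j x}"
  have K: "finite K" "?j \<in> K"
    unfolding K_def using conn_le[OF _ j L] by (auto intro: finite_subset[of _ "{..n}"])
  define m where "m = Max K"
  have m: "m \<in> K" "\<And>x. x \<in> K \<Longrightarrow> x \<le> m"
    unfolding m_def using Max_in[of K] Max_ge[of K] K by blast+
  have jm: "?j \<le> m" "conn ?L ?j m" using m K unfolding K_def by auto
  have mn: "m < n" using conn_le[OF jm(2) j L] nn jm(2) by (cases "m = n") auto
  have cl: "a q \<in> {?j..m} \<longleftrightarrow> b q \<in> {?j..m}" if q: "q \<in> ?L" for q
  proof (cases "conn ?L ?j (a q)")
    case True
    then have "conn ?L ?j (b q)" using conn_edge_iff q by blast
    with True have "a q \<in> K" "b q \<in> K" "?j \<le> a q" "?j \<le> b q" unfolding K_def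
      using min conn_sym by auto
    then show ?thesis using m by auto
  next
    case False
    then have nb: "\<not> conn ?L ?j (b q)" using conn_edge_iff q by blast
    have ne: "a q \<noteq> ?j" "b q \<noteq> ?j" "a q \<noteq> m" "b q \<noteq> m" using False nb jm by auto
    show ?thesis
    proof (cases "?j < m")
      case True
      from noncrossing_component[OF L jm(2) q False True] ne show ?thesis by auto
    qed (use ne jm in auto)
  qed
  \<comment> \<open>\<open>[a p, m]\<close> is the disjoint union of \<open>[a p, b p)\<close> and
    \<open>[b p, m]\<close>, both of which strand q respects.\<close>
  have "a q \<in> {a p..m} \<longleftrightarrow> b q \<in> {a p..m}" if q: "q \<in> ?L" for q
    using cl[OF q] later_respects[of p q] q p strand_less[of p] jm(1) unfolding later_def by auto
  then show ?thesis using jm mn by blast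
qed

text \<open>Reduces the condition on the whole tree to one on the later strands only, which are all that
  the perpendicular category depends on.\<close>

lemma conn_target_iff:
  assumes p: "p < n"
  shows "conn ({..<n} - {p}) (b p) n \<longleftrightarrow>
    (\<exists>k<a p. conn (later p) k (b p)) \<or> conn (later p) (b p) n"
    (is "?l \<longleftrightarrow> ?r")
proof -
  let ?L = "later p" and ?Q = "{..<n} - {p}"
  have L: "?L \<subseteq> ?Q" unfolding later_def by auto
  have nc: "\<not> conn ?Q (a p) (b p)" using not_conn_strand[of ?Q p] p by auto
  have ab: "a p < b p" "b p \<le> n" using p strand_less strand_le by auto
  show ?thesis
  proof
    assume ?l
    show ?r
    proof (rule ccontr)
      assume nr: "\<not> ?r"
      then have min: "b p \<le> k" if "conn ?L k (b p)" for k
        using later_component_ge that by blast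
      have nn: "\<not> conn ?L (b p) n" using nr by simp
      obtain m where m: "b p \<le> m" "m < n" "conn ?L (b p) m"
        and cl: "\<forall>q\<in>?L. a q \<in> {a p..m} \<longleftrightarrow> b q \<in> {a p..m}"
        using component_interval[OF p min nn] by blast
      \<comment> \<open>The interval contains \<open>b p\<close> but not n, so it is enough that no
        strand in the component of \<open>b p\<close> without p crosses it.\<close>
      have "b p \<in> {a p<..m} \<longleftrightarrow> n \<in> {a p<..m}"
      proof (rule conn_closed_within[OF \<open>?l\<close>])
        fix q assume q: "q \<in> ?Q" "conn ?Q (b p) (a q)"
        then have c2: "conn ?Q (b p) (b q)" using conn_edge_iff[OF q(1)] by simp
        \<comment> \<open>The component avoids \<open>a p\<close>, so \<open>(a p, m]\<close> and
          \<open>[a p, m]\<close> agree on it.\<close>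
        have ne: "a q \<noteq> a p" "b q \<noteq> a p" using nc q(2) c2 conn_sym[of ?Q "b p" "a p"] by auto
        show "a q \<in> {a p<..m} \<longleftrightarrow> b q \<in> {a p<..m}"
        proof (cases "q < p")
          case True
          \<comment> \<open>For a strand q earlier than p, \<open>[a q, b q)\<close> separates
            neither \<open>b p\<close> from m, which later strands join, nor \<open>a p\<close> from
            \<open>b p\<close>. It contains all three or none, and so strand q cannot cross
            \<open>(a p, m]\<close>.\<close>
          have "b p \<in> {a q..<b q} \<longleftrightarrow> m \<in> {a q..<b q}"
            by (rule conn_closed[OF m(3)], rule later_respects) (use True in \<open>auto simp: later_def\<close>)
          moreover have "a q < b q" using strand_less q(1) by auto
          ultimately show ?thesis
            using later_respects[OF True p] m(1) ab(1) unfolding atLeastLessThan_iff greaterThanAtMost_iff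
            by linarith
        next
          case False
          then have "q \<in> ?L" using q(1) unfolding later_def by auto
          with cl have "a q \<in> {a p..m} \<longleftrightarrow> b q \<in> {a p..m}" by blast
          with ne show ?thesis by auto
        qed
      qed
      then show False using m ab by auto
    qed
  next
    assume ?r
    then show ?l
    proof
      assume "conn ?L (b p) n" then show ?l using conn_mono[OF L] by blast
    next
      assume "\<exists>k<a p. conn ?L k (b p)"
      then obtain k where k: "k < a p" "conn ?Q k (b p)" using conn_mono[OF L] by blast
      show ?l
      proof (rule ccontr)
        assume nl: "\<not> ?l"
        then have "b p \<noteq> n" by auto
        have "conn (insert p ?Q) (b p) n"
          using conn_all[of "b p" n] ab p by (simp add: insert_absorb insert_Diff)
        \<comment> \<open>n is on the side of \<open>a p\<close>. As k is joined to
          \<open>b p\<close> and \<open>k < a p < b p < n\<close>, the two components would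
          cross.\<close>
        then have "conn ?Q (a p) n"
          using conn_insertD[of p ?Q "b p" n] nl nc conn_sym[of ?Q "b p" "a p"] by auto
        then have "conn ?Q k (a p)"
          using components_do_not_cross[of ?Q k "a p" "b p" n] k ab \<open>b p \<noteq> n\<close> by auto
        then have "conn ?Q (a p) (b p)" using k(2) by (meson conn_sym conn_trans)
        then show False using nc by simp
      qed
    qed
  qed
qed

end

subsection \<open>Paths in the strand diagram\<close>

context strand_config
begin

definition diagram :: "nat set \<Rightarrow> (nat, nat \<times> nat) pre_digraph" where
  "diagram Q = \<lparr>verts = {0..n}, arcs = edges Q, tail = fst, head = snd\<rparr>"

lemma diagram_simps [simp]:
  "verts (diagram Q) = {0..n}" "arcs (diagram Q) = edges Q"
  "tail (diagram Q) = fst" "head (diagram Q) = snd"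
  by (simp_all add: diagram_def)

abbreviation "cas_in Q \<equiv> pre_digraph.cas (diagram Q)"
abbreviation "walk_in Q \<equiv> pre_digraph.awalk (diagram Q)"
abbreviation "path_in Q \<equiv> pre_digraph.apath (diagram Q)"
abbreviation "verts_in Q \<equiv> pre_digraph.awalk_verts (diagram Q)"

lemma wf_diagram:
  assumes "Q \<subseteq> {..<n}"
  shows "wf_digraph (diagram Q)"
proof
  fix e assume "e \<in> arcs (diagram Q)"
  then obtain q where q: "q \<in> Q" "e = (a q, b q) \<or> e = (b q, a q)" by (auto simp: edges_def)
  then have "q < n" using assms by blast
  then show "tail (diagram Q) e \<in> verts (diagram Q)" "head (diagram Q) e \<in> verts (diagram Q)"
    using q(2) strand_less[of q] strand_le[of q] by auto
qed

lemma edges_conn: "e \<in> edges Q \<Longrightarrow> conn Q (fst e) (snd e)"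
  unfolding conn_def by auto

text \<open>\<open>cas\<close> and, below, \<open>awalk_verts\<close> look at tail and head but not
  at the arc set. Hence a walk may be regarded in any subgraph that contains its arcs.\<close>

lemma cas_diagram: "cas_in Q = cas_in R"
proof (intro ext)
  fix u w v
  show "cas_in Q u w v = cas_in R u w v"
    by (induction w arbitrary: u) (auto simp: pre_digraph.cas.simps)
qed

lemma awalk_verts_diagram: "verts_in Q = verts_in R"
proof (intro ext)
  fix u w
  show "verts_in Q u w = verts_in R u w"
    by (induction w arbitrary: u) (auto simp: pre_digraph.awalk_verts.simps)
qed

lemma awalk_subset:
  "walk_in R u w v \<Longrightarrow> set w \<subseteq> edges Q \<Longrightarrow> walk_in Q u w v"
  unfolding pre_digraph.awalk_def cas_diagram[of Q R] by simp

lemma apath_mono: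
  assumes "Q \<subseteq> R" "path_in Q u w v"
  shows "path_in R u w v"
proof -
  have "edges Q \<subseteq> edges R" using assms(1) unfolding edges_def by blast
  then show ?thesis using assms(2)
    unfolding pre_digraph.apath_def pre_digraph.awalk_def cas_diagram[of R Q]
      awalk_verts_diagram[of R Q] by auto
qed

lemma awalk_verts_conn:
  assumes "cas_in Q u w v" "set w \<subseteq> edges Q"
    "x \<in> set (verts_in Q u w)"
  shows "conn Q u x"
  using assms
proof (induction w arbitrary: u)
  case Nil
  then show ?case by (simp add: pre_digraph.awalk_verts.simps)
next
  case (Cons e w)
  then have "conn Q u (snd e)" using edges_conn[of e Q] by (auto simp: pre_digraph.cas.simps)
  then show ?case using Cons conn_trans[of Q u "snd e" x]
    by (auto simp: pre_digraph.cas.simps pre_digraph.awalk_verts.simps)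
qed

lemma awalk_conn:
  assumes "Q \<subseteq> {..<n}" "walk_in Q u w v"
  shows "conn Q u v"
proof -
  interpret wf_digraph "diagram Q" by (rule wf_diagram[OF assms(1)])
  have "v \<in> set (awalk_verts u w)"
    using awlast_if_cas[of u w v] last_in_set[of "awalk_verts u w"] assms(2)
    unfolding awalk_def by auto
  then show ?thesis using awalk_verts_conn assms(2) unfolding awalk_def by auto
qed

lemma conn_apath:
  assumes Q: "Q \<subseteq> {..<n}" and "u \<le> n" "conn Q u v"
  shows "\<exists>w. path_in Q u w v"
proof -
  interpret wf_digraph "diagram Q" by (rule wf_diagram[OF Q])
  have "\<exists>w. awalk u w v" using assms(3,2) unfolding conn_def
  proof (induction rule: converse_rtrancl_induct)
    case base
    then have "awalk v [] v" by (simp add: awalk_Nil_iff)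
    then show ?case by blast
  next
    case (step y z)
    then have "z \<le> n" using wellformed(2)[of "(y, z)"] by simp
    then obtain w where "awalk z w v" using step by blast
    then have "awalk y ((y, z) # w) v" using step by (simp add: awalk_Cons_iff)
    then show ?case by blast
  qed
  then show ?thesis using apath_awalk_to_apath by blast
qed

text \<open>If two paths from u start with arcs to different vertices, their remainders avoid u and
  meet in v. Together with the first arc of the second path they join the ends of the strand of the
  first arc without using that strand, against \<open>not_conn_strand\<close>.\<close>

lemma apath_unique:
  assumes "path_in {..<n} u w v" "path_in {..<n} u w' v"
  shows "w = w'"
proof -
  interpret wf_digraph "diagram {..<n}" by (rule wf_diagram) simp
  \<comment> \<open>A walk that misses one end of strand p contains no arc of p.\<close>
  have avoid: "walk_in ({..<n} - {p}) x w v"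
    if w: "apath x w v" and p: "u \<notin> set (awalk_verts x w)" "u = a p \<or> u = b p" for u p x w
  proof (rule awalk_subset)
    show "awalk x w v" using w unfolding apath_def by blast
    show "set w \<subseteq> edges ({..<n} - {p})"
    proof
      fix f assume f: "f \<in> set w"
      then have "f \<in> edges {..<n}" using w unfolding apath_def awalk_def by auto
      then obtain r where r: "r < n" "f = (a r, b r) \<or> f = (b r, a r)" by (auto simp: edges_def)
      have "fst f \<in> set (awalk_verts x w)" "snd f \<in> set (awalk_verts x w)"
        using f w awalk_verts_arc1[of f w x] awalk_verts_arc2[of x w v f] unfolding apath_def awalk_def
          by auto
      then have "r \<noteq> p" using r p by auto
      then show "f \<in> edges ({..<n} - {p})" using r by (auto simp: edges_def)
    qed
  qed
  show ?thesis using assms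
  proof (induction w arbitrary: u w')
    case Nil
    then show ?case using apath_nonempty_ends[of u w' v] by (cases "w' = []") (auto simp: apath_Nil_iff)
  next
    case (Cons e es)
    then have "w' \<noteq> []" using apath_nonempty_ends[of u "e # es" v] by (auto simp: apath_Nil_iff)
    then obtain e' es' where w': "w' = e' # es'" by (cases w') auto
    have 1: "e \<in> edges {..<n}" "fst e = u" "apath (snd e) es v" "u \<notin> set (awalk_verts (snd e) es)"
      using Cons.prems(1) by (auto simp: apath_Cons_iff)
    have 2: "e' \<in> edges {..<n}" "fst e' = u" "apath (snd e') es' v" "u \<notin> set (awalk_verts (snd e') es')"
      using Cons.prems(2) by (auto simp: w' apath_Cons_iff)
    show ?case
    proof (cases "snd e = snd e'")
      case True
      then show ?thesis using Cons.IH[OF 1(3)] 2 1 w' by (auto simp: prod_eq_iff)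
    next
      case False
      from 1(1) obtain p where p: "p < n" "e = (a p, b p) \<or> e = (b p, a p)" by (auto simp: edges_def)
      let ?Q = "{..<n} - {p}"
      have up: "u = a p \<or> u = b p" using p 1(2) by auto
      have Q: "?Q \<subseteq> {..<n}" by auto
      have "conn ?Q (snd e) v" by (rule awalk_conn[OF Q avoid[OF 1(3,4) up]])
      moreover have "conn ?Q (snd e') v" by (rule awalk_conn[OF Q avoid[OF 2(3,4) up]])
      moreover have "e' \<in> edges ?Q"
      proof -
        from 2(1) obtain q where q: "q < n" "e' = (a q, b q) \<or> e' = (b q, a q)" by (auto simp: edges_def)
        have "q \<noteq> p" using p q 1(2) 2(2) False strand_less[OF p(1)] by auto
        then show ?thesis using q by (auto simp: edges_def)
      qed
      then have "conn ?Q u (snd e')" using edges_conn 2(2) by blast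
      ultimately have "conn ?Q (fst e) (snd e)" using 1(2) by (metis conn_sym conn_trans)
      then have "conn ?Q (a p) (b p)" using p(2) conn_sym by auto
      then show ?thesis using not_conn_strand[of ?Q p] p by auto
    qed
  qed
qed

lemma unique_path: "u \<le> n \<Longrightarrow> v \<le> n \<Longrightarrow> \<exists>!w. path_in {..<n} u w v"
  using conn_apath[OF order_refl _ conn_all] apath_unique by blast

text \<open>If \<open>b p\<close> reaches n without p, the path is strand p followed by a path from
  \<open>b p\<close>. Otherwise \<open>a p\<close> reaches n without p, and that path stays in the
  component of \<open>a p\<close>, which excludes \<open>b p\<close>.\<close>

lemma on_unique_path_iff:
  assumes p: "p < n" and w: "path_in {..<n} (a p) w n"
  shows "b p \<in> set (verts_in {..<n} (a p) w) \<longleftrightarrow>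
    conn ({..<n} - {p}) (b p) n"
proof -
  let ?Q = "{..<n} - {p}"
  have Q: "?Q \<subseteq> {..<n}" by auto
  have ab: "a p < b p" "b p \<le> n" using p strand_less strand_le by auto
  have nc: "\<not> conn ?Q (a p) (b p)" using not_conn_strand[of ?Q p] p by auto
  interpret wf_digraph "diagram {..<n}" by (rule wf_diagram) simp
  show ?thesis
  proof (cases "conn ?Q (b p) n")
    case True
    obtain w' where w': "path_in ?Q (b p) w' n"
      using conn_apath[OF Q _ True] ab by auto
    have "a p \<notin> set (awalk_verts (b p) w')"
    proof
      assume "a p \<in> set (awalk_verts (b p) w')"
      then have "conn ?Q (b p) (a p)"
        using awalk_verts_conn[of ?Q "b p" w' n "a p"] w' awalk_verts_diagram[of ?Q "{..<n}"]
        unfolding pre_digraph.apath_def pre_digraph.awalk_def by auto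
      then show False using nc conn_sym by blast
    qed
    moreover have "(a p, b p) \<in> edges {..<n}" using p by (auto simp: edges_def)
    ultimately have "apath (a p) ((a p, b p) # w') n"
      using apath_mono[OF Q w'] by (simp add: apath_Cons_iff)
    then have "w = (a p, b p) # w'" using apath_unique[OF w] by blast
    moreover have "b p \<in> set (awalk_verts (b p) w')"
      by (cases w') (use w' in \<open>auto simp: pre_digraph.apath_def pre_digraph.awalk_def pre_digraph.cas.simps\<close>)
    ultimately show ?thesis using True by simp
  next
    case False
    have "conn (insert p ?Q) (b p) n" using conn_all[of "b p" n] ab p by (simp add: insert_absorb insert_Diff)
    then have "conn ?Q (a p) n"
      using conn_insertD[of p ?Q "b p" n] False nc conn_sym[of ?Q "b p" "a p"] by auto
    then obtain w' where w': "path_in ?Q (a p) w' n"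
      using conn_apath[OF Q] ab by (meson less_imp_le order_trans)
    then have "w = w'" using apath_unique[OF w] apath_mono[OF Q w'] by blast
    then have "x \<in> set (awalk_verts (a p) w) \<Longrightarrow> conn ?Q (a p) x" for x
      using awalk_verts_conn[of ?Q "a p" w' n x] w' awalk_verts_diagram[of ?Q "{..<n}"]
      unfolding pre_digraph.apath_def pre_digraph.awalk_def by auto
    then show ?thesis using False nc by blast
  qed
qed

end

subsection \<open>Relatively projective objects\<close>

lemma (in strand_config) conn_transit_bij:
  assumes W: "is_rep n W" and Q: "Q \<subseteq> {..<n}"
    and bij: "\<And>q. q \<in> Q \<Longrightarrow> transit_bij n W (a q) (b q)"
    and c: "conn Q x y" and x: "x \<le> n"
  shows "transit_bij n W (min x y) (max x y)"
  using c unfolding conn_def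
proof (induction rule: rtrancl_induct)
  case base
  then show ?case by (simp add: transit_bij_refl)
next
  case (step y z)
  have y: "y \<le> n" using conn_le[of Q x y] step(1) x Q unfolding conn_def by blast
  from step(2) obtain q where q: "q \<in> Q" "(y, z) = (a q, b q) \<or> (y, z) = (b q, a q)"
    by (auto simp: edges_def)
  then have qn: "a q < b q" "b q \<le> n" using Q strand_less strand_le by auto
  have "transit_bij n W (min y z) (max y z)" "z \<le> n"
    using q(2) bij[OF q(1)] qn by (auto simp: min_def max_def)
  then show ?case using transit_bij_transitive[OF W x y] step.IH by blast
qed

lemma exceptional_sequence_intervals:
  assumes "exceptional_sequence n Es"
  shows "\<exists>a b. strand_config n a b \<and> (\<forall>p<n. rep_iso n (Es ! p) (interval_rep (a p) (b p)))"
proof -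
  note es = assms[unfolded exceptional_sequence_def]
  have rep: "is_rep n (Es ! p)" if "p < n" for p using es that unfolding indecomposable_def by auto
  have "\<forall>p. \<exists>ab. p < n \<longrightarrow> fst ab < snd ab \<and> snd ab \<le> n \<and> rep_iso n (Es ! p) (interval_rep (fst ab) (snd ab))"
  proof
    fix p
    show "\<exists>ab. p < n \<longrightarrow> fst ab < snd ab \<and> snd ab \<le> n \<and> rep_iso n (Es ! p) (interval_rep (fst ab) (snd ab))"
    proof (cases "p < n")
      case True
      then have "indecomposable n (Es ! p)" using es by auto
      from indecomposable_is_interval[OF this] show ?thesis by auto
    qed simp
  qed
  from choice[OF this] obtain ab where
    ab: "\<forall>p. p < n \<longrightarrow> fst (ab p) < snd (ab p) \<and> snd (ab p) \<le> n \<and> rep_iso n (Es ! p) (interval_rep (fst (ab p)) (snd (ab p)))"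
    by blast
  define a b where "a p = fst (ab p)" and "b p = snd (ab p)" for p
  have ab: "a p < b p" "b p \<le> n" "rep_iso n (Es ! p) (interval_rep (a p) (b p))" if "p < n" for p
    using ab that unfolding a_def b_def by auto
  have "strand_config n a b"
  proof
    fix q p assume qp: "q < p" "p < n"
    then have q: "q < n" by simp
    obtain f g where p1: "retraction n (interval_rep (a p) (b p)) (Es ! p) g f"
      by (rule rep_iso_retraction[OF ab(3)[OF qp(2)] rep[OF qp(2)] interval_is_rep])
    obtain f' g' where q1: "retraction n (interval_rep (a q) (b q)) (Es ! q) g' f'"
      by (rule rep_iso_retraction[OF ab(3)[OF q] rep[OF q] interval_is_rep])
    \<comment> \<open>Both arguments are carried over to interval modules, where the condition
      concerns end points only.\<close>
    have "Es ! q \<in> perp n (Es ! p)" using es qp rep[OF q] unfolding perp_def by auto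
    then have "Es ! q \<in> perp n (interval_rep (a p) (b p))" by (rule perp_retract_left[OF p1])
    then have "(interval_rep (a q) (b q) :: 'a rep) \<in> perp n (interval_rep (a p) (b p))"
      by (rule perp_retract_right[OF q1 interval_is_rep])
    then show "a p \<in> {a q..<b q} \<longleftrightarrow> b p \<in> {a q..<b q}"
      unfolding perp_interval_iff[OF ab(1,2)[OF qp(2)]]
      using interval_transit_bij_iff[OF ab(1,2)[OF qp(2)] ab(2)[OF q]] by blast
  qed (use ab in auto)
  then show ?thesis using ab(3) by blast
qed

context strand_config
begin

lemma strands_exceptional:
  fixes Es :: "'k::field rep list"
  assumes "length Es = n"
    and iso: "\<And>p. p < n \<Longrightarrow> rep_iso n (Es ! p) (interval_rep (a p) (b p))"
  shows "strands n (set Es) = (\<lambda>p. (a p, b p)) ` {..<n}"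
proof (intro equalityI subsetI)
  fix e assume "e \<in> strands n (set Es)"
  then obtain i j E where e: "e = (i, j)" "i < j" "j \<le> n" "E \<in> set Es" "rep_iso n E (interval_rep i j)"
    unfolding strands_def by blast
  then obtain p where p: "p < n" "E = Es ! p" using assms(1) by (auto simp: in_set_conv_nth)
  have "i = a p" "j = b p"
    using rep_iso_interval_unique[of n E i j "a p" "b p"] e p iso[OF p(1)] strand_less[OF p(1)] strand_le[OF p(1)]
    by auto
  then show "e \<in> (\<lambda>p. (a p, b p)) ` {..<n}" using e(1) p(1) by auto
next
  fix e assume "e \<in> (\<lambda>p. (a p, b p)) ` {..<n}"
  then obtain p where "p < n" "e = (a p, b p)" by auto
  then show "e \<in> strands n (set Es)"
    unfolding strands_def using strand_less[of p] strand_le[of p] iso[of p] assms(1) by auto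
qed

lemma strand_diagram_eq:
  assumes "strands n S = (\<lambda>p. (a p, b p)) ` {..<n}"
  shows "strand_diagram n S = diagram {..<n}"
  unfolding strand_diagram_def diagram_def assms by (auto simp: edges_def)

lemma relatively_projective_iff:
  fixes Es :: "'k::field rep list"
  assumes es: "exceptional_sequence n Es"
    and iso: "\<And>p. p < n \<Longrightarrow> rep_iso n (Es ! p) (interval_rep (a p) (b p))" and p: "p < n"
  shows "relatively_projective n Es p \<longleftrightarrow> conn ({..<n} - {p}) (b p) n"
proof -
  let ?M = "interval_rep (a p) (b p) :: 'k rep"
  note esd = es[unfolded exceptional_sequence_def]
  have len: "length Es = n" using esd by simp
  have rep: "is_rep n (Es ! q)" if "q < n" for q using esd that unfolding indecomposable_def by auto
  have perp: "perp n (Es ! q) = {W. is_rep n W \<and> transit_bij n W (a q) (b q)}" if q: "q < n" for q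
  proof -
    obtain f g where fg: "retraction n (Es ! q) (interval_rep (a q) (b q)) f g" "retraction n (interval_rep (a q) (b q)) (Es ! q) g f"
      by (rule rep_iso_retraction[OF iso[OF q] rep[OF q] interval_is_rep])
    have "W \<in> perp n (Es ! q) \<longleftrightarrow> W \<in> perp n (interval_rep (a q) (b q))" for W
      using perp_retract_left[OF fg(1)] perp_retract_left[OF fg(2)] by blast
    then show ?thesis using perp_interval_iff[OF strand_less[OF q] strand_le[OF q]] by auto
  qed
  let ?L = "later p" and ?V = "direct_sum_list (drop (Suc p) Es)"
  have L: "?L \<subseteq> {..<n}" unfolding later_def by auto
  have set: "set (drop (Suc p) Es) = (\<lambda>q. Es ! q) ` ?L"
  proof (intro equalityI subsetI)
    fix E assume "E \<in> set (drop (Suc p) Es)"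
    then obtain k where "k < length (drop (Suc p) Es)" "E = drop (Suc p) Es ! k" by (metis in_set_conv_nth)
    then show "E \<in> (\<lambda>q. Es ! q) ` ?L" using len
      by (intro image_eqI[of _ _ "Suc p + k"]) (auto simp: later_def)
  next
    fix E assume "E \<in> (\<lambda>q. Es ! q) ` ?L"
    then obtain q where q: "p < q" "q < n" "E = Es ! q" unfolding later_def by auto
    then have "E = drop (Suc p) Es ! (q - Suc p)" "q - Suc p < length (drop (Suc p) Es)" using len by auto
    then show "E \<in> set (drop (Suc p) Es)" using nth_mem by metis
  qed
  have reps: "\<forall>E\<in>set (drop (Suc p) Es). is_rep n E" unfolding set using rep L by auto
  have V: "is_rep n ?V" using direct_sum_list_perp[OF reps] by simp
  have C: "W \<in> perp n ?V \<longleftrightarrow> is_rep n W \<and> (\<forall>q\<in>?L. transit_bij n W (a q) (b q))" for W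
  proof -
    have "W \<in> perp n ?V \<longleftrightarrow> is_rep n W \<and> (\<forall>q\<in>?L. W \<in> perp n (Es ! q))"
      using direct_sum_list_perp[OF reps] unfolding set by simp
    also have "\<dots> \<longleftrightarrow> is_rep n W \<and> (\<forall>q\<in>?L. transit_bij n W (a q) (b q))"
      using perp L by auto
    finally show ?thesis .
  qed
  have Cint: "(interval_rep c d :: 'k rep) \<in> perp n ?V \<longleftrightarrow> (\<forall>q\<in>?L. a q \<in> {c..<d} \<longleftrightarrow> b q \<in> {c..<d})" if "d \<le> n" for c d
    unfolding C using interval_is_rep interval_transit_bij_iff[OF strand_less strand_le that] L by blast
  have abp: "a p < b p" "b p \<le> n" using strand_less[OF p] strand_le[OF p] by auto
  have M: "?M \<in> perp n ?V"
    unfolding Cint[OF abp(2)] using later_respects by (auto simp: later_def)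
  obtain f g where fg: "retraction n (Es ! p) ?M f g" "retraction n ?M (Es ! p) g f"
    by (rule rep_iso_retraction[OF iso[OF p] rep[OF p] interval_is_rep])
  have P: "Es ! p \<in> perp n ?V" by (rule perp_retract_right[OF fg(1) V M])
  have isr: "is_rep n X" if "X \<in> perp n ?V" for X using that C by blast
  \<comment> \<open>\<open>Es ! p\<close> and \<open>?M\<close> are retracts of each other, so
    projectivity passes both ways.\<close>
  have "relatively_projective n Es p \<longleftrightarrow> projective_in n (perp n ?V) ?M"
    unfolding relatively_projective_def
    using projective_in_retract[OF _ fg(2) M isr] projective_in_retract[OF _ fg(1) P isr] by blast
  also have "\<dots> \<longleftrightarrow> (\<exists>k<a p. conn ?L k (b p)) \<or> conn ?L (b p) n" (is "_ \<longleftrightarrow> ?R")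
  proof
    assume R: ?R
    show "projective_in n (perp n ?V) ?M"
    proof (rule projective_interval[OF V abp M])
      fix X Y :: "'k rep" and g u
      assume X: "X \<in> perp n ?V" and Y: "Y \<in> perp n ?V" and g: "rep_hom n X Y g"
        and u: "u \<in> colvecs (udim n X (a p))"
          and z: "transit n Y (a p) (b p) * (g (Suc (a p)) * u) = 0\<^sub>m (udim n Y (b p)) 1"
      have bij: "transit_bij n W (min x y) (max x y)" if "W \<in> perp n ?V" "conn ?L x y" "x \<le> n" for W x y
        by (rule conn_transit_bij[OF isr[OF that(1)] L _ that(2,3)]) (use that(1) C in blast)
      show "\<exists>v\<in>colvecs (udim n X (a p)). g (Suc (a p)) * v = g (Suc (a p)) * u \<and>
        transit n X (a p) (b p) * v = 0\<^sub>m (udim n X (b p)) 1"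
      proof (cases "conn ?L (b p) n")
        case True
        \<comment> \<open>The relation at \<open>b p\<close> then takes values in a zero space, and
          u itself serves as the lift.\<close>
        have "transit_bij n X (b p) n" using bij[OF X True abp(2)] abp(2)
          by (simp add: min_absorb1 max_absorb2)
        then have "transit n X (a p) (b p) * u = 0\<^sub>m (udim n X (b p)) 1"
          by (rule transit_bij_to_top[OF isr[OF X] abp(2)])
            (rule transit_colvecs[OF isr[OF X] less_imp_le[OF abp(1)] abp(2) u])
        then show ?thesis using u by blast
      next
        case False
        then have "b p < n" using abp(2) by (cases "b p = n") auto
        obtain k where k: "k < a p" "conn ?L k (b p)" using R False by blast
        have kb: "k \<le> b p" "k \<le> n" using k abp by auto
        have "transit_bij n X k (b p)" "transit_bij n Y k (b p)"
          using bij[OF X k(2) kb(2)] bij[OF Y k(2) kb(2)] kb(1) by (simp_all add: min_absorb1 max_absorb2)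
        then show ?thesis by (rule lift_by_transit_bij[OF isr[OF X] isr[OF Y] g k(1) abp(1) \<open>b p < n\<close> _ _ u z])
      qed
    qed
  next
    assume prj: "projective_in n (perp n ?V) ?M"
    show ?R
    proof (rule ccontr)
      assume nr: "\<not> ?R"
      then have min: "b p \<le> k" if "conn ?L k (b p)" for k
        using later_component_ge that by blast
      have nn: "\<not> conn ?L (b p) n" using nr by simp
      obtain m where m: "b p \<le> m" "m < n"
        and cl: "\<forall>q\<in>?L. a q \<in> {a p..m} \<longleftrightarrow> b q \<in> {a p..m}"
        using component_interval[OF p min nn] by blast
      have mn: "Suc m \<le> n" using m by simp
      \<comment> \<open>In shifted vertices this module occupies \<open>[a p, Suc m)\<close>, that
        is \<open>[a p, m]\<close>.\<close>
      have "(interval_rep (a p) (Suc m) :: 'k rep) \<in> perp n ?V"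
        using cl unfolding Cint[OF mn] atLeastLessThanSuc_atLeastAtMost .
      then show False using not_projective_interval[OF abp(1) m _ M] prj by blast
    qed
  qed
  also have "\<dots> \<longleftrightarrow> conn ({..<n} - {p}) (b p) n" using conn_target_iff[OF p] by simp
  finally show ?thesis .
qed

end

text \<open>The path condition mentions S but no sequence, so quantifying over all orderings of S
  also yields that relative projectivity does not depend on the ordering.\<close>

theorem corollary6p8:
  fixes n :: nat and S :: "'k::field rep set" and i j :: nat
  assumes "n \<ge> 1"
    and "exceptional_set n S"
    and "(i, j) \<in> strands n S"
  shows "(\<exists>!w. is_strand_path n S i w n) \<and>
    (\<forall>Es p. exceptional_sequence n Es \<longrightarrow> set Es = S \<longrightarrow> p < n \<longrightarrow>
       rep_iso n (Es ! p) (interval_rep i j) \<longrightarrow>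
       (relatively_projective n Es p \<longleftrightarrow>
        j \<in> path_vertices n S i (THE w. is_strand_path n S i w n)))"
proof -
  have ij: "i < j" "j \<le> n" using assms(3) unfolding strands_def by auto
  have main: "(\<exists>!w. is_strand_path n S i w n) \<and> (\<forall>p<n. rep_iso n (Es ! p) (interval_rep i j) \<longrightarrow>
      (relatively_projective n Es p \<longleftrightarrow> j \<in> path_vertices n S i (THE w. is_strand_path n S i w n)))"
    if es: "exceptional_sequence n Es" and S: "set Es = S" for Es
  proof -
    obtain a b where ab: "strand_config n a b" and iso: "\<forall>p<n. rep_iso n (Es ! p) (interval_rep (a p) (b p))"
      using exceptional_sequence_intervals[OF es] by blast
    interpret strand_config n a b by (rule ab)
    have "strands n S = (\<lambda>p. (a p, b p)) ` {..<n}"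
      unfolding S[symmetric] by (rule strands_exceptional) (use es iso in \<open>auto simp: exceptional_sequence_def\<close>)
    then have diag: "strand_diagram n S = diagram {..<n}" by (rule strand_diagram_eq)
    have path: "is_strand_path n S i w n \<longleftrightarrow> pre_digraph.apath (diagram {..<n}) i w n" for w
      unfolding is_strand_path_def diag ..
    have ex1: "\<exists>!w. is_strand_path n S i w n"
      unfolding path by (rule unique_path) (use ij in auto)
    from theI'[OF this] have the: "pre_digraph.apath (diagram {..<n}) i (THE w. is_strand_path n S i w n) n"
      unfolding path .
    have "relatively_projective n Es p \<longleftrightarrow> j \<in> path_vertices n S i (THE w. is_strand_path n S i w n)"
      if p: "p < n" and isop: "rep_iso n (Es ! p) (interval_rep i j)" for p
    proof -
      have "i = a p" "j = b p"
        using rep_iso_interval_unique[OF isop _ ij strand_less[OF p] strand_le[OF p]] iso p by auto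
      then show ?thesis
        using relatively_projective_iff[OF es _ p] iso on_unique_path_iff[OF p, of "THE w. is_strand_path n S i w n"] the
        unfolding path_vertices_def diag by simp
    qed
    then show ?thesis using ex1 by blast
  qed
  \<comment> \<open>Uniqueness of the path is a statement about S alone; some ordering is chosen to
    obtain it from \<open>main\<close>.\<close>
  obtain Es where "exceptional_sequence n Es" "set Es = S" using assms(2) unfolding exceptional_set_def by blast
  then show ?thesis using main by blast
qed

end
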